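(* Let $M,N$ be cyber-physical systems of the calculus described in the context. Then: (1) if $M\approx N$ then $M\uplus O\approx N\uplus O$ for every CPS $O$ physically disjoint from $M$ and $N$; (2) if $M\approx N$ then $M\parallel P\approx N\parallel P$ for every pure-logical process $P$; (3) if $M\approx N$ then $M\backslash c\approx N\backslash c$ for every channel $c$.
   Context: The calculus. Fix pairwise disjoint sets of state variables $\mathsf X$, sensors $\mathsf S$, actuators $\mathsf A$ and channels; values include reals, Booleans and names. $\mathbb R^{\mathsf N}$ is the set of functions $\mathsf N\to\mathbb R$; $\xi[n\mapsto v]$ is update. Distributions are finite-support; $\overline{o}$ is the Dirac distribution; a sub-distribution $\gamma$ has mass $|\gamma|=\sum_o\gamma(o)\in(0,1]$. A physical state is $S=\langle\xi_x,\xi_s,\xi_a\rangle$, $\xi_x\in\mathbb R^{\mathsf X}$, $\xi_s\in\mathbb R^{\mathsf S}$, $\xi_a\in\mathbb R^{\mathsf A}$. A physical environment is $E=\langle \mathit{evol},\mathit{meas},\mathit{inv}\rangle$, $\mathit{evol}:\mathbb R^{\mathsf X}\times\mathbb R^{\mathsf A}\to\mathcal D(\mathbb R^{\mathsf X})$, $\mathit{meas}:\mathbb R^{\mathsf X}\to\mathcal D(\mathbb R^{\mathsf S})$, $\mathit{inv}\subseteq\mathbb R^{\mathsf X}$; $S\in\mathit{inv}$ means $\xi_x\in\mathit{inv}$. $\mathit{next}_E(S)=\sum_{\xi'_x,\xi'_s}\mathit{evol}(\xi_x,\xi_a)(\xi'_x)\cdot\mathit{meas}(\xi'_x)(\xi'_s)\cdot\overline{\langle\xi'_x,\xi'_s,\xi_a\rangle}$.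 Processes: $P::=\mathsf{nil}\mid \mathsf{tick}.C\mid P\parallel Q\mid \lfloor \mathit{chn}.C\rfloor D\mid \mathit{phy}.C\mid \mathsf{if}\ b\ \mathsf{then}\ P\ \mathsf{else}\ Q\mid P\backslash c\mid X\mid \mathsf{fix}\,X.P$; $C,D::=\bigoplus_{i\in I}p_i{:}P_i$ (finite, probabilities summing to 1); $\mathit{chn}::= c!v\mid c?(x)$; $\mathit{phy}::=\mathsf{read}\ s(x)\mid \mathsf{write}\ a\langle v\rangle$; recursion is time-guarded, processes closed, conditionals identified with the selected branch. $[\![\bigoplus_i p_i{:}P_i]\!]=\sum_ip_i\overline{P_i}$; $\parallel$, $\backslash c$, $\{v/x\}$ lifted to distributions pointwise (product for $\parallel$). Process transitions: $\lfloor c!v.C\rfloor D\xrightarrow{c!v}[\![C]\!]$; $\lfloor c?(x).C\rfloor D\xrightarrow{c?v}[\![C]\!]\{v/x\}$; $\mathsf{write}\ a\langle v\rangle.C\xrightarrow{a!v}[\![C]\!]$; $\mathsf{read}\ s(x).C\xrightarrow{s?x}[\![C]\!]$; complementary $c!v$/$c?v$ moves of $P_1,P_2$ give $P_1\parallel P_2\xrightarrow{\tau}\pi_1\parallel\pi_2$; non-$\mathsf{tick}$ moves of a component propagate through $\parallel$ (other component Dirac); moves other than $c!v,c?v$ propagate through $\backslash c$; recursion unfolds; $\mathsf{nil}\xrightarrow{\mathsf{tick}}\overline{\mathsf{nil}}$; $\mathsf{tick}.C\xrightarrow{\mathsf{tick}}[\![C]\!]$; $\lfloor\mathit{chn}.C\rfloor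 D\xrightarrow{\mathsf{tick}}[\![D]\!]$; $P_1\parallel P_2\xrightarrow{\mathsf{tick}}\pi_1\parallel\pi_2$ if both components tick and $P_1\parallel P_2$ has no $\tau$-move. CPSs are well-formed $E;S\rhd P$ (sensors/actuators of $P$ in the domains of $\xi_s,\xi_a$), plus a special CPS $\mathsf{Dead}$ with no transitions. Rules (actions $\tau,c!v,c?v,\mathsf{tick}$): if $P\xrightarrow{\alpha}\pi$, $\alpha\in\{c!v,c?v,\tau\}$, $S\in\mathit{inv}$ then $E;S\rhd P\xrightarrow{\alpha}E;\overline S\rhd\pi$; if $P\xrightarrow{s?z}\pi$, $S\in\mathit{inv}$ then $E;S\rhd P\xrightarrow{\tau}E;\overline S\rhd\pi\{\xi_s(s)/z\}$; if $P\xrightarrow{a!v}\pi$, $S\in\mathit{inv}$ then $\xrightarrow{\tau}E;\overline{\langle\xi_x,\xi_s,\xi_a[a\mapsto v]\rangle}\rhd\pi$; if $P\xrightarrow{\mathsf{tick}}\pi$, no $\tau$-move of $E;S\rhd P$, $S\in\mathit{inv}$ then $\xrightarrow{\mathsf{tick}}E;\mathit{next}_E(S)\rhd\pi$; if $S\notin\mathit{inv}$ then $E;S\rhd P\xrightarrow{\tau}\overline{\mathsf{Dead}}$. ($E;\sigma\rhd\pi$ denotes the product distribution.) Weak transitions: $M\xrightarrow{\hat\tau}\gamma$ iff $M\xrightarrow{\tau}\gamma$ or $\gamma=\overline M$; for $\alpha\neq\tau$, $M\xrightarrow{\hat\alpha}\gamma$ iff $M\xrightarrow{\alpha}\gamma$.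 For $\gamma=\sum_{i\in I}p_i\overline{M_i}$, $\gamma\xrightarrow{\hat\alpha}\sum_{j\in J}p_j\gamma_j$ if $\emptyset\neq J\subseteq I$, $M_j\xrightarrow{\hat\alpha}\gamma_j$ for $j\in J$ and $M_i$ has no $\hat\alpha$-move for $i\notin J$. $\stackrel{\hat\tau}{\Longrightarrow}$ is the reflexive-transitive closure of $\xrightarrow{\hat\tau}$, and for $\alpha\neq\tau$, $\stackrel{\hat\alpha}{\Longrightarrow}=\stackrel{\hat\tau}{\Longrightarrow}\xrightarrow{\hat\alpha}\stackrel{\hat\tau}{\Longrightarrow}$. A matching for distributions $(\gamma,\gamma')$ is a distribution $\omega$ on pairs whose marginals are $\gamma$ and $\gamma'$. A symmetric relation $\mathcal R$ on CPSs is a weak probabilistic bisimulation if $M\,\mathcal R\,N$ and $M\xrightarrow{\alpha}\gamma$ imply $N\stackrel{\hat\alpha}{\Longrightarrow}\gamma'$ for some $\gamma'$ with a matching $\omega$ of $(\gamma,\gamma')$ such that $\omega(M',N')>0$ implies $M'\,\mathcal R\,N'$. $M\approx N$ iff some weak probabilistic bisimulation relates them. Physical disjointness: $M_i=E_i;S_i\rhd P_i$ ($i=1,2$) are physically disjoint if their sets of state variables, sensors and actuators are disjoint; then $M_1\uplus M_2=(E_1\uplus E_2);(S_1\uplus S_2)\rhd(P_1\parallel P_2)$, where $S_1\uplus S_2$ is componentwise disjoint union of functions, and $E_1\uplus E_2$ has $\mathit{evol}(\xi^1_x\uplus\xi^2_x,\xi^1_a\uplus\xi^2_a)(\xi'^1_x\uplus\xi'^2_x)=\mathit{evol}^1(\xi^1_x,\xi^1_a)(\xi'^1_x)\cdot\mathit{evol}^2(\xi^2_x,\xi^2_a)(\xi'^2_x)$,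 $\mathit{meas}(\xi^1_x\uplus\xi^2_x)(\xi'^1_s\uplus\xi'^2_s)=\mathit{meas}^1(\xi^1_x)(\xi'^1_s)\cdot\mathit{meas}^2(\xi^2_x)(\xi'^2_s)$, and $\xi^1_x\uplus\xi^2_x\in\mathit{inv}$ iff $\xi^i_x\in\mathit{inv}^i$ for both $i$. $\mathsf{Dead}$ is physically disjoint from every $M$, with $M\uplus\mathsf{Dead}=\mathsf{Dead}\uplus M=\mathsf{Dead}$. A process is pure-logical if it contains no $\mathsf{read}$ or $\mathsf{write}$ prefixes. For $M=E;S\rhd P$: $M\parallel Q=E;S\rhd(P\parallel Q)$ and $M\backslash c=E;S\rhd(P\backslash c)$. *)

theory Defs
  imports "HOL-Probability.SPMF"
begin

section \<open>Values, terms and processes\<close>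

text \<open>
  State variables, sensors, actuators and channels are the elements of the types
  \<open>'x\<close>, \<open>'s\<close>, \<open>'a\<close> and \<open>'c\<close>, hence pairwise disjoint.  A particular system owns
  subsets of the first three.
\<close>

datatype ('x, 's, 'a, 'c) val =
  Real real | Bool bool | XName 'x | SName 's | AName 'a | CName 'c

text \<open>
  Actuators hold reals.  A write of a non-real value is ill-typed in the calculus; it is given a
  default meaning so that it neither blocks nor needs a type discipline for received values.
\<close>

fun to_real :: "('x, 's, 'a, 'c) val \<Rightarrow> real" where
  "to_real (Real r) = r"
| "to_real (Bool b) = of_bool b"
| "to_real _ = 0"

type_synonym var = nat

datatype ('x, 's, 'a, 'c) tm = Val "('x, 's, 'a, 'c) val" | Var var

text \<open>A Boolean guard is an arbitrary total predicate applied to a list of terms.\<close>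

datatype ('x, 's, 'a, 'c) guard = Guard "('x, 's, 'a, 'c) val list \<Rightarrow> bool" "('x, 's, 'a, 'c) tm list"

datatype ('x, 's, 'a, 'c) chn = Out 'c "('x, 's, 'a, 'c) tm" | In 'c var

datatype ('x, 's, 'a, 'c) phy = Read 's var | Write 'a "('x, 's, 'a, 'c) tm"

type_synonym pvar = nat

text \<open>
  The list \<open>[(P\<^sub>1, p\<^sub>1), \<dots>, (P\<^sub>n, p\<^sub>n)]\<close> is the probabilistic choice of the \<open>P\<^sub>i\<close> with weights \<open>p\<^sub>i\<close>;
  \<open>PTimeout chn C D\<close> is \<open>\<lfloor>chn.C\<rfloor>D\<close>.
\<close>

datatype ('x, 's, 'a, 'c) proc =
  PNil
| PTick "(('x, 's, 'a, 'c) proc \<times> real) list"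
| PPar "('x, 's, 'a, 'c) proc" "('x, 's, 'a, 'c) proc"
| PTimeout "('x, 's, 'a, 'c) chn" "(('x, 's, 'a, 'c) proc \<times> real) list"
    "(('x, 's, 'a, 'c) proc \<times> real) list"
| PPhy "('x, 's, 'a, 'c) phy" "(('x, 's, 'a, 'c) proc \<times> real) list"
| PIf "('x, 's, 'a, 'c) guard" "('x, 's, 'a, 'c) proc" "('x, 's, 'a, 'c) proc"
| PRes "('x, 's, 'a, 'c) proc" 'c
| PVar pvar
| PFix pvar "('x, 's, 'a, 'c) proc"

type_synonym ('x, 's, 'a, 'c) choice = "(('x, 's, 'a, 'c) proc \<times> real) list"


subsection \<open>Free variables and substitution\<close>

fun fv_tm :: "('x, 's, 'a, 'c) tm \<Rightarrow> var set" where
  "fv_tm (Val v) = {}"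
| "fv_tm (Var x) = {x}"

fun subst_tm :: "('x, 's, 'a, 'c) val \<Rightarrow> var \<Rightarrow> ('x, 's, 'a, 'c) tm \<Rightarrow> ('x, 's, 'a, 'c) tm" where
  "subst_tm v x (Val w) = Val w"
| "subst_tm v x (Var y) = (if y = x then Val v else Var y)"

fun fv_guard :: "('x, 's, 'a, 'c) guard \<Rightarrow> var set" where
  "fv_guard (Guard p ts) = (\<Union>t\<in>set ts. fv_tm t)"

fun subst_guard ::
  "('x, 's, 'a, 'c) val \<Rightarrow> var \<Rightarrow> ('x, 's, 'a, 'c) guard \<Rightarrow> ('x, 's, 'a, 'c) guard" where
  "subst_guard v x (Guard p ts) = Guard p (map (subst_tm v x) ts)"

text \<open>\<open>eval_tm\<close> is unspecified on variables; only closed guards are ever evaluated.\<close>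

fun eval_tm :: "('x, 's, 'a, 'c) tm \<Rightarrow> ('x, 's, 'a, 'c) val" where
  "eval_tm (Val v) = v"
| "eval_tm (Var x) = undefined"

fun eval_guard :: "('x, 's, 'a, 'c) guard \<Rightarrow> bool" where
  "eval_guard (Guard p ts) = p (map eval_tm ts)"

fun fv :: "('x, 's, 'a, 'c) proc \<Rightarrow> var set" where
  "fv PNil = {}"
| "fv (PTick C) = (\<Union>(P, p)\<in>set C. fv P)"
| "fv (PPar P Q) = fv P \<union> fv Q"
| "fv (PTimeout (Out c t) C D) = fv_tm t \<union> (\<Union>(P, p)\<in>set C. fv P) \<union> (\<Union>(P, p)\<in>set D. fv P)"
| "fv (PTimeout (In c x) C D) = ((\<Union>(P, p)\<in>set C. fv P) - {x}) \<union> (\<Union>(P, p)\<in>set D. fv P)"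
| "fv (PPhy (Read s x) C) = (\<Union>(P, p)\<in>set C. fv P) - {x}"
| "fv (PPhy (Write a t) C) = fv_tm t \<union> (\<Union>(P, p)\<in>set C. fv P)"
| "fv (PIf b P Q) = fv_guard b \<union> fv P \<union> fv Q"
| "fv (PRes P c) = fv P"
| "fv (PVar X) = {}"
| "fv (PFix X P) = fv P"

fun subst ::
  "('x, 's, 'a, 'c) val \<Rightarrow> var \<Rightarrow> ('x, 's, 'a, 'c) proc \<Rightarrow> ('x, 's, 'a, 'c) proc" where
  "subst v x PNil = PNil"
| "subst v x (PTick C) = PTick (map (\<lambda>(P, p). (subst v x P, p)) C)"
| "subst v x (PPar P Q) = PPar (subst v x P) (subst v x Q)"
| "subst v x (PTimeout (Out c t) C D) =
     PTimeout (Out c (subst_tm v x t))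
       (map (\<lambda>(P, p). (subst v x P, p)) C) (map (\<lambda>(P, p). (subst v x P, p)) D)"
| "subst v x (PTimeout (In c y) C D) =
     PTimeout (In c y)
       (if y = x then C else map (\<lambda>(P, p). (subst v x P, p)) C) (map (\<lambda>(P, p). (subst v x P, p)) D)"
| "subst v x (PPhy (Read s y) C) =
     PPhy (Read s y) (if y = x then C else map (\<lambda>(P, p). (subst v x P, p)) C)"
| "subst v x (PPhy (Write a t) C) =
     PPhy (Write a (subst_tm v x t)) (map (\<lambda>(P, p). (subst v x P, p)) C)"
| "subst v x (PIf b P Q) = PIf (subst_guard v x b) (subst v x P) (subst v x Q)"
| "subst v x (PRes P c) = PRes (subst v x P) c"
| "subst v x (PVar X) = PVar X"
| "subst v x (PFix X P) = PFix X (subst v x P)"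

fun fpv :: "('x, 's, 'a, 'c) proc \<Rightarrow> pvar set" where
  "fpv PNil = {}"
| "fpv (PTick C) = (\<Union>(P, p)\<in>set C. fpv P)"
| "fpv (PPar P Q) = fpv P \<union> fpv Q"
| "fpv (PTimeout h C D) = (\<Union>(P, p)\<in>set C. fpv P) \<union> (\<Union>(P, p)\<in>set D. fpv P)"
| "fpv (PPhy h C) = (\<Union>(P, p)\<in>set C. fpv P)"
| "fpv (PIf b P Q) = fpv P \<union> fpv Q"
| "fpv (PRes P c) = fpv P"
| "fpv (PVar X) = {X}"
| "fpv (PFix X P) = fpv P - {X}"

text \<open>
  \<open>psubst R X P\<close> replaces the free occurrences of \<open>X\<close> in \<open>P\<close> by \<open>R\<close>.  It does not rename
  binders: it is only used to unfold closed processes \<open>PFix X P\<close>, where \<open>R = PFix X P\<close> has no free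
  variables that could be captured.
\<close>

fun psubst ::
  "('x, 's, 'a, 'c) proc \<Rightarrow> pvar \<Rightarrow> ('x, 's, 'a, 'c) proc \<Rightarrow> ('x, 's, 'a, 'c) proc" where
  "psubst R X PNil = PNil"
| "psubst R X (PTick C) = PTick (map (\<lambda>(P, p). (psubst R X P, p)) C)"
| "psubst R X (PPar P Q) = PPar (psubst R X P) (psubst R X Q)"
| "psubst R X (PTimeout h C D) =
     PTimeout h (map (\<lambda>(P, p). (psubst R X P, p)) C) (map (\<lambda>(P, p). (psubst R X P, p)) D)"
| "psubst R X (PPhy h C) = PPhy h (map (\<lambda>(P, p). (psubst R X P, p)) C)"
| "psubst R X (PIf b P Q) = PIf b (psubst R X P) (psubst R X Q)"
| "psubst R X (PRes P c) = PRes (psubst R X P) c"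
| "psubst R X (PVar Y) = (if Y = X then R else PVar Y)"
| "psubst R X (PFix Y P) = (if Y = X then PFix Y P else PFix Y (psubst R X P))"


subsection \<open>Syntactic conditions\<close>

text \<open>
  \<open>time_guarded X P\<close>: every free occurrence of \<open>X\<close> in \<open>P\<close> lies in the continuation of a
  \<open>tick\<close> prefix or in the time-out branch \<open>D\<close> of some \<open>\<lfloor>chn.C\<rfloor>D\<close>.
\<close>

fun time_guarded :: "pvar \<Rightarrow> ('x, 's, 'a, 'c) proc \<Rightarrow> bool" where
  "time_guarded X PNil \<longleftrightarrow> True"
| "time_guarded X (PTick C) \<longleftrightarrow> True"
| "time_guarded X (PPar P Q) \<longleftrightarrow> time_guarded X P \<and> time_guarded X Q"
| "time_guarded X (PTimeout h C D) \<longleftrightarrow> (\<forall>(P, p)\<in>set C. time_guarded X P)"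
| "time_guarded X (PPhy h C) \<longleftrightarrow> (\<forall>(P, p)\<in>set C. time_guarded X P)"
| "time_guarded X (PIf b P Q) \<longleftrightarrow> time_guarded X P \<and> time_guarded X Q"
| "time_guarded X (PRes P c) \<longleftrightarrow> time_guarded X P"
| "time_guarded X (PVar Y) \<longleftrightarrow> Y \<noteq> X"
| "time_guarded X (PFix Y P) \<longleftrightarrow> Y = X \<or> time_guarded X P"

text \<open>
  \<open>pmf_of_list_wf C\<close> states that the weights in \<open>C\<close> are nonnegative and sum up to 1.
\<close>

fun ok_proc :: "('x, 's, 'a, 'c) proc \<Rightarrow> bool" where
  "ok_proc PNil \<longleftrightarrow> True"
| "ok_proc (PTick C) \<longleftrightarrow> pmf_of_list_wf C \<and> (\<forall>(P, p)\<in>set C. ok_proc P)"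
| "ok_proc (PPar P Q) \<longleftrightarrow> ok_proc P \<and> ok_proc Q"
| "ok_proc (PTimeout h C D) \<longleftrightarrow> pmf_of_list_wf C \<and> pmf_of_list_wf D \<and>
     (\<forall>(P, p)\<in>set C. ok_proc P) \<and> (\<forall>(P, p)\<in>set D. ok_proc P)"
| "ok_proc (PPhy h C) \<longleftrightarrow> pmf_of_list_wf C \<and> (\<forall>(P, p)\<in>set C. ok_proc P)"
| "ok_proc (PIf b P Q) \<longleftrightarrow> ok_proc P \<and> ok_proc Q"
| "ok_proc (PRes P c) \<longleftrightarrow> ok_proc P"
| "ok_proc (PVar X) \<longleftrightarrow> True"
| "ok_proc (PFix X P) \<longleftrightarrow> time_guarded X P \<and> ok_proc P"

definition wf_proc :: "('x, 's, 'a, 'c) proc \<Rightarrow> bool" where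
  "wf_proc P \<longleftrightarrow> ok_proc P \<and> fv P = {} \<and> fpv P = {}"

text \<open>The physical prefixes, at any depth, of a process.\<close>

fun phys :: "('x, 's, 'a, 'c) proc \<Rightarrow> ('x, 's, 'a, 'c) phy set" where
  "phys PNil = {}"
| "phys (PTick C) = (\<Union>(P, p)\<in>set C. phys P)"
| "phys (PPar P Q) = phys P \<union> phys Q"
| "phys (PTimeout h C D) = (\<Union>(P, p)\<in>set C. phys P) \<union> (\<Union>(P, p)\<in>set D. phys P)"
| "phys (PPhy h C) = {h} \<union> (\<Union>(P, p)\<in>set C. phys P)"
| "phys (PIf b P Q) = phys P \<union> phys Q"
| "phys (PRes P c) = phys P"
| "phys (PVar X) = {}"
| "phys (PFix X P) = phys P"

definition sensors :: "('x, 's, 'a, 'c) proc \<Rightarrow> 's set" where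
  "sensors P = {s. \<exists>x. Read s x \<in> phys P}"

definition actuators :: "('x, 's, 'a, 'c) proc \<Rightarrow> 'a set" where
  "actuators P = {a. \<exists>t. Write a t \<in> phys P}"

definition pure_logical :: "('x, 's, 'a, 'c) proc \<Rightarrow> bool" where
  "pure_logical P \<longleftrightarrow> phys P = {}"


section \<open>Process transitions\<close>

datatype ('x, 's, 'a, 'c) act =
  Tau | Snd 'c "('x, 's, 'a, 'c) val" | Rcv 'c "('x, 's, 'a, 'c) val" | Tick

datatype ('x, 's, 'a, 'c) plabel =
  Act "('x, 's, 'a, 'c) act" | Rd 's var | Wr 'a "('x, 's, 'a, 'c) val"

definition par_pmf ::
  "('x, 's, 'a, 'c) proc pmf \<Rightarrow> ('x, 's, 'a, 'c) proc pmf \<Rightarrow> ('x, 's, 'a, 'c) proc pmf" where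
  "par_pmf \<pi>\<^sub>1 \<pi>\<^sub>2 = map_pmf (\<lambda>(P, Q). PPar P Q) (pair_pmf \<pi>\<^sub>1 \<pi>\<^sub>2)"

text \<open>
  The instantaneous moves never depend on \<open>tick\<close> moves, whereas the latter have a negative premise
  on \<open>\<tau>\<close> moves; so the two kinds are defined one after the other.  \<open>pmf_of_list\<close> sends the
  choice \<open>C\<close> to the distribution \<open>\<lbrakk>C\<rbrakk>\<close>.  A closed conditional has exactly the moves of the selected
  branch.
\<close>

inductive pstep ::
  "('x, 's, 'a, 'c) proc \<Rightarrow> ('x, 's, 'a, 'c) plabel \<Rightarrow> ('x, 's, 'a, 'c) proc pmf \<Rightarrow> bool" where
  Out: "pstep (PTimeout (Out c (Val v)) C D) (Act (Snd c v)) (pmf_of_list C)"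
| In: "pstep (PTimeout (In c x) C D) (Act (Rcv c v)) (map_pmf (subst v x) (pmf_of_list C))"
| Write: "pstep (PPhy (Write a (Val v)) C) (Wr a v) (pmf_of_list C)"
| Read: "pstep (PPhy (Read s x) C) (Rd s x) (pmf_of_list C)"
| ComL: "pstep P (Act (Snd c v)) \<pi>\<^sub>1 \<Longrightarrow> pstep Q (Act (Rcv c v)) \<pi>\<^sub>2 \<Longrightarrow>
     pstep (PPar P Q) (Act Tau) (par_pmf \<pi>\<^sub>1 \<pi>\<^sub>2)"
| ComR: "pstep P (Act (Rcv c v)) \<pi>\<^sub>1 \<Longrightarrow> pstep Q (Act (Snd c v)) \<pi>\<^sub>2 \<Longrightarrow>
     pstep (PPar P Q) (Act Tau) (par_pmf \<pi>\<^sub>1 \<pi>\<^sub>2)"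
| ParL: "pstep P l \<pi> \<Longrightarrow> pstep (PPar P Q) l (par_pmf \<pi> (return_pmf Q))"
| ParR: "pstep Q l \<pi> \<Longrightarrow> pstep (PPar P Q) l (par_pmf (return_pmf P) \<pi>)"
| Res: "pstep P l \<pi> \<Longrightarrow> (\<And>v. l \<noteq> Act (Snd c v)) \<Longrightarrow> (\<And>v. l \<noteq> Act (Rcv c v)) \<Longrightarrow>
     pstep (PRes P c) l (map_pmf (\<lambda>P'. PRes P' c) \<pi>)"
| Fix: "pstep (psubst (PFix X P) X P) l \<pi> \<Longrightarrow> pstep (PFix X P) l \<pi>"
| IfT: "pstep P l \<pi> \<Longrightarrow> eval_guard b \<Longrightarrow> pstep (PIf b P Q) l \<pi>"
| IfF: "pstep Q l \<pi> \<Longrightarrow> \<not> eval_guard b \<Longrightarrow> pstep (PIf b P Q) l \<pi>"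

inductive ptick :: "('x, 's, 'a, 'c) proc \<Rightarrow> ('x, 's, 'a, 'c) proc pmf \<Rightarrow> bool" where
  Nil: "ptick PNil (return_pmf PNil)"
| Tick: "ptick (PTick C) (pmf_of_list C)"
| Timeout: "ptick (PTimeout h C D) (pmf_of_list D)"
| Par: "ptick P \<pi>\<^sub>1 \<Longrightarrow> ptick Q \<pi>\<^sub>2 \<Longrightarrow> (\<nexists>\<pi>. pstep (PPar P Q) (Act Tau) \<pi>) \<Longrightarrow>
     ptick (PPar P Q) (par_pmf \<pi>\<^sub>1 \<pi>\<^sub>2)"
| Res: "ptick P \<pi> \<Longrightarrow> ptick (PRes P c) (map_pmf (\<lambda>P'. PRes P' c) \<pi>)"
| Fix: "ptick (psubst (PFix X P) X P) \<pi> \<Longrightarrow> ptick (PFix X P) \<pi>"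
| IfT: "ptick P \<pi> \<Longrightarrow> eval_guard b \<Longrightarrow> ptick (PIf b P Q) \<pi>"
| IfF: "ptick Q \<pi> \<Longrightarrow> \<not> eval_guard b \<Longrightarrow> ptick (PIf b P Q) \<pi>"


section \<open>Cyber-physical systems\<close>

text \<open>\<open>fun_space N\<close> is the set of functions from \<open>N\<close> to the reals, represented as partial maps.\<close>

definition fun_space :: "'n set \<Rightarrow> ('n \<rightharpoonup> real) set" where
  "fun_space N = {\<xi>. dom \<xi> = N}"

type_synonym ('x, 's, 'a) pstate = "('x \<rightharpoonup> real) \<times> ('s \<rightharpoonup> real) \<times> ('a \<rightharpoonup> real)"

record ('x, 's, 'a) penv =
  xvars :: "'x set"
  svars :: "'s set"
  avars :: "'a set"
  evol :: "('x \<rightharpoonup> real) \<Rightarrow> ('a \<rightharpoonup> real) \<Rightarrow> ('x \<rightharpoonup> real) pmf"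
  meas :: "('x \<rightharpoonup> real) \<Rightarrow> ('s \<rightharpoonup> real) pmf"
  invar :: "('x \<rightharpoonup> real) set"

definition wf_env :: "('x, 's, 'a) penv \<Rightarrow> bool" where
  "wf_env E \<longleftrightarrow>
     (\<forall>\<xi>x\<in>fun_space (xvars E). \<forall>\<xi>a\<in>fun_space (avars E).
        finite (set_pmf (evol E \<xi>x \<xi>a)) \<and> set_pmf (evol E \<xi>x \<xi>a) \<subseteq> fun_space (xvars E)) \<and>
     (\<forall>\<xi>x\<in>fun_space (xvars E).
        finite (set_pmf (meas E \<xi>x)) \<and> set_pmf (meas E \<xi>x) \<subseteq> fun_space (svars E)) \<and>
     invar E \<subseteq> fun_space (xvars E)"

definition pstates :: "('x, 's, 'a) penv \<Rightarrow> ('x, 's, 'a) pstate set" where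
  "pstates E = fun_space (xvars E) \<times> fun_space (svars E) \<times> fun_space (avars E)"

fun in_inv :: "('x, 's, 'a) pstate \<Rightarrow> ('x, 's, 'a) penv \<Rightarrow> bool" where
  "in_inv (\<xi>x, \<xi>s, \<xi>a) E \<longleftrightarrow> \<xi>x \<in> invar E"

fun next_env :: "('x, 's, 'a) penv \<Rightarrow> ('x, 's, 'a) pstate \<Rightarrow> ('x, 's, 'a) pstate pmf" where
  "next_env E (\<xi>x, \<xi>s, \<xi>a) =
     bind_pmf (evol E \<xi>x \<xi>a) (\<lambda>\<xi>x'. map_pmf (\<lambda>\<xi>s'. (\<xi>x', \<xi>s', \<xi>a)) (meas E \<xi>x'))"

datatype ('x, 's, 'a, 'c) cps =
  Dead
| Sys "('x, 's, 'a) penv" "('x, 's, 'a) pstate" "('x, 's, 'a, 'c) proc"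

fun wf_cps :: "('x, 's, 'a, 'c) cps \<Rightarrow> bool" where
  "wf_cps Dead \<longleftrightarrow> True"
| "wf_cps (Sys E (\<xi>x, \<xi>s, \<xi>a) P) \<longleftrightarrow>
     wf_env E \<and> (\<xi>x, \<xi>s, \<xi>a) \<in> pstates E \<and> wf_proc P \<and>
     sensors P \<subseteq> dom \<xi>s \<and> actuators P \<subseteq> dom \<xi>a"

definition sys_pmf ::
  "('x, 's, 'a) penv \<Rightarrow> ('x, 's, 'a) pstate pmf \<Rightarrow> ('x, 's, 'a, 'c) proc pmf
     \<Rightarrow> ('x, 's, 'a, 'c) cps pmf" where
  "sys_pmf E \<sigma> \<pi> = map_pmf (\<lambda>(S, P). Sys E S P) (pair_pmf \<sigma> \<pi>)"


subsection \<open>Transitions\<close>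

inductive cstep ::
  "('x, 's, 'a, 'c) cps \<Rightarrow> ('x, 's, 'a, 'c) act \<Rightarrow> ('x, 's, 'a, 'c) cps pmf \<Rightarrow> bool" where
  Proc: "pstep P (Act \<alpha>) \<pi> \<Longrightarrow> in_inv S E \<Longrightarrow>
     cstep (Sys E S P) \<alpha> (sys_pmf E (return_pmf S) \<pi>)"
| Sensor: "pstep P (Rd s z) \<pi> \<Longrightarrow> in_inv (\<xi>x, \<xi>s, \<xi>a) E \<Longrightarrow> \<xi>s s = Some r \<Longrightarrow>
     cstep (Sys E (\<xi>x, \<xi>s, \<xi>a) P) Tau
       (sys_pmf E (return_pmf (\<xi>x, \<xi>s, \<xi>a)) (map_pmf (subst (Real r) z) \<pi>))"
| Actuator: "pstep P (Wr a v) \<pi> \<Longrightarrow> in_inv (\<xi>x, \<xi>s, \<xi>a) E \<Longrightarrow>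
     cstep (Sys E (\<xi>x, \<xi>s, \<xi>a) P) Tau
       (sys_pmf E (return_pmf (\<xi>x, \<xi>s, \<xi>a(a \<mapsto> to_real v))) \<pi>)"
| Deadlock: "\<not> in_inv S E \<Longrightarrow> cstep (Sys E S P) Tau (return_pmf Dead)"

inductive cps_trans ::
  "('x, 's, 'a, 'c) cps \<Rightarrow> ('x, 's, 'a, 'c) act \<Rightarrow> ('x, 's, 'a, 'c) cps pmf \<Rightarrow> bool" where
  Instant: "cstep M \<alpha> \<gamma> \<Longrightarrow> cps_trans M \<alpha> \<gamma>"
| Timed: "ptick P \<pi> \<Longrightarrow> (\<nexists>\<gamma>. cstep (Sys E S P) Tau \<gamma>) \<Longrightarrow> in_inv S E \<Longrightarrow>
     cps_trans (Sys E S P) Tick (sys_pmf E (next_env E S) \<pi>)"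


section \<open>Weak transitions and bisimilarity\<close>

definition hat_trans ::
  "('x, 's, 'a, 'c) act \<Rightarrow> ('x, 's, 'a, 'c) cps \<Rightarrow> ('x, 's, 'a, 'c) cps pmf \<Rightarrow> bool" where
  "hat_trans \<alpha> M \<gamma> \<longleftrightarrow> cps_trans M \<alpha> \<gamma> \<or> (\<alpha> = Tau \<and> \<gamma> = return_pmf M)"

text \<open>
  Lifting to sub-distributions.  Every finite decomposition of \<open>\<gamma>\<close> into weighted Dirac
  distributions is admitted; the \<open>M i\<close> need not be distinct.
\<close>

definition hat_lift ::
  "('x, 's, 'a, 'c) act \<Rightarrow> ('x, 's, 'a, 'c) cps spmf \<Rightarrow> ('x, 's, 'a, 'c) cps spmf \<Rightarrow> bool" where
  "hat_lift \<alpha> \<gamma> \<gamma>' \<longleftrightarrow>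
     (\<exists>(I :: nat set) J p M g.
        finite I \<and> J \<noteq> {} \<and> J \<subseteq> I \<and> (\<forall>i\<in>I. 0 < p i) \<and>
        (\<forall>N. spmf \<gamma> N = (\<Sum>i\<in>I. p i * pmf (return_pmf (M i)) N)) \<and>
        (\<forall>j\<in>J. hat_trans \<alpha> (M j) (g j)) \<and>
        (\<forall>i\<in>I - J. \<nexists>\<delta>. hat_trans \<alpha> (M i) \<delta>) \<and>
        (\<forall>N. spmf \<gamma>' N = (\<Sum>j\<in>J. p j * pmf (g j) N)))"

definition weak_lift ::
  "('x, 's, 'a, 'c) act \<Rightarrow> ('x, 's, 'a, 'c) cps spmf \<Rightarrow> ('x, 's, 'a, 'c) cps spmf \<Rightarrow> bool" where
  "weak_lift \<alpha> =
     (if \<alpha> = Tau then (hat_lift Tau)\<^sup>*\<^sup>*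
      else (hat_lift Tau)\<^sup>*\<^sup>* OO hat_lift \<alpha> OO (hat_lift Tau)\<^sup>*\<^sup>*)"

definition matching :: "('m \<times> 'm) pmf \<Rightarrow> 'm pmf \<Rightarrow> 'm spmf \<Rightarrow> bool" where
  "matching \<omega> \<gamma> \<gamma>' \<longleftrightarrow> map_pmf fst \<omega> = \<gamma> \<and> spmf_of_pmf (map_pmf snd \<omega>) = \<gamma>'"

definition weak_prob_bisim :: "('x, 's, 'a, 'c) cps rel \<Rightarrow> bool" where
  "weak_prob_bisim R \<longleftrightarrow>
     R \<subseteq> {M. wf_cps M} \<times> {M. wf_cps M} \<and> sym R \<and>
     (\<forall>M N \<alpha> \<gamma>. (M, N) \<in> R \<longrightarrow> cps_trans M \<alpha> \<gamma> \<longrightarrow>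
        (\<exists>\<gamma>' \<omega>. weak_lift \<alpha> (return_spmf N) \<gamma>' \<and> matching \<omega> \<gamma> \<gamma>' \<and>
           (\<forall>M' N'. pmf \<omega> (M', N') > 0 \<longrightarrow> (M', N') \<in> R)))"

definition bisimilar ::
  "('x, 's, 'a, 'c) cps \<Rightarrow> ('x, 's, 'a, 'c) cps \<Rightarrow> bool" (infix "\<approx>\<^sub>p" 50) where
  "M \<approx>\<^sub>p N \<longleftrightarrow> (\<exists>R. weak_prob_bisim R \<and> (M, N) \<in> R)"


section \<open>Composition of systems\<close>

fun phys_disjoint :: "('x, 's, 'a, 'c) cps \<Rightarrow> ('x, 's, 'a, 'c) cps \<Rightarrow> bool" where
  "phys_disjoint (Sys E\<^sub>1 S\<^sub>1 P\<^sub>1) (Sys E\<^sub>2 S\<^sub>2 P\<^sub>2) \<longleftrightarrow>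
     xvars E\<^sub>1 \<inter> xvars E\<^sub>2 = {} \<and> svars E\<^sub>1 \<inter> svars E\<^sub>2 = {} \<and> avars E\<^sub>1 \<inter> avars E\<^sub>2 = {}"
| "phys_disjoint Dead M \<longleftrightarrow> True"
| "phys_disjoint M Dead \<longleftrightarrow> True"

fun union_pstate :: "('x, 's, 'a) pstate \<Rightarrow> ('x, 's, 'a) pstate \<Rightarrow> ('x, 's, 'a) pstate" where
  "union_pstate (\<xi>x, \<xi>s, \<xi>a) (\<zeta>x, \<zeta>s, \<zeta>a) = (\<xi>x ++ \<zeta>x, \<xi>s ++ \<zeta>s, \<xi>a ++ \<zeta>a)"

text \<open>
  The components of \<open>\<xi>\<^sub>1 \<uplus> \<xi>\<^sub>2\<close> are recovered by restriction to the two domains.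
  The defining product equations are derived in \<open>evol_union_env\<close>, \<open>meas_union_env\<close> and
  \<open>invar_union_env\<close> below.
\<close>

definition union_env :: "('x, 's, 'a) penv \<Rightarrow> ('x, 's, 'a) penv \<Rightarrow> ('x, 's, 'a) penv" where
  "union_env E\<^sub>1 E\<^sub>2 =
     \<lparr> xvars = xvars E\<^sub>1 \<union> xvars E\<^sub>2,
       svars = svars E\<^sub>1 \<union> svars E\<^sub>2,
       avars = avars E\<^sub>1 \<union> avars E\<^sub>2,
       evol = (\<lambda>\<xi>x \<xi>a. map_pmf (\<lambda>(\<xi>\<^sub>1, \<xi>\<^sub>2). \<xi>\<^sub>1 ++ \<xi>\<^sub>2)
         (pair_pmf (evol E\<^sub>1 (\<xi>x |` xvars E\<^sub>1) (\<xi>a |` avars E\<^sub>1))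
                   (evol E\<^sub>2 (\<xi>x |` xvars E\<^sub>2) (\<xi>a |` avars E\<^sub>2)))),
       meas = (\<lambda>\<xi>x. map_pmf (\<lambda>(\<xi>\<^sub>1, \<xi>\<^sub>2). \<xi>\<^sub>1 ++ \<xi>\<^sub>2)
         (pair_pmf (meas E\<^sub>1 (\<xi>x |` xvars E\<^sub>1)) (meas E\<^sub>2 (\<xi>x |` xvars E\<^sub>2)))),
       invar = {\<xi>x \<in> fun_space (xvars E\<^sub>1 \<union> xvars E\<^sub>2).
         \<xi>x |` xvars E\<^sub>1 \<in> invar E\<^sub>1 \<and> \<xi>x |` xvars E\<^sub>2 \<in> invar E\<^sub>2} \<rparr>"

fun union_cps ::
  "('x, 's, 'a, 'c) cps \<Rightarrow> ('x, 's, 'a, 'c) cps \<Rightarrow> ('x, 's, 'a, 'c) cps" (infixl "\<uplus>" 65) where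
  "Sys E\<^sub>1 S\<^sub>1 P\<^sub>1 \<uplus> Sys E\<^sub>2 S\<^sub>2 P\<^sub>2 = Sys (union_env E\<^sub>1 E\<^sub>2) (union_pstate S\<^sub>1 S\<^sub>2) (PPar P\<^sub>1 P\<^sub>2)"
| "Dead \<uplus> M = Dead"
| "M \<uplus> Dead = Dead"

fun par_cps ::
  "('x, 's, 'a, 'c) cps \<Rightarrow> ('x, 's, 'a, 'c) proc \<Rightarrow> ('x, 's, 'a, 'c) cps" (infixl "\<parallel>" 65) where
  "Sys E S P \<parallel> Q = Sys E S (PPar P Q)"
| "Dead \<parallel> Q = Dead"

fun res_cps :: "('x, 's, 'a, 'c) cps \<Rightarrow> 'c \<Rightarrow> ('x, 's, 'a, 'c) cps" (infixl "\<setminus>" 70) where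
  "Sys E S P \<setminus> c = Sys E S (PRes P c)"
| "Dead \<setminus> c = Dead"


subsection \<open>Defining equations of the union of environments\<close>

lemma map_add_restrict:
  assumes "f \<in> fun_space A" "g \<in> fun_space B" "A \<inter> B = {}"
  shows "(f ++ g) |` A = f" and "(f ++ g) |` B = g"
proof -
  have dom: "dom f = A" "dom g = B" using assms by (auto simp: fun_space_def)
  show "(f ++ g) |` A = f"
  proof
    fix x show "((f ++ g) |` A) x = f x"
    proof (cases "x \<in> A")
      case True
      with assms(3) dom have "x \<notin> dom g" by blast
      with True show ?thesis by (simp add: map_add_dom_app_simps)
    next
      case False
      with dom have "x \<notin> dom f" by simp
      with False show ?thesis by (simp add: domIff)
    qed
  qed
  show "(f ++ g) |` B = g"
  proof
    fix x show "((f ++ g) |` B) x = g x"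
    proof (cases "x \<in> B")
      case True
      with dom have "x \<in> dom g" by simp
      with True show ?thesis by (simp add: map_add_dom_app_simps)
    next
      case False
      with dom have "x \<notin> dom g" by simp
      with False show ?thesis by (simp add: domIff)
    qed
  qed
qed

lemma pmf_map_add_pair:
  assumes "set_pmf p \<subseteq> fun_space A" "set_pmf q \<subseteq> fun_space B" "A \<inter> B = {}"
    and "f \<in> fun_space A" "g \<in> fun_space B"
  shows "pmf (map_pmf (\<lambda>(f, g). f ++ g) (pair_pmf p q)) (f ++ g) = pmf p f * pmf q g"
proof -
  let ?h = "\<lambda>(f :: 'a \<rightharpoonup> real, g). f ++ g"
  have inj: "inj_on ?h (fun_space A \<times> fun_space B)"
  proof (rule inj_onI)
    fix y z :: "('a \<rightharpoonup> real) \<times> ('a \<rightharpoonup> real)"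
    assume yz: "y \<in> fun_space A \<times> fun_space B" "z \<in> fun_space A \<times> fun_space B" "?h y = ?h z"
    have "u = ((?h u) |` A, (?h u) |` B)" if "u \<in> fun_space A \<times> fun_space B"
      for u :: "('a \<rightharpoonup> real) \<times> ('a \<rightharpoonup> real)"
      using that assms(3) map_add_restrict[of "fst u" A "snd u" B] by (simp add: mem_Times_iff split_beta)
    from this[OF yz(1)] this[OF yz(2)] yz(3) show "y = z" by (simp only:)
  qed
  have sub: "set_pmf (pair_pmf p q) \<subseteq> fun_space A \<times> fun_space B"
    using assms(1,2) by auto
  have fg: "(f, g) \<in> fun_space A \<times> fun_space B"
    using assms(4,5) by simp
  have "pmf (map_pmf ?h (pair_pmf p q)) (?h (f, g)) = pmf (pair_pmf p q) (f, g)"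
  proof (cases "(f, g) \<in> set_pmf (pair_pmf p q)")
    case True
    then show ?thesis by (rule pmf_map_inj[OF inj_on_subset[OF inj sub]])
  next
    case False
    then have "?h (f, g) \<notin> ?h ` set_pmf (pair_pmf p q)"
      using inj_on_image_mem_iff[OF inj fg sub] by blast
    then have "?h (f, g) \<notin> set_pmf (map_pmf ?h (pair_pmf p q))"
      by (simp only: set_map_pmf not_False_eq_True)
    with False show ?thesis by (simp only: set_pmf_iff not_not)
  qed
  then show ?thesis by (simp add: pmf_pair)
qed

lemma evol_union_env:
  assumes "wf_env E\<^sub>1" "wf_env E\<^sub>2" "xvars E\<^sub>1 \<inter> xvars E\<^sub>2 = {}" "avars E\<^sub>1 \<inter> avars E\<^sub>2 = {}"
    and "\<xi>x\<^sub>1 \<in> fun_space (xvars E\<^sub>1)" "\<xi>x\<^sub>2 \<in> fun_space (xvars E\<^sub>2)"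
    and "\<xi>a\<^sub>1 \<in> fun_space (avars E\<^sub>1)" "\<xi>a\<^sub>2 \<in> fun_space (avars E\<^sub>2)"
    and "\<zeta>\<^sub>1 \<in> fun_space (xvars E\<^sub>1)" "\<zeta>\<^sub>2 \<in> fun_space (xvars E\<^sub>2)"
  shows "pmf (evol (union_env E\<^sub>1 E\<^sub>2) (\<xi>x\<^sub>1 ++ \<xi>x\<^sub>2) (\<xi>a\<^sub>1 ++ \<xi>a\<^sub>2)) (\<zeta>\<^sub>1 ++ \<zeta>\<^sub>2)
    = pmf (evol E\<^sub>1 \<xi>x\<^sub>1 \<xi>a\<^sub>1) \<zeta>\<^sub>1 * pmf (evol E\<^sub>2 \<xi>x\<^sub>2 \<xi>a\<^sub>2) \<zeta>\<^sub>2"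
proof -
  have "(\<xi>x\<^sub>1 ++ \<xi>x\<^sub>2) |` xvars E\<^sub>1 = \<xi>x\<^sub>1" "(\<xi>x\<^sub>1 ++ \<xi>x\<^sub>2) |` xvars E\<^sub>2 = \<xi>x\<^sub>2"
    "(\<xi>a\<^sub>1 ++ \<xi>a\<^sub>2) |` avars E\<^sub>1 = \<xi>a\<^sub>1" "(\<xi>a\<^sub>1 ++ \<xi>a\<^sub>2) |` avars E\<^sub>2 = \<xi>a\<^sub>2"
    using map_add_restrict[OF assms(5,6,3)] map_add_restrict[OF assms(7,8,4)] by (simp_all only:)
  then have eq: "evol (union_env E\<^sub>1 E\<^sub>2) (\<xi>x\<^sub>1 ++ \<xi>x\<^sub>2) (\<xi>a\<^sub>1 ++ \<xi>a\<^sub>2)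
    = map_pmf (\<lambda>(\<xi>\<^sub>1, \<xi>\<^sub>2). \<xi>\<^sub>1 ++ \<xi>\<^sub>2) (pair_pmf (evol E\<^sub>1 \<xi>x\<^sub>1 \<xi>a\<^sub>1) (evol E\<^sub>2 \<xi>x\<^sub>2 \<xi>a\<^sub>2))"
    by (simp only: union_env_def penv.simps)
  have "set_pmf (evol E\<^sub>1 \<xi>x\<^sub>1 \<xi>a\<^sub>1) \<subseteq> fun_space (xvars E\<^sub>1)" "set_pmf (evol E\<^sub>2 \<xi>x\<^sub>2 \<xi>a\<^sub>2) \<subseteq> fun_space (xvars E\<^sub>2)"
    using assms(1,2,5-8) unfolding wf_env_def by blast+
  from pmf_map_add_pair[OF this assms(3,9,10)] show ?thesis
    unfolding eq .
qed

lemma meas_union_env: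
  assumes "wf_env E\<^sub>1" "wf_env E\<^sub>2" "xvars E\<^sub>1 \<inter> xvars E\<^sub>2 = {}" "svars E\<^sub>1 \<inter> svars E\<^sub>2 = {}"
    and "\<xi>x\<^sub>1 \<in> fun_space (xvars E\<^sub>1)" "\<xi>x\<^sub>2 \<in> fun_space (xvars E\<^sub>2)"
    and "\<zeta>\<^sub>1 \<in> fun_space (svars E\<^sub>1)" "\<zeta>\<^sub>2 \<in> fun_space (svars E\<^sub>2)"
  shows "pmf (meas (union_env E\<^sub>1 E\<^sub>2) (\<xi>x\<^sub>1 ++ \<xi>x\<^sub>2)) (\<zeta>\<^sub>1 ++ \<zeta>\<^sub>2)
    = pmf (meas E\<^sub>1 \<xi>x\<^sub>1) \<zeta>\<^sub>1 * pmf (meas E\<^sub>2 \<xi>x\<^sub>2) \<zeta>\<^sub>2"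
proof -
  have "(\<xi>x\<^sub>1 ++ \<xi>x\<^sub>2) |` xvars E\<^sub>1 = \<xi>x\<^sub>1" "(\<xi>x\<^sub>1 ++ \<xi>x\<^sub>2) |` xvars E\<^sub>2 = \<xi>x\<^sub>2"
    using map_add_restrict[OF assms(5,6,3)] by (simp_all only:)
  then have eq: "meas (union_env E\<^sub>1 E\<^sub>2) (\<xi>x\<^sub>1 ++ \<xi>x\<^sub>2)
    = map_pmf (\<lambda>(\<xi>\<^sub>1, \<xi>\<^sub>2). \<xi>\<^sub>1 ++ \<xi>\<^sub>2) (pair_pmf (meas E\<^sub>1 \<xi>x\<^sub>1) (meas E\<^sub>2 \<xi>x\<^sub>2))"
    by (simp only: union_env_def penv.simps)
  have "set_pmf (meas E\<^sub>1 \<xi>x\<^sub>1) \<subseteq> fun_space (svars E\<^sub>1)" "set_pmf (meas E\<^sub>2 \<xi>x\<^sub>2) \<subseteq> fun_space (svars E\<^sub>2)"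
    using assms(1,2,5,6) unfolding wf_env_def by blast+
  from pmf_map_add_pair[OF this assms(4,7,8)] show ?thesis
    unfolding eq .
qed

lemma invar_union_env:
  assumes "xvars E\<^sub>1 \<inter> xvars E\<^sub>2 = {}"
    and "\<xi>x\<^sub>1 \<in> fun_space (xvars E\<^sub>1)" "\<xi>x\<^sub>2 \<in> fun_space (xvars E\<^sub>2)"
  shows "\<xi>x\<^sub>1 ++ \<xi>x\<^sub>2 \<in> invar (union_env E\<^sub>1 E\<^sub>2) \<longleftrightarrow> \<xi>x\<^sub>1 \<in> invar E\<^sub>1 \<and> \<xi>x\<^sub>2 \<in> invar E\<^sub>2"
proof -
  have "(\<xi>x\<^sub>1 ++ \<xi>x\<^sub>2) |` xvars E\<^sub>1 = \<xi>x\<^sub>1" "(\<xi>x\<^sub>1 ++ \<xi>x\<^sub>2) |` xvars E\<^sub>2 = \<xi>x\<^sub>2"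
    using map_add_restrict[OF assms(2,3,1)] by (simp_all only:)
  moreover have "\<xi>x\<^sub>1 ++ \<xi>x\<^sub>2 \<in> fun_space (xvars E\<^sub>1 \<union> xvars E\<^sub>2)"
    using assms(2,3) by (auto simp: fun_space_def)
  ultimately show ?thesis by (simp add: union_env_def)
qed

end

theory Submission
  imports Defs
begin

text \<open>
  Given a bisimulation \<open>R\<close>, the relation pairing the two systems placed in the same context is a
  bisimulation once all pairs of systems outside their invariant are added.  A move of \<open>M\<close> alone, or
  a communication with the context, is matched by running the weak move of \<open>N\<close> inside the context.
  Two points are delicate.  First, whether a system is inside its invariant must be preserved by \<open>R\<close>,
  as otherwise the context could move next to \<open>M\<close> but not next to \<open>N\<close>: recursion is time-guarded, so a
  system inside its invariant reaches a \<open>tick\<close> after finitely many \<open>\<tau>\<close>-moves, whence it is not related to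
  \<open>Dead\<close>.  Secondly, a \<open>tick\<close> has a negative premise: if \<open>M\<close> in the context has no \<open>\<tau>\<close>-move, then every
  \<open>\<tau>\<close>-derivative \<open>N'\<close> of \<open>N\<close> is related to \<open>M\<close> itself, and a communication offered by \<open>N'\<close> would be
  offered by \<open>M\<close> as well.
\<close>

section \<open>Process moves: preservation, depth and progress\<close>

text \<open>Three more obstacles shape the proof. Weak transitions live on sub-distributions and may
  lose mass, while a context has to be carried along whole distributions. But an answer is matched
  with a full distribution, and lost mass never returns; so nothing is lost along a matching weak
  move, and weak moves can be replaced by steps between \<open>pmf\<close>s. An answer of
  \<open>N\<close> has \<tau>-moves before and after its visible action, and the context moves
  together with that action. The leading ones are therefore run beside the old context, the trailing
  ones beside the new context. A tick may put the new context outside its invariant, where the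
  trailing moves are blocked. Such outcomes are answered by stopping right after the tick; the two
  systems need not correspond at that point, but both composites are outside their invariant. The
  trailing part thus depends on the outcome of the context, so runs of different lengths have to be
  mixed; idle \<tau>-steps even out the lengths.\<close>

fun dom_phy :: "('x, 's, 'a, 'c) phy \<Rightarrow> 's + 'a" where
  "dom_phy (Read s x) = Inl s"
| "dom_phy (Write a t) = Inr a"

text \<open>\<open>phys\<close> keeps the term of a write, which substitution changes; the bare
  sensor and actuator names form a set that substitution preserves.\<close>

definition pdom :: "('x, 's, 'a, 'c) proc \<Rightarrow> ('s + 'a) set" where
  "pdom P = dom_phy ` phys P"

lemma pdom_simps [simp]:
  "pdom PNil = {}"
  "pdom (PTick C) = (\<Union>(P, p)\<in>set C. pdom P)"
  "pdom (PPar P Q) = pdom P \<union> pdom Q"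
  "pdom (PTimeout h C D) = (\<Union>(P, p)\<in>set C. pdom P) \<union> (\<Union>(P, p)\<in>set D. pdom P)"
  "pdom (PPhy g C) = {dom_phy g} \<union> (\<Union>(P, p)\<in>set C. pdom P)"
  "pdom (PIf b P Q) = pdom P \<union> pdom Q"
  "pdom (PRes P c) = pdom P"
  "pdom (PVar X) = {}"
  "pdom (PFix X P) = pdom P"
  by (auto simp: pdom_def image_iff)

lemma sensors_pdom: "sensors P = {s. Inl s \<in> pdom P}"
  unfolding sensors_def pdom_def by (force elim: dom_phy.elims[OF sym])

lemma actuators_pdom: "actuators P = {a. Inr a \<in> pdom P}"
  unfolding actuators_def pdom_def by (force elim: dom_phy.elims[OF sym])

lemma pure_logical_pdom: "pure_logical P \<longleftrightarrow> pdom P = {}"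
  by (simp add: pure_logical_def pdom_def)

text \<open>A bound on the number of instantaneous moves before the next tick: tick continuations
  and time-out branches contribute nothing. Sums over branches serve as well as maxima, since only
  strict decrease along moves matters.\<close>

fun depth :: "('x, 's, 'a, 'c) proc \<Rightarrow> nat" where
  "depth PNil = 0"
| "depth (PTick C) = 0"
| "depth (PPar P Q) = depth P + depth Q"
| "depth (PTimeout h C D) = Suc (\<Sum>(P, p)\<leftarrow>C. depth P)"
| "depth (PPhy h C) = Suc (\<Sum>(P, p)\<leftarrow>C. depth P)"
| "depth (PIf b P Q) = depth P + depth Q"
| "depth (PRes P c) = depth P"
| "depth (PVar X) = 0"
| "depth (PFix X P) = depth P"

text \<open>Counts the operators above the first prefixes. Unfolding a time-guarded recursion
  inserts copies only below prefixes, so it lowers this number by one although the term may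
  grow.\<close>

fun height :: "('x, 's, 'a, 'c) proc \<Rightarrow> nat" where
  "height (PPar P Q) = Suc (height P + height Q)"
| "height (PIf b P Q) = Suc (height P + height Q)"
| "height (PRes P c) = Suc (height P)"
| "height (PFix X P) = Suc (height P)"
| "height P = 0"

lemma depth_le_sum_list: "P \<in> fst ` set C \<Longrightarrow> depth P \<le> (\<Sum>(P, p)\<leftarrow>C. depth P)"
  by (force intro: member_le_sum_list)

lemma sum_list_depth_map:
  "(\<And>P p. (P, p) \<in> set C \<Longrightarrow> depth (f P) = depth P) \<Longrightarrow>
    (\<Sum>x\<leftarrow>C. case (case x of (P, p) \<Rightarrow> (f P, p)) of (P, p) \<Rightarrow> depth P) = (\<Sum>(P, p)\<leftarrow>C. depth P)"
  by (rule arg_cong[where f = sum_list], rule map_cong) auto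

lemma pmf_of_list_wf_map_fst [simp]:
  "pmf_of_list_wf (map (\<lambda>(P, p). (f P, p)) C) \<longleftrightarrow> pmf_of_list_wf C"
proof -
  have "map snd (map (\<lambda>(P, p). (f P, p)) C) = map snd C" by auto
  then show ?thesis unfolding pmf_of_list_wf_def by metis
qed

section \<open>Stability under substitution of values and unfolding of recursion\<close>

lemma depth_subst [simp]: "depth (subst v x P) = depth P"
  by (induction v x P rule: subst.induct) (auto simp: o_def intro!: sum_list_depth_map)

lemma fpv_subst [simp]: "fpv (subst v x P) = fpv P"
  by (induction v x P rule: subst.induct) (auto split: if_splits; fastforce)+

lemma time_guarded_subst [simp]: "time_guarded X (subst v x P) \<longleftrightarrow> time_guarded X P"
  by (induction v x P rule: subst.induct) (auto; fastforce)+

lemma ok_proc_subst [simp]: "ok_proc (subst v x P) \<longleftrightarrow> ok_proc P"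
  by (induction v x P rule: subst.induct) (auto; fastforce)+

lemma fv_subst_tm [simp]: "fv_tm (subst_tm v x t) = fv_tm t - {x}"
  by (cases t) auto

lemma fv_subst_guard [simp]: "fv_guard (subst_guard v x b) = fv_guard b - {x}"
  by (cases b) auto

lemma fv_subst: "fv (subst v x P) = fv P - {x}"
  by (induction v x P rule: subst.induct) (auto split: if_splits; fastforce)+

lemma pdom_subst [simp]: "pdom (subst v x P) = pdom P"
  by (induction v x P rule: subst.induct) (auto split: if_splits; fastforce)+

lemma subst_tm_fresh: "x \<notin> fv_tm t \<Longrightarrow> subst_tm v x t = t"
  by (cases t) auto

lemma subst_guard_fresh: "x \<notin> fv_guard b \<Longrightarrow> subst_guard v x b = b"
  by (cases b) (auto simp: subst_tm_fresh intro!: map_idI)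

lemma subst_fresh: "x \<notin> fv P \<Longrightarrow> subst v x P = P"
  by (induction v x P rule: subst.induct)
    (auto simp: subst_tm_fresh subst_guard_fresh intro!: map_idI; fastforce)+

lemma time_guarded_fresh: "X \<notin> fpv P \<Longrightarrow> time_guarded X P"
  by (induction X P rule: time_guarded.induct) (auto; fastforce)+

lemma fpv_psubst: "fpv (psubst R X P) \<subseteq> (fpv P - {X}) \<union> fpv R"
  by (induction R X P rule: psubst.induct) (auto split: if_splits; fastforce)+

lemma fv_psubst: "fv (psubst R X P) \<subseteq> fv P \<union> fv R"
proof (induction R X P rule: psubst.induct)
  case (4 R X h C D)
  then show ?case by (cases h) (auto; fastforce)+
next
  case (5 R X h C)
  then show ?case by (cases h) (auto; fastforce)+
qed (auto split: if_splits; fastforce)+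

lemma pdom_psubst: "pdom (psubst R X P) \<subseteq> pdom P \<union> pdom R"
  by (induction R X P rule: psubst.induct) (auto split: if_splits; fastforce)+

lemma time_guarded_psubst:
  "time_guarded Y P \<Longrightarrow> time_guarded Y R \<Longrightarrow> time_guarded Y (psubst R X P)"
  by (induction R X P rule: psubst.induct) (auto split: if_splits; fastforce)+

text \<open>A closed \<open>R\<close> is time-guarded in every variable, so placing it under another
  binder \<open>PFix Y\<close> cannot break the guardedness of \<open>Y\<close>.\<close>

lemma ok_proc_psubst: "ok_proc P \<Longrightarrow> ok_proc R \<Longrightarrow> fpv R = {} \<Longrightarrow> ok_proc (psubst R X P)"
proof (induction R X P rule: psubst.induct)
  case (9 R X Y P)
  then show ?case by (cases "Y = X") (auto simp: time_guarded_psubst time_guarded_fresh)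
qed (auto split: if_splits; fastforce)+

text \<open>The guarded occurrences of \<open>X\<close> lie in tick continuations and time-out
  branches, which \<open>depth\<close> ignores.\<close>

lemma depth_psubst: "time_guarded X P \<Longrightarrow> depth (psubst R X P) = depth P"
  by (induction R X P rule: psubst.induct) (auto simp: o_def intro!: sum_list_depth_map; fastforce)+

lemma height_psubst: "time_guarded X P \<Longrightarrow> height (psubst R X P) = height P"
  by (induction R X P rule: psubst.induct) auto

lemma unfold_fix:
  assumes "ok_proc (PFix X P)" "fpv (PFix X P) = {}"
  defines "U \<equiv> psubst (PFix X P) X P"
  shows "ok_proc U" "fpv U = {}" "fv U \<subseteq> fv P" "pdom U \<subseteq> pdom P"
    "depth U = depth P" "height U = height P"
  using assms fpv_psubst[of "PFix X P" X P] fv_psubst[of "PFix X P" X P] pdom_psubst[of "PFix X P" X P]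
  by (auto intro!: ok_proc_psubst depth_psubst height_psubst)

section \<open>What process moves preserve\<close>

lemma set_par_pmf: "set_pmf (par_pmf \<pi>\<^sub>1 \<pi>\<^sub>2) = (\<lambda>(P, Q). PPar P Q) ` (set_pmf \<pi>\<^sub>1 \<times> set_pmf \<pi>\<^sub>2)"
  by (simp add: par_pmf_def)

text \<open>A read leaves its variable free in the target; the sensor value is filled in only at
  system level.\<close>

fun bound_vars :: "('x, 's, 'a, 'c) plabel \<Rightarrow> var set" where
  "bound_vars (Rd s z) = {z}"
| "bound_vars _ = {}"

lemma set_pmf_of_choice:
  "pmf_of_list_wf C \<Longrightarrow> P \<in> set_pmf (pmf_of_list C) \<Longrightarrow> P \<in> fst ` set C"
  using set_pmf_of_list[of C] by auto

text \<open>A communication or physical prefix contributes the \<open>Suc\<close> in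
  \<open>depth\<close>, which disappears when the prefix fires. A synchronisation decreases both
  components, and unfolding changes nothing.\<close>

lemma pstep_preserves:
  assumes "pstep P l \<pi>" "ok_proc P" "fpv P = {}" "P' \<in> set_pmf \<pi>"
  shows "ok_proc P' \<and> fpv P' = {} \<and> fv P' \<subseteq> fv P \<union> bound_vars l \<and> pdom P' \<subseteq> pdom P \<and> depth P' < depth P"
  using assms
proof (induction arbitrary: P')
  case (Out c v C D)
  then have "P' \<in> fst ` set C" by (auto dest: set_pmf_of_choice)
  with Out depth_le_sum_list[of P' C] show ?case by (auto simp: less_Suc_eq_le; fastforce)
next
  case (In c x C D v)
  then obtain Q where "P' = subst v x Q" "Q \<in> fst ` set C"
    using set_pmf_of_choice[of C] by auto
  with In depth_le_sum_list[of Q C] show ?case by (auto simp: less_Suc_eq_le fv_subst; fastforce)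
next
  case (Write a v C)
  then have "P' \<in> fst ` set C" by (auto dest: set_pmf_of_choice)
  with Write depth_le_sum_list[of P' C] show ?case by (auto simp: less_Suc_eq_le; fastforce)
next
  case (Read s x C)
  then have "P' \<in> fst ` set C" by (auto dest: set_pmf_of_choice)
  with Read depth_le_sum_list[of P' C] show ?case by (auto simp: less_Suc_eq_le; fastforce)
next
  case (ComL P c v \<pi>\<^sub>1 Q \<pi>\<^sub>2)
  from ComL.prems(3) obtain P'' Q'' where "P' = PPar P'' Q''" "P'' \<in> set_pmf \<pi>\<^sub>1" "Q'' \<in> set_pmf \<pi>\<^sub>2"
    by (auto simp: set_par_pmf)
  with ComL.IH(1)[of P''] ComL.IH(2)[of Q''] ComL.prems
  show ?case by (simp add: add_strict_mono) blast
next
  case (ComR P c v \<pi>\<^sub>1 Q \<pi>\<^sub>2)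
  from ComR.prems(3) obtain P'' Q'' where "P' = PPar P'' Q''" "P'' \<in> set_pmf \<pi>\<^sub>1" "Q'' \<in> set_pmf \<pi>\<^sub>2"
    by (auto simp: set_par_pmf)
  with ComR.IH(1)[of P''] ComR.IH(2)[of Q''] ComR.prems
  show ?case by (simp add: add_strict_mono) blast
next
  case (Fix X P l \<pi>)
  note U = unfold_fix[OF Fix.prems(1,2)]
  from Fix.IH[OF U(1,2) Fix.prems(3)] U(3-6) show ?case by simp blast
qed (auto simp: set_par_pmf; fastforce)+

lemma pstep_finite: "pstep P l \<pi> \<Longrightarrow> ok_proc P \<Longrightarrow> fpv P = {} \<Longrightarrow> finite (set_pmf \<pi>)"
proof (induction rule: pstep.induct)
  case (Fix X P l \<pi>)
  with unfold_fix[of X P] show ?case by auto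
qed (auto simp: set_par_pmf finite_set_pmf_of_list)

lemma pstep_phys_label:
  "pstep P l \<pi> \<Longrightarrow> ok_proc P \<Longrightarrow> fpv P = {} \<Longrightarrow>
    (\<forall>s z. l = Rd s z \<longrightarrow> Inl s \<in> pdom P) \<and> (\<forall>a v. l = Wr a v \<longrightarrow> Inr a \<in> pdom P)"
proof (induction rule: pstep.induct)
  case (Fix X P l \<pi>)
  with unfold_fix[of X P] show ?case by auto
qed auto

lemma ptick_preserves:
  assumes "ptick P \<pi>" "ok_proc P" "fpv P = {}" "P' \<in> set_pmf \<pi>"
  shows "ok_proc P' \<and> fpv P' = {} \<and> fv P' \<subseteq> fv P \<and> pdom P' \<subseteq> pdom P"
  using assms
proof (induction arbitrary: P')
  case (Tick C)
  then have "P' \<in> fst ` set C" by (auto dest: set_pmf_of_choice)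
  with Tick show ?case by (auto; fastforce)
next
  case (Timeout h C D)
  then have "P' \<in> fst ` set D" by (auto dest: set_pmf_of_choice)
  then obtain p where "(P', p) \<in> set D" by auto
  with Timeout.prems(1,2) show ?case by (cases h) auto
next
  case (Fix X P \<pi>)
  note U = unfold_fix[OF Fix.prems(1,2)]
  from Fix.IH[OF U(1,2) Fix.prems(3)] U(3-6) show ?case by simp blast
next
  case (Par P \<pi>\<^sub>1 Q \<pi>\<^sub>2)
  from Par.prems(3) obtain P'' Q'' where "P' = PPar P'' Q''" "P'' \<in> set_pmf \<pi>\<^sub>1" "Q'' \<in> set_pmf \<pi>\<^sub>2"
    by (auto simp: set_par_pmf)
  with Par.IH(1)[of P''] Par.IH(2)[of Q''] Par.prems
  show ?case by simp blast
next
  case (Res P \<pi> c)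
  then obtain P'' where "P' = PRes P'' c" "P'' \<in> set_pmf \<pi>" by auto
  with Res.IH[of P''] Res.prems show ?case by auto
qed auto

lemma ptick_finite: "ptick P \<pi> \<Longrightarrow> ok_proc P \<Longrightarrow> fpv P = {} \<Longrightarrow> finite (set_pmf \<pi>)"
proof (induction rule: ptick.induct)
  case (Fix X P \<pi>)
  with unfold_fix[of X P] show ?case by auto
qed (auto simp: set_par_pmf finite_set_pmf_of_list)

section \<open>Progress of closed processes\<close>

lemma closed_tm: "fv_tm t = {} \<Longrightarrow> \<exists>v. t = Val v"
  by (cases t) auto

text \<open>These are the process labels that become \<tau>-moves of a system.\<close>

fun internal :: "('x, 's, 'a, 'c) plabel \<Rightarrow> bool" where
  "internal (Act \<alpha>) \<longleftrightarrow> \<alpha> = Tau"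
| "internal _ \<longleftrightarrow> True"

text \<open>The induction is on \<open>height\<close> because unfolding a recursion may enlarge the
  term. Closedness enters twice: a written term is a value, and no bare process variable
  occurs.\<close>

lemma progress_proc:
  assumes "ok_proc P" "fpv P = {}" "fv P = {}"
  shows "(\<exists>\<pi>. ptick P \<pi>) \<or> (\<exists>l \<pi>. internal l \<and> pstep P l \<pi>)"
  using assms
proof (induction P rule: measure_induct_rule[of height])
  case (less P)
  show ?case
  proof (cases P)
    case (PPar Q R)
    with less.IH[of Q] less.IH[of R] less.prems
    have "(\<exists>\<pi>. ptick Q \<pi>) \<or> (\<exists>l \<pi>. internal l \<and> pstep Q l \<pi>)"
      "(\<exists>\<pi>. ptick R \<pi>) \<or> (\<exists>l \<pi>. internal l \<and> pstep R l \<pi>)" by auto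
    moreover have "internal (Act Tau)" by simp
    \<comment> \<open>If both components tick, either the composition has a \<tau>-move or the
      negative premise of its tick rule holds.\<close>
    ultimately show ?thesis unfolding PPar by (metis ptick.Par pstep.ParL pstep.ParR)
  next
    case (PPhy h C)
    show ?thesis
    proof (cases h)
      case (Read s x)
      with PPhy show ?thesis by (metis internal.simps(2) pstep.Read)
    next
      case (Write a t)
      with PPhy less.prems obtain v where "t = Val v" using closed_tm[of t] by auto
      with PPhy Write show ?thesis by (metis internal.simps(3) pstep.Write)
    qed
  next
    case (PIf b Q R)
    then have "\<exists>P'\<in>{Q, R}. (\<forall>\<pi>. ptick P' \<pi> \<longrightarrow> ptick P \<pi>) \<and> (\<forall>l \<pi>. pstep P' l \<pi> \<longrightarrow> pstep P l \<pi>)"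
      by (cases "eval_guard b") (auto intro: ptick.IfT ptick.IfF pstep.IfT pstep.IfF)
    then obtain P' where "P' \<in> {Q, R}" "\<And>\<pi>. ptick P' \<pi> \<Longrightarrow> ptick P \<pi>" "\<And>l \<pi>. pstep P' l \<pi> \<Longrightarrow> pstep P l \<pi>"
      by blast
    moreover from this(1) have "(\<exists>\<pi>. ptick P' \<pi>) \<or> (\<exists>l \<pi>. internal l \<and> pstep P' l \<pi>)"
      using PIf less.IH[of P'] less.prems by auto
    ultimately show ?thesis by blast
  next
    case (PRes Q c)
    have "pstep P l (map_pmf (\<lambda>P'. PRes P' c) \<pi>)" if "internal l" "pstep Q l \<pi>" for l \<pi>
      unfolding PRes using that by (intro pstep.Res) auto
    moreover have "(\<exists>\<pi>. ptick Q \<pi>) \<or> (\<exists>l \<pi>. internal l \<and> pstep Q l \<pi>)"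
      using PRes less.IH[of Q] less.prems by auto
    ultimately show ?thesis unfolding PRes by (blast intro: ptick.Res)
  next
    case (PFix X Q)
    have "(\<exists>\<pi>. ptick (psubst P X Q) \<pi>) \<or> (\<exists>l \<pi>. internal l \<and> pstep (psubst P X Q) l \<pi>)"
      using PFix less.IH[of "psubst P X Q"] less.prems unfold_fix[of X Q] by auto
    then show ?thesis unfolding PFix by (blast intro: ptick.Fix pstep.Fix)
  next
    case (PVar X)
    with less.prems show ?thesis by simp
  qed (auto intro: ptick.intros)
qed

section \<open>Weak transitions between distributions\<close>

text \<open>The mass-preserving counterpart of \<open>hat_lift\<close>. \<open>D\<close> draws a
  state together with its successor distribution, so that one state may use several successors, as
  repeated indices allow in \<open>hat_lift\<close>.\<close>

definition lift_step ::
  "('x, 's, 'a, 'c) act \<Rightarrow> ('x, 's, 'a, 'c) cps pmf \<Rightarrow> ('x, 's, 'a, 'c) cps pmf \<Rightarrow> bool" where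
  "lift_step \<alpha> g g' \<longleftrightarrow>
     (\<exists>D. finite (set_pmf D) \<and> map_pmf fst D = g \<and>
        (\<forall>(M, \<delta>)\<in>set_pmf D. hat_trans \<alpha> M \<delta>) \<and> g' = bind_pmf D snd)"

definition weak_step ::
  "('x, 's, 'a, 'c) act \<Rightarrow> ('x, 's, 'a, 'c) cps pmf \<Rightarrow> ('x, 's, 'a, 'c) cps pmf \<Rightarrow> bool" where
  "weak_step \<alpha> =
     (if \<alpha> = Tau then (lift_step Tau)\<^sup>*\<^sup>*
      else (lift_step Tau)\<^sup>*\<^sup>* OO lift_step \<alpha> OO (lift_step Tau)\<^sup>*\<^sup>*)"

section \<open>From sub-distributions to full distributions\<close>

lemma weight_spmf_finite_mixture:
  assumes "finite I" "\<And>i. i \<in> I \<Longrightarrow> 0 \<le> p i" "\<And>x. spmf \<gamma> x = (\<Sum>i\<in>I. p i * pmf (q i) x)"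
  shows "weight_spmf \<gamma> = (\<Sum>i\<in>I. p i)"
proof -
  have "ennreal (weight_spmf \<gamma>) = (\<integral>\<^sup>+ x. spmf \<gamma> x \<partial>count_space UNIV)"
    by (simp add: weight_spmf_eq_nn_integral_spmf)
  also have "\<dots> = (\<integral>\<^sup>+ x. (\<Sum>i\<in>I. ennreal (p i) * ennreal (pmf (q i) x)) \<partial>count_space UNIV)"
    using assms by (simp add: sum_ennreal[symmetric] ennreal_mult del: sum_ennreal cong: sum.cong)
  also have "\<dots> = (\<Sum>i\<in>I. ennreal (p i) * (\<integral>\<^sup>+ x. ennreal (pmf (q i) x) \<partial>count_space UNIV))"
    by (simp add: nn_integral_sum nn_integral_cmult)
  also have "\<dots> = ennreal (\<Sum>i\<in>I. p i)"
    using assms(1,2) by (simp add: nn_integral_pmf)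
  finally show ?thesis
    using assms(1,2) by (simp add: sum_nonneg)
qed

lemma lossless_spmf_of_pmf:
  assumes "lossless_spmf \<gamma>"
  obtains g where "\<gamma> = spmf_of_pmf g"
  using assms by (auto simp: lossless_spmf_conv_spmf_of_pmf)

lemma finite_weights_pmf:
  assumes "finite I" "\<And>i. i \<in> I \<Longrightarrow> 0 < p i" "(\<Sum>i\<in>I. p i) = (1::real)"
  obtains q where "set_pmf q = I" "\<And>i. i \<in> I \<Longrightarrow> pmf q i = p i"
proof -
  define f where "f i = (if i \<in> I then p i else 0)" for i
  have nn: "f i \<ge> 0" for i using assms(2)[of i] by (auto simp: f_def)
  have "(\<integral>\<^sup>+ i. ennreal (f i) \<partial>count_space UNIV) = (\<integral>\<^sup>+ i. ennreal (f i) \<partial>count_space I)"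
    by (rule nn_integral_count_space_eq) (auto simp: f_def)
  also have "\<dots> = (\<Sum>i\<in>I. ennreal (f i))"
    using assms(1) by (rule nn_integral_count_space_finite)
  also have "\<dots> = ennreal (\<Sum>i\<in>I. p i)"
    using assms(2) by (subst sum_ennreal) (auto simp: f_def less_imp_le)
  finally have "(\<integral>\<^sup>+ i. ennreal (f i) \<partial>count_space UNIV) = 1" using assms(3) by simp
  with nn have pmf: "pmf (embed_pmf f) i = f i" for i by (rule pmf_embed_pmf)
  show ?thesis
    by (rule that[of "embed_pmf f"]) (use assms(2) in \<open>force simp: set_pmf_iff pmf f_def split: if_splits\<close>)+
qed

lemma pmf_bind_finite:
  assumes "finite I" "set_pmf q \<subseteq> I"
  shows "pmf (bind_pmf q f) x = (\<Sum>i\<in>I. pmf q i * pmf (f i) x)"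
  using assms unfolding pmf_bind by (subst integral_measure_pmf[of I]) auto

text \<open>A target of full mass leaves no room for loss: its mass 1 is the weight of
  \<open>J\<close>, the weight of \<open>I\<close> is at most 1, and all weights are positive. Hence
  \<open>J = I\<close>, and the source has full mass as well.\<close>

lemma hat_lift_imp_lift_step:
  assumes "hat_lift \<alpha> \<gamma> (spmf_of_pmf g')"
  obtains g where "\<gamma> = spmf_of_pmf g" "lift_step \<alpha> g g'"
proof -
  from assms obtain I J :: "nat set" and p M g where *: "finite I" "J \<subseteq> I" "\<forall>i\<in>I. 0 < p i"
    "\<And>N. spmf \<gamma> N = (\<Sum>i\<in>I. p i * pmf (return_pmf (M i)) N)"
    "\<forall>j\<in>J. hat_trans \<alpha> (M j) (g j)" "\<And>N. spmf (spmf_of_pmf g') N = (\<Sum>j\<in>J. p j * pmf (g j) N)"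
    unfolding hat_lift_def by blast
  note fin = finite_subset[OF *(2,1)]
  have wJ: "(\<Sum>j\<in>J. p j) = 1"
    using weight_spmf_finite_mixture[OF fin _ *(6)] *(2,3) by (force simp: less_imp_le)
  have wI: "weight_spmf \<gamma> = (\<Sum>i\<in>I. p i)"
    using weight_spmf_finite_mixture[OF *(1) _ *(4)] *(3) by (force simp: less_imp_le)
  have IJ: "I = J"
  proof (rule ccontr)
    assume "I \<noteq> J"
    with *(2) obtain i where i: "i \<in> I" "i \<notin> J" by blast
    have "(\<Sum>j\<in>J. p j) < (\<Sum>i\<in>I. p i)"
      using *(1-3) i by (intro sum_strict_mono2[of I J i]) (auto simp: less_imp_le)
    with wI wJ weight_spmf_le_1[of \<gamma>] show False by simp
  qed
  with wI wJ have "lossless_spmf \<gamma>" by (simp add: lossless_spmf_def)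
  then obtain g0 where g0: "\<gamma> = spmf_of_pmf g0" by (rule lossless_spmf_of_pmf)
  obtain q where q: "set_pmf q = I" "\<And>i. i \<in> I \<Longrightarrow> pmf q i = p i"
    using finite_weights_pmf[of I p] *(1,3) wJ IJ by auto
  \<comment> \<open>Pushing forward a distribution on indices keeps apart indices that carry the
    same state but different successors.\<close>
  define D where "D = map_pmf (\<lambda>i. (M i, g i)) q"
  have "map_pmf fst D = g0"
  proof (rule pmf_eqI)
    fix N
    have "pmf (map_pmf fst D) N = pmf (bind_pmf q (\<lambda>i. return_pmf (M i))) N"
      by (simp add: D_def pmf.map_comp o_def flip: map_pmf_def)
    also have "\<dots> = (\<Sum>i\<in>I. p i * pmf (return_pmf (M i)) N)"
      by (subst pmf_bind_finite[of I q]) (use *(1) q in \<open>auto intro!: sum.cong\<close>)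
    finally show "pmf (map_pmf fst D) N = pmf g0 N" using *(4)[of N] g0 by simp
  qed
  moreover have "g' = bind_pmf D snd"
  proof (rule pmf_eqI)
    fix N
    have "pmf (bind_pmf D snd) N = pmf (bind_pmf q g) N"
      by (simp add: D_def bind_map_pmf)
    also have "\<dots> = (\<Sum>i\<in>I. p i * pmf (g i) N)"
      using pmf_bind_finite[of I q] *(1) q by simp
    finally show "pmf g' N = pmf (bind_pmf D snd) N" using *(6)[of N] IJ by simp
  qed
  ultimately have "lift_step \<alpha> g0 g'"
    unfolding lift_step_def using *(1,5) q IJ by (intro exI[of _ D]) (auto simp: D_def)
  with g0 show ?thesis by (rule that)
qed

lemma lift_step_imp_hat_lift:
  assumes "lift_step \<alpha> g g'"
  shows "hat_lift \<alpha> (spmf_of_pmf g) (spmf_of_pmf g')"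
proof -
  from assms obtain D where D: "finite (set_pmf D)" "map_pmf fst D = g"
    "\<forall>(M, \<delta>)\<in>set_pmf D. hat_trans \<alpha> M \<delta>" "g' = bind_pmf D snd"
    unfolding lift_step_def by blast
  \<comment> \<open>\<open>hat_lift\<close> is indexed by natural numbers, so the finite support of
    \<open>D\<close> is enumerated.\<close>
  obtain h where h: "bij_betw h {..<card (set_pmf D)} (set_pmf D)"
    using ex_bij_betw_nat_finite[OF D(1)] by (auto simp: atLeast0LessThan)
  let ?I = "{..<card (set_pmf D)}"
  have sum: "pmf (bind_pmf D f) N = (\<Sum>i\<in>?I. pmf D (h i) * pmf (f (h i)) N)" for f :: "_ \<Rightarrow> 'e pmf" and N
    unfolding pmf_bind_finite[OF D(1) order.refl] by (rule sum.reindex_bij_betw[OF h, symmetric])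
  have hI: "h i \<in> set_pmf D" if "i \<in> ?I" for i using h that by (auto simp: bij_betw_def)
  have ne: "?I \<noteq> {}" using set_pmf_not_empty[of D] h by (auto simp: bij_betw_def)
  have g: "g = bind_pmf D (\<lambda>x. return_pmf (fst x))" using D(2) by (simp add: map_pmf_def o_def)
  show ?thesis
    unfolding hat_lift_def
    by (rule exI[of _ ?I], rule exI[of _ ?I], rule exI[of _ "\<lambda>i. pmf D (h i)"],
        rule exI[of _ "\<lambda>i. fst (h i)"], rule exI[of _ "\<lambda>i. snd (h i)"])
      (use ne hI D(3) in \<open>auto simp: g D(4) sum pmf_positive split_beta\<close>)
qed

text \<open>Full mass is known only of the last distribution and is carried backwards along the
  chain.\<close>

lemma hat_lift_rtranclp_imp:
  assumes "(hat_lift Tau)\<^sup>*\<^sup>* \<gamma> (spmf_of_pmf g')"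
  obtains g where "\<gamma> = spmf_of_pmf g" "(lift_step Tau)\<^sup>*\<^sup>* g g'"
proof -
  have "\<exists>g. \<gamma> = spmf_of_pmf g \<and> (lift_step Tau)\<^sup>*\<^sup>* g g'"
    using assms
  proof (induction rule: converse_rtranclp_induct)
    case (step \<gamma> \<gamma>')
    then show ?case by (metis hat_lift_imp_lift_step converse_rtranclp_into_rtranclp)
  qed blast
  with that show ?thesis by blast
qed

lemma lift_step_rtranclp_imp:
  "(lift_step Tau)\<^sup>*\<^sup>* g g' \<Longrightarrow> (hat_lift Tau)\<^sup>*\<^sup>* (spmf_of_pmf g) (spmf_of_pmf g')"
  by (induction rule: rtranclp_induct) (auto intro: rtranclp.rtrancl_into_rtrancl lift_step_imp_hat_lift)

lemma spmf_of_pmf_eqD: "spmf_of_pmf p = spmf_of_pmf q \<Longrightarrow> p = q"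
  by (rule pmf_eqI) (metis spmf_spmf_of_pmf)

lemma weak_lift_iff: "weak_lift \<alpha> (spmf_of_pmf g) (spmf_of_pmf g') \<longleftrightarrow> weak_step \<alpha> g g'"
proof (cases "\<alpha> = Tau")
  case True
  then show ?thesis
    unfolding weak_lift_def weak_step_def
    by (auto intro: lift_step_rtranclp_imp elim!: hat_lift_rtranclp_imp dest!: spmf_of_pmf_eqD)
next
  case False
  have "weak_step \<alpha> g g'" if "weak_lift \<alpha> (spmf_of_pmf g) (spmf_of_pmf g')"
  proof -
    from that False obtain \<gamma>\<^sub>1 \<gamma>\<^sub>2 where 1: "(hat_lift Tau)\<^sup>*\<^sup>* (spmf_of_pmf g) \<gamma>\<^sub>1"
      and 2: "hat_lift \<alpha> \<gamma>\<^sub>1 \<gamma>\<^sub>2" and 3: "(hat_lift Tau)\<^sup>*\<^sup>* \<gamma>\<^sub>2 (spmf_of_pmf g')"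
      unfolding weak_lift_def by auto
    from 3 obtain g2 where g2: "\<gamma>\<^sub>2 = spmf_of_pmf g2" "(lift_step Tau)\<^sup>*\<^sup>* g2 g'"
      by (rule hat_lift_rtranclp_imp)
    from 2 g2 obtain g1 where g1: "\<gamma>\<^sub>1 = spmf_of_pmf g1" "lift_step \<alpha> g1 g2"
      by (blast elim: hat_lift_imp_lift_step)
    from 1 g1 obtain g0 where "spmf_of_pmf g = spmf_of_pmf g0" "(lift_step Tau)\<^sup>*\<^sup>* g0 g1"
      by (blast elim: hat_lift_rtranclp_imp)
    with g1 g2 False show ?thesis
      unfolding weak_step_def by (auto dest!: spmf_of_pmf_eqD intro!: relcomppI)
  qed
  moreover have "weak_lift \<alpha> (spmf_of_pmf g) (spmf_of_pmf g')" if "weak_step \<alpha> g g'"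
    using that False unfolding weak_lift_def weak_step_def
    by (simp add: relcompp.simps) (metis lift_step_rtranclp_imp lift_step_imp_hat_lift)
  ultimately show ?thesis by blast
qed

text \<open>The second marginal of a matching is a distribution, so every answer has full mass and
  the weak moves reduce to steps between \<open>pmf\<close>s; the matching itself witnesses
  \<open>rel_pmf\<close>.\<close>

lemma weak_prob_bisim_iff:
  "weak_prob_bisim R \<longleftrightarrow> R \<subseteq> {M. wf_cps M} \<times> {M. wf_cps M} \<and> sym R \<and>
     (\<forall>M N \<alpha> \<gamma>. (M, N) \<in> R \<longrightarrow> cps_trans M \<alpha> \<gamma> \<longrightarrow>
        (\<exists>\<gamma>'. weak_step \<alpha> (return_pmf N) \<gamma>' \<and> rel_pmf (\<lambda>M N. (M, N) \<in> R) \<gamma> \<gamma>'))"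
proof -
  have "(\<exists>\<gamma>' \<omega>. weak_lift \<alpha> (return_spmf N) \<gamma>' \<and> matching \<omega> \<gamma> \<gamma>' \<and>
           (\<forall>M' N'. pmf \<omega> (M', N') > 0 \<longrightarrow> (M', N') \<in> R)) \<longleftrightarrow>
    (\<exists>\<gamma>'. weak_step \<alpha> (return_pmf N) \<gamma>' \<and> rel_pmf (\<lambda>M N. (M, N) \<in> R) \<gamma> \<gamma>')" for N \<alpha> \<gamma>
    unfolding matching_def rel_pmf.simps weak_lift_iff[symmetric]
    by (auto simp: pmf_positive_iff simp flip: spmf_of_pmf_return_pmf)
  then show ?thesis unfolding weak_prob_bisim_def by simp
qed

section \<open>Idling, mixing and invariants of lifted steps\<close>

lemma lift_step_refl: "finite (set_pmf g) \<Longrightarrow> lift_step Tau g g"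
  unfolding lift_step_def
  by (intro exI[of _ "map_pmf (\<lambda>M. (M, return_pmf M)) g"])
    (auto simp: pmf.map_comp o_def hat_trans_def bind_map_pmf bind_return_pmf')

lemma lift_step_return: "hat_trans \<alpha> M \<delta> \<Longrightarrow> lift_step \<alpha> (return_pmf M) \<delta>"
  unfolding lift_step_def by (intro exI[of _ "return_pmf (M, \<delta>)"]) (auto simp: bind_return_pmf)

text \<open>The witnesses for the single \<open>a\<close> are mixed with the weights of
  \<open>p\<close>; finite support of \<open>p\<close> keeps the mixture finite.\<close>

lemma lift_step_bind:
  assumes "finite (set_pmf p)" "\<And>a. a \<in> set_pmf p \<Longrightarrow> lift_step \<alpha> (f a) (h a)"
  shows "lift_step \<alpha> (bind_pmf p f) (bind_pmf p h)"
proof -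
  have "\<forall>a\<in>set_pmf p. \<exists>D. finite (set_pmf D) \<and> map_pmf fst D = f a \<and>
      (\<forall>(M, \<delta>)\<in>set_pmf D. hat_trans \<alpha> M \<delta>) \<and> h a = bind_pmf D snd"
    using assms(2) unfolding lift_step_def by blast
  then obtain D where D: "\<And>a. a \<in> set_pmf p \<Longrightarrow> finite (set_pmf (D a)) \<and> map_pmf fst (D a) = f a \<and>
      (\<forall>(M, \<delta>)\<in>set_pmf (D a). hat_trans \<alpha> M \<delta>) \<and> h a = bind_pmf (D a) snd"
    by metis
  show ?thesis
    unfolding lift_step_def
  proof (intro exI[of _ "bind_pmf p D"] conjI)
    show "map_pmf fst (bind_pmf p D) = bind_pmf p f"
      unfolding map_bind_pmf by (rule bind_pmf_cong) (use D in auto)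
    show "bind_pmf p h = bind_pmf (bind_pmf p D) snd"
      unfolding bind_assoc_pmf by (rule bind_pmf_cong) (use D in auto)
  qed (use assms(1) D in auto)
qed

text \<open>The runs from the various \<open>f a\<close> may differ in length. Idle steps at their
  ends bring all of them to the maximal length, after which they are mixed step by step; idling in
  \<open>h a\<close> uses that its support is finite.\<close>

lemma lift_step_bind_rtranclp:
  assumes "finite (set_pmf p)"
    and "\<And>a. a \<in> set_pmf p \<Longrightarrow> (lift_step Tau)\<^sup>*\<^sup>* (f a) (h a)"
    and "\<And>a. a \<in> set_pmf p \<Longrightarrow> finite (set_pmf (h a))"
  shows "(lift_step Tau)\<^sup>*\<^sup>* (bind_pmf p f) (bind_pmf p h)"
proof -
  have "\<forall>a\<in>set_pmf p. \<exists>n. (lift_step Tau ^^ n) (f a) (h a)"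
    using assms(2) by (blast dest: rtranclp_imp_relpowp)
  then obtain n where n: "\<And>a. a \<in> set_pmf p \<Longrightarrow> (lift_step Tau ^^ n a) (f a) (h a)"
    by metis
  define m where "m = Max (n ` set_pmf p)"
  have pad: "(lift_step Tau ^^ m) (f a) (h a)" if a: "a \<in> set_pmf p" for a
  proof -
    have "(lift_step Tau ^^ j) (h a) (h a)" for j
      using lift_step_refl[OF assms(3)[OF a]] by (induction j) auto
    with n[OF a] have "(lift_step Tau ^^ (n a + (m - n a))) (f a) (h a)"
      unfolding relpowp_add by blast
    moreover have "n a \<le> m" using a assms(1) by (simp add: m_def)
    ultimately show ?thesis by simp
  qed
  have "(lift_step Tau ^^ m) (bind_pmf p f) (bind_pmf p h)"
    using pad
  proof (induction m arbitrary: f)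
    case 0
    then show ?case by (auto intro!: bind_pmf_cong)
  next
    case (Suc m)
    then have "\<forall>a\<in>set_pmf p. \<exists>k. lift_step Tau (f a) k \<and> (lift_step Tau ^^ m) k (h a)"
      by (blast dest: relpowp_Suc_D2)
    then obtain k where k: "\<And>a. a \<in> set_pmf p \<Longrightarrow> lift_step Tau (f a) (k a) \<and> (lift_step Tau ^^ m) (k a) (h a)"
      by metis
    then have "lift_step Tau (bind_pmf p f) (bind_pmf p k)"
      using assms(1) by (intro lift_step_bind) auto
    with Suc.IH[of k] k show ?case by (blast intro: relpowp_Suc_I2)
  qed
  then show ?thesis by (rule relpowp_imp_rtranclp)
qed

lemma lift_step_invariant:
  assumes "lift_step \<alpha> g g'" "\<And>M. M \<in> set_pmf g \<Longrightarrow> I M"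
    and "\<And>M \<delta> M'. I M \<Longrightarrow> cps_trans M \<alpha> \<delta> \<Longrightarrow> M' \<in> set_pmf \<delta> \<Longrightarrow> I M'"
    and "M' \<in> set_pmf g'"
  shows "I M'"
proof -
  from assms(1,4) obtain D M \<delta> where "map_pmf fst D = g" "(M, \<delta>) \<in> set_pmf D" "hat_trans \<alpha> M \<delta>"
    "M' \<in> set_pmf \<delta>"
    unfolding lift_step_def by fastforce
  moreover from this have "I M" using assms(2) by force
  ultimately show ?thesis using assms(3) by (auto simp: hat_trans_def)
qed

lemma lift_step_rtranclp_invariant:
  assumes "(lift_step Tau)\<^sup>*\<^sup>* g g'" "\<And>M. M \<in> set_pmf g \<Longrightarrow> I M"
    and "\<And>M \<delta> M'. I M \<Longrightarrow> cps_trans M Tau \<delta> \<Longrightarrow> M' \<in> set_pmf \<delta> \<Longrightarrow> I M'"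
    and "M' \<in> set_pmf g'"
  shows "I M'"
  using assms(1,4)
proof (induction arbitrary: M' rule: rtranclp_induct)
  case (step g1 g2)
  show ?case by (rule lift_step_invariant[OF step(2) step.IH assms(3) step.prems])
qed (use assms(2) in blast)

lemma lift_step_finite:
  assumes "lift_step \<alpha> g g'"
    and "\<And>M \<delta>. M \<in> set_pmf g \<Longrightarrow> cps_trans M \<alpha> \<delta> \<Longrightarrow> finite (set_pmf \<delta>)"
  shows "finite (set_pmf g')"
  using assms unfolding lift_step_def hat_trans_def by fastforce

section \<open>Well-formedness, invariants and progress of systems\<close>

lemma wf_cps_Sys_iff: "wf_cps (Sys E S P) \<longleftrightarrow>
    wf_env E \<and> S \<in> pstates E \<and> wf_proc P \<and> pdom P \<subseteq> svars E <+> avars E"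
proof -
  have "pdom P \<subseteq> A <+> B \<longleftrightarrow> sensors P \<subseteq> A \<and> actuators P \<subseteq> B" for A B
    unfolding sensors_pdom actuators_pdom
    by (auto simp: subset_iff split_sum_all elim: sumE)
  then show ?thesis by (cases S) (auto simp: pstates_def fun_space_def)
qed

lemma set_sys_pmf: "set_pmf (sys_pmf E \<sigma> \<pi>) = (\<lambda>(S, P). Sys E S P) ` (set_pmf \<sigma> \<times> set_pmf \<pi>)"
  by (simp add: sys_pmf_def)

text \<open>\<open>Dead\<close> is classed with the systems about to reach it: the only move that a
  system which is not alive can have is the \<tau>-move to \<open>Dead\<close>.\<close>

fun alive :: "('x, 's, 'a, 'c) cps \<Rightarrow> bool" where
  "alive Dead \<longleftrightarrow> False"
| "alive (Sys E S P) \<longleftrightarrow> in_inv S E"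

lemma not_alive_trans: "cps_trans M \<alpha> \<gamma> \<Longrightarrow> \<not> alive M \<Longrightarrow> \<alpha> = Tau \<and> \<gamma> = return_pmf Dead"
  by (auto elim!: cps_trans.cases cstep.cases)

lemma Dead_no_trans [simp]: "\<not> cps_trans Dead \<alpha> \<gamma>"
  by (auto elim!: cps_trans.cases cstep.cases)

lemma cstep_preserves:
  assumes "cstep (Sys E S P) \<alpha> \<gamma>" "wf_cps (Sys E S P)" "in_inv S E"
  shows "finite (set_pmf \<gamma>) \<and> (\<forall>M'\<in>set_pmf \<gamma>. \<exists>S' P'. M' = Sys E S' P' \<and> wf_cps M' \<and>
    in_inv S' E \<and> depth P' < depth P \<and> pdom P' \<subseteq> pdom P)"
proof -
  have wf: "ok_proc P" "fpv P = {}" "fv P = {}" "pdom P \<subseteq> svars E <+> avars E" "wf_env E" "S \<in> pstates E"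
    using assms(2) by (auto simp: wf_cps_Sys_iff wf_proc_def)
  \<comment> \<open>One argument for the three rules that apply inside the invariant:
    \<open>f\<close> is the identity, or for a read the substitution that eliminates the variable in
    \<open>bound_vars l\<close>.\<close>
  have *: "?thesis" if p: "pstep P l \<pi>" "\<gamma> = sys_pmf E (return_pmf S') (map_pmf f \<pi>)"
    "S' \<in> pstates E" "in_inv S' E"
    and f: "\<And>Q. ok_proc Q \<Longrightarrow> fpv Q = {} \<Longrightarrow> fv Q \<subseteq> bound_vars l \<Longrightarrow>
      ok_proc (f Q) \<and> fpv (f Q) = {} \<and> fv (f Q) = {} \<and> pdom (f Q) = pdom Q \<and> depth (f Q) = depth Q"
    for l \<pi> S' f
  proof -
    have "\<exists>S'' P''. M' = Sys E S'' P'' \<and> wf_cps M' \<and> in_inv S'' E \<and> depth P'' < depth P \<and> pdom P'' \<subseteq> pdom P"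
      if "M' \<in> set_pmf \<gamma>" for M'
    proof -
      from that p(2) obtain Q where Q: "Q \<in> set_pmf \<pi>" "M' = Sys E S' (f Q)"
        by (auto simp: set_sys_pmf)
      from pstep_preserves[OF p(1) wf(1,2) Q(1)] wf(3) f[of Q] have
        "ok_proc (f Q) \<and> fpv (f Q) = {} \<and> fv (f Q) = {} \<and> pdom (f Q) \<subseteq> pdom P \<and> depth (f Q) < depth P"
        by auto
      with p(3,4) wf Q(2) show ?thesis by (auto simp: wf_cps_Sys_iff wf_proc_def)
    qed
    moreover have "finite (set_pmf \<gamma>)" using pstep_finite[OF p(1) wf(1,2)] p(2) by (auto simp: set_sys_pmf)
    ultimately show ?thesis by blast
  qed
  from assms(1) show ?thesis
  proof cases
    case (Proc \<pi>)
    then show ?thesis by (intro *[of "Act \<alpha>" \<pi> S "\<lambda>x. x"]) (use wf assms in \<open>auto simp: pmf.map_ident\<close>)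
  next
    case (Sensor s z \<pi> \<xi>x \<xi>s \<xi>a r)
    then show ?thesis by (intro *[of "Rd s z" \<pi> S "subst (Real r) z"]) (use wf assms in \<open>auto simp: fv_subst\<close>)
  next
    case (Actuator a v \<pi> \<xi>x \<xi>s \<xi>a)
    \<comment> \<open>The actuator is already in the domain, so the update keeps the domain and the
      new state still fits \<open>E\<close>.\<close>
    have "a \<in> avars E" using pstep_phys_label[OF Actuator(4) wf(1,2)] wf(4) by auto
    with Actuator show ?thesis
      by (intro *[of "Wr a v" \<pi> "(\<xi>x, \<xi>s, \<xi>a(a \<mapsto> to_real v))" "\<lambda>x. x"])
        (use wf assms in \<open>auto simp: pmf.map_ident pstates_def fun_space_def\<close>)
  next
    case Deadlock
    with assms(3) show ?thesis by simp
  qed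
qed

lemma next_env_preserves:
  assumes "wf_env E" "S \<in> pstates E"
  shows "finite (set_pmf (next_env E S)) \<and> set_pmf (next_env E S) \<subseteq> pstates E"
proof -
  obtain \<xi>x \<xi>s \<xi>a where S: "S = (\<xi>x, \<xi>s, \<xi>a)" by (cases S)
  have "finite (set_pmf (evol E \<xi>x \<xi>a))" "set_pmf (evol E \<xi>x \<xi>a) \<subseteq> fun_space (xvars E)"
    "\<xi>a \<in> fun_space (avars E)"
    using assms unfolding wf_env_def pstates_def S by auto
  moreover have "finite (set_pmf (meas E \<zeta>))" "set_pmf (meas E \<zeta>) \<subseteq> fun_space (svars E)"
    if "\<zeta> \<in> fun_space (xvars E)" for \<zeta>
    using assms(1) that unfolding wf_env_def by auto
  ultimately show ?thesis unfolding S by (auto simp: pstates_def subset_iff)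
qed

text \<open>The unchanged environment is recorded because physical disjointness depends on it alone
  and so survives moves.\<close>

lemma cps_trans_preserves:
  assumes "cps_trans (Sys E S P) \<alpha> \<gamma>" "wf_cps (Sys E S P)"
  shows "finite (set_pmf \<gamma>) \<and> (\<forall>M'\<in>set_pmf \<gamma>. M' = Dead \<or>
    (\<exists>S' P'. M' = Sys E S' P' \<and> wf_cps M' \<and> pdom P' \<subseteq> pdom P))"
  using assms(1)
proof cases
  case Instant
  show ?thesis
  proof (cases "in_inv S E")
    case True
    with cstep_preserves[OF Instant assms(2)] show ?thesis by blast
  next
    case False
    with assms(1) not_alive_trans[of "Sys E S P"] show ?thesis by fastforce
  qed
next
  case (Timed \<pi>)
  have wf: "ok_proc P" "fpv P = {}" "fv P = {}" "pdom P \<subseteq> svars E <+> avars E" "wf_env E" "S \<in> pstates E"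
    using assms(2) by (auto simp: wf_cps_Sys_iff wf_proc_def)
  have "M' = Dead \<or> (\<exists>S' P'. M' = Sys E S' P' \<and> wf_cps M' \<and> pdom P' \<subseteq> pdom P)" if M': "M' \<in> set_pmf \<gamma>" for M'
  proof -
    from M' Timed obtain S' P' where "M' = Sys E S' P'" "S' \<in> set_pmf (next_env E S)" "P' \<in> set_pmf \<pi>"
      by (auto simp: set_sys_pmf)
    with ptick_preserves[OF Timed(3) wf(1,2), of P'] wf next_env_preserves[OF wf(5,6)] show ?thesis
      by (cases S') (auto simp: wf_cps_Sys_iff wf_proc_def simp del: wf_cps.simps)
  qed
  moreover have "finite (set_pmf \<gamma>)"
    using Timed ptick_finite[OF Timed(3) wf(1,2)] next_env_preserves[OF wf(5,6)] by (auto simp: set_sys_pmf)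
  ultimately show ?thesis by blast
qed

lemma cps_trans_wf:
  assumes "cps_trans M \<alpha> \<gamma>" "wf_cps M"
  shows "finite (set_pmf \<gamma>)" "M' \<in> set_pmf \<gamma> \<Longrightarrow> wf_cps M'"
proof -
  obtain E S P where M: "M = Sys E S P" using assms(1) by (cases M rule: cps.exhaust) auto
  note * = cps_trans_preserves[OF assms[unfolded M]]
  show "finite (set_pmf \<gamma>)" using * by blast
  show "wf_cps M'" if "M' \<in> set_pmf \<gamma>" using * that by force
qed

text \<open>Instantaneous moves do not touch the state variables, and the invariant speaks only of
  these.\<close>

lemma cps_trans_alive:
  assumes "cps_trans M \<alpha> \<gamma>" "wf_cps M" "alive M" "\<alpha> \<noteq> Tick" "M' \<in> set_pmf \<gamma>"
  shows "alive M'"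
proof (cases M)
  case (Sys E S P)
  from assms(1,4) have "cstep M \<alpha> \<gamma>" by cases auto
  with cstep_preserves[of E S P] Sys assms show ?thesis by fastforce
qed (use assms in simp)

lemma cps_progress:
  assumes "wf_cps M" "alive M"
  shows "(\<exists>\<gamma>. cps_trans M Tau \<gamma>) \<or> (\<exists>\<gamma>. cps_trans M Tick \<gamma>)"
proof (cases M)
  case (Sys E S P)
  have wf: "ok_proc P" "fpv P = {}" "fv P = {}" "pdom P \<subseteq> svars E <+> avars E" "S \<in> pstates E"
    using assms(1) by (auto simp: Sys wf_cps_Sys_iff wf_proc_def)
  obtain \<xi>x \<xi>s \<xi>a where S: "S = (\<xi>x, \<xi>s, \<xi>a)" by (cases S)
  have inv: "in_inv (\<xi>x, \<xi>s, \<xi>a) E" using assms(2) Sys S by simp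
  have "\<exists>\<gamma>. cstep M Tau \<gamma>" if "pstep P l \<pi>" "internal l" for l \<pi>
  proof (cases l)
    case (Act \<alpha>)
    with that have "pstep P (Act Tau) \<pi>" by simp
    then show ?thesis using inv unfolding Sys S by (blast intro: cstep.Proc)
  next
    case (Rd s z)
    with pstep_phys_label[OF that(1) wf(1,2)] wf(4,5) have "s \<in> dom \<xi>s"
      by (auto simp: S pstates_def fun_space_def)
    with that Rd inv show ?thesis unfolding Sys S by (blast intro: cstep.Sensor)
  next
    case (Wr a v)
    with that inv show ?thesis unfolding Sys S by (blast intro: cstep.Actuator)
  qed
  with progress_proc[OF wf(1-3)] show ?thesis
    using assms(2) unfolding Sys by (metis alive.simps(2) cps_trans.Instant cps_trans.Timed)
qed (use assms in simp)

lemma pstep_not_tick: "pstep P l \<pi> \<Longrightarrow> l \<noteq> Act Tick"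
  by (induction rule: pstep.induct) auto

lemma tick_no_tau:
  assumes "cps_trans M Tick \<gamma>"
  shows "\<not> cps_trans M Tau \<gamma>'"
  using assms
proof cases
  case Instant
  then show ?thesis by cases (auto dest: pstep_not_tick)
next
  case Timed
  then show ?thesis by (auto elim!: cps_trans.cases)
qed

section \<open>Bisimulations in context\<close>

lemma lift_step_rtranclp_stuck:
  assumes "(lift_step Tau)\<^sup>*\<^sup>* (return_pmf M) g" "\<nexists>\<delta>. cps_trans M Tau \<delta>"
  shows "g = return_pmf M"
proof -
  have "M' = M" if "M' \<in> set_pmf g" for M'
    by (rule lift_step_rtranclp_invariant[OF assms(1), where I = "\<lambda>M'. M' = M"]) (use assms(2) that in auto)
  then show ?thesis by (auto simp: set_pmf_subset_singleton[symmetric])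
qed

text \<open>Without \<tau>-moves the leading part of the weak step can only idle, so the action is
  taken by \<open>M\<close> itself.\<close>

lemma weak_step_stuck:
  assumes "weak_step \<alpha> (return_pmf M) g" "\<nexists>\<delta>. cps_trans M Tau \<delta>" "\<alpha> \<noteq> Tau"
  shows "\<exists>\<delta>. cps_trans M \<alpha> \<delta>"
proof -
  from assms obtain g1 g2 where "(lift_step Tau)\<^sup>*\<^sup>* (return_pmf M) g1" "lift_step \<alpha> g1 g2"
    unfolding weak_step_def by auto
  with assms(2) have "lift_step \<alpha> (return_pmf M) g2" using lift_step_rtranclp_stuck by metis
  then obtain D where D: "map_pmf fst D = return_pmf M" "\<forall>(M, \<delta>)\<in>set_pmf D. hat_trans \<alpha> M \<delta>"
    unfolding lift_step_def by blast
  obtain M' \<delta> where "(M', \<delta>) \<in> set_pmf D" using set_pmf_not_empty[of D] by fastforce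
  moreover from this D(1) have "M' = M"
    by (metis fst_conv imageI set_map_pmf set_return_pmf singletonD)
  ultimately show ?thesis using D(2) assms(3) by (auto simp: hat_trans_def)
qed

lemma weak_prob_bisimD:
  assumes "weak_prob_bisim R"
  shows "(M, N) \<in> R \<Longrightarrow> wf_cps M" "(M, N) \<in> R \<Longrightarrow> wf_cps N" "(M, N) \<in> R \<Longrightarrow> (N, M) \<in> R"
    "(M, N) \<in> R \<Longrightarrow> cps_trans M \<alpha> \<gamma> \<Longrightarrow>
      \<exists>\<gamma>'. weak_step \<alpha> (return_pmf N) \<gamma>' \<and> rel_pmf (\<lambda>M N. (M, N) \<in> R) \<gamma> \<gamma>'"
  using assms unfolding weak_prob_bisim_iff by (auto dest: symD)

lemma rel_pmf_return_right:
  "rel_pmf Q p (return_pmf y) \<Longrightarrow> x \<in> set_pmf p \<Longrightarrow> Q x y"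
  by (auto simp: rel_pmf_return_pmf2)

text \<open>An \<open>M\<close> without \<tau>-moves answers a \<tau>-move by staying put, so each
  single outcome is matched with \<open>M\<close>.\<close>

lemma bisim_stuck:
  assumes R: "weak_prob_bisim R" and "(N, M) \<in> R" "\<nexists>\<delta>. cps_trans M Tau \<delta>"
    and "cps_trans N Tau \<delta>" "N' \<in> set_pmf \<delta>"
  shows "(N', M) \<in> R"
proof -
  obtain g where g: "weak_step Tau (return_pmf M) g" "rel_pmf (\<lambda>M N. (M, N) \<in> R) \<delta> g"
    using weak_prob_bisimD(4)[OF R assms(2,4)] by blast
  then have "g = return_pmf M"
    using lift_step_rtranclp_stuck assms(3) by (auto simp: weak_step_def)
  with g(2) assms(5) show ?thesis by (auto dest: rel_pmf_return_right)
qed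

fun cps_depth :: "('x, 's, 'a, 'c) cps \<Rightarrow> nat" where
  "cps_depth Dead = 0"
| "cps_depth (Sys E S P) = depth P"

lemma cps_trans_depth:
  assumes "cps_trans M Tau \<gamma>" "wf_cps M" "alive M" "M' \<in> set_pmf \<gamma>"
  shows "cps_depth M' < cps_depth M"
proof (cases M)
  case (Sys E S P)
  from assms(1) have "cstep M Tau \<gamma>" by cases auto
  with cstep_preserves[of E S P] Sys assms show ?thesis by fastforce
qed (use assms in simp)

text \<open>
  Time-guardedness bounds the number of consecutive \<open>\<tau>\<close>-moves, so a live system always reaches a
  \<open>tick\<close>, which \<open>Dead\<close> cannot match.
\<close>

lemma bisim_Dead_not_alive:
  assumes R: "weak_prob_bisim R" and "(M, Dead) \<in> R"
  shows "\<not> alive M"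
  using assms(2)
proof (induction M rule: measure_induct_rule[of cps_depth])
  case (less M)
  show ?case
  proof
    assume alive: "alive M"
    note wf = weak_prob_bisimD(1)[OF R less.prems]
    from cps_progress[OF wf alive] show False
    proof
      assume "\<exists>\<gamma>. cps_trans M Tau \<gamma>"
      then obtain \<gamma> where \<gamma>: "cps_trans M Tau \<gamma>" ..
      obtain M' where M': "M' \<in> set_pmf \<gamma>" using set_pmf_not_empty[of \<gamma>] by blast
      have "(M', Dead) \<in> R" using bisim_stuck[OF R less.prems _ \<gamma> M'] by simp
      with less.IH cps_trans_depth[OF \<gamma> wf alive M'] cps_trans_alive[OF \<gamma> wf alive _ M'] show False
        by blast
    next
      assume "\<exists>\<gamma>. cps_trans M Tick \<gamma>"
      then obtain \<gamma> where \<gamma>: "cps_trans M Tick \<gamma>" ..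
      from weak_prob_bisimD(4)[OF R less.prems \<gamma>] weak_step_stuck[of Tick Dead] show False by auto
    qed
  qed
qed

text \<open>An \<open>N\<close> outside its invariant moves to \<open>Dead\<close>. The \<tau>-moves
  by which \<open>M\<close> answers keep it alive, so a live system would be related to
  \<open>Dead\<close>.\<close>

lemma bisim_alive:
  assumes R: "weak_prob_bisim R" and MN: "(M, N) \<in> R" and "alive M"
  shows "alive N"
proof (cases N)
  case Dead
  with bisim_Dead_not_alive[OF R] MN assms(3) show ?thesis by blast
next
  case (Sys E S P)
  show ?thesis
  proof (rule ccontr)
    assume "\<not> alive N"
    with Sys have "cps_trans N Tau (return_pmf Dead)" by (auto intro: cps_trans.Instant cstep.Deadlock)
    from weak_prob_bisimD(4)[OF R weak_prob_bisimD(3)[OF R MN] this] obtain g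
      where g: "(lift_step Tau)\<^sup>*\<^sup>* (return_pmf M) g" "rel_pmf (\<lambda>M N. (M, N) \<in> R) (return_pmf Dead) g"
      by (auto simp: weak_step_def)
    obtain M' where M': "M' \<in> set_pmf g" using set_pmf_not_empty[of g] by blast
    with g(2) have "(M', Dead) \<in> R"
      using weak_prob_bisimD(3)[OF R] by (auto simp: rel_pmf_return_pmf1)
    moreover have "wf_cps M' \<and> alive M'"
      by (rule lift_step_rtranclp_invariant[OF g(1) _ _ M'])
        (use assms(3) weak_prob_bisimD(1)[OF R MN] in \<open>auto intro: cps_trans_wf(2) cps_trans_alive\<close>)
    ultimately show False using bisim_Dead_not_alive[OF R] by blast
  qed
qed

section \<open>Systems in an abstract context\<close>

fun co :: "('x, 's, 'a, 'c) act \<Rightarrow> ('x, 's, 'a, 'c) act \<Rightarrow> bool" where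
  "co (Snd c v) (Rcv d w) \<longleftrightarrow> c = d \<and> v = w"
| "co (Rcv c v) (Snd d w) \<longleftrightarrow> c = d \<and> v = w"
| "co _ _ \<longleftrightarrow> False"

lemma co_not_Tau: "co \<alpha> \<beta> \<Longrightarrow> \<alpha> \<noteq> Tau \<and> \<alpha> \<noteq> Tick"
  by (cases "(\<alpha>, \<beta>)" rule: co.cases) auto

text \<open>The product distribution under \<open>f\<close>, with \<open>k\<close> drawn first:
  \<open>g\<close> can then be replaced by a distribution that depends on the outcome
  \<open>k\<close>.\<close>

definition cprod :: "('m \<Rightarrow> 'k \<Rightarrow> 'n) \<Rightarrow> 'm pmf \<Rightarrow> 'k pmf \<Rightarrow> 'n pmf" where
  "cprod f g \<kappa> = bind_pmf \<kappa> (\<lambda>k. map_pmf (\<lambda>M. f M k) g)"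

text \<open>
  The three operators are instances: \<open>k\<close> is the other system, the pure-logical process or the
  restricted channel.  \<open>calive k\<close> says that \<open>k\<close> is inside its invariant, \<open>allowed k\<close> are the actions of \<open>M\<close>
  that \<open>k\<close> lets through, and \<open>kstep\<close>, \<open>ktick\<close> are the moves of \<open>k\<close> itself.
\<close>

locale cps_context =
  fixes comp :: "('x, 's, 'a, 'c) cps \<Rightarrow> 'k \<Rightarrow> ('x, 's, 'a, 'c) cps"
    and compat :: "('x, 's, 'a, 'c) cps \<Rightarrow> 'k \<Rightarrow> bool"
    and calive :: "'k \<Rightarrow> bool"
    and allowed :: "'k \<Rightarrow> ('x, 's, 'a, 'c) act \<Rightarrow> bool"
    and kstep :: "'k \<Rightarrow> ('x, 's, 'a, 'c) act \<Rightarrow> 'k pmf \<Rightarrow> bool"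
    and ktick :: "'k \<Rightarrow> 'k pmf \<Rightarrow> bool"
  assumes wf_comp: "compat M k \<Longrightarrow> wf_cps (comp M k)"
    and wf_compat: "compat M k \<Longrightarrow> wf_cps M"
    and alive_comp: "compat M k \<Longrightarrow> alive (comp M k) \<longleftrightarrow> alive M \<and> calive k"
    and compat_trans: "compat M k \<Longrightarrow> cps_trans M \<alpha> \<delta> \<Longrightarrow> M' \<in> set_pmf \<delta> \<Longrightarrow> compat M' k"
    and compat_kstep: "compat M k \<Longrightarrow> kstep k \<alpha> \<kappa> \<Longrightarrow> k' \<in> set_pmf \<kappa> \<Longrightarrow> compat M k' \<and> calive k'"
    and compat_ktick: "compat M k \<Longrightarrow> ktick k \<kappa> \<Longrightarrow> k' \<in> set_pmf \<kappa> \<Longrightarrow> compat M k'"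
    and finite_kstep: "compat M k \<Longrightarrow> kstep k \<alpha> \<kappa> \<Longrightarrow> finite (set_pmf \<kappa>)"
    and finite_ktick: "compat M k \<Longrightarrow> ktick k \<kappa> \<Longrightarrow> finite (set_pmf \<kappa>)"
    and allowed_Tau: "allowed k Tau"
    and trans_left: "compat M k \<Longrightarrow> calive k \<Longrightarrow> cps_trans M \<alpha> \<delta> \<Longrightarrow> \<alpha> \<noteq> Tick \<Longrightarrow> allowed k \<alpha> \<Longrightarrow>
      cps_trans (comp M k) \<alpha> (map_pmf (\<lambda>M'. comp M' k) \<delta>)"
    and trans_right: "compat M k \<Longrightarrow> alive M \<Longrightarrow> calive k \<Longrightarrow> kstep k \<alpha> \<kappa> \<Longrightarrow>
      cps_trans (comp M k) \<alpha> (map_pmf (comp M) \<kappa>)"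
    and trans_com: "compat M k \<Longrightarrow> calive k \<Longrightarrow> cps_trans M \<alpha> \<delta> \<Longrightarrow> kstep k \<beta> \<kappa> \<Longrightarrow> co \<alpha> \<beta> \<Longrightarrow>
      cps_trans (comp M k) Tau (cprod comp \<delta> \<kappa>)"
    and trans_tick: "compat M k \<Longrightarrow> calive k \<Longrightarrow> cps_trans M Tick \<delta> \<Longrightarrow> ktick k \<kappa> \<Longrightarrow>
      (\<nexists>\<gamma>. cps_trans (comp M k) Tau \<gamma>) \<Longrightarrow> cps_trans (comp M k) Tick (cprod comp \<delta> \<kappa>)"
    and trans_cases: "compat M k \<Longrightarrow> alive M \<Longrightarrow> calive k \<Longrightarrow> cps_trans (comp M k) \<alpha> \<gamma> \<Longrightarrow>
      (\<exists>\<delta>. cps_trans M \<alpha> \<delta> \<and> \<alpha> \<noteq> Tick \<and> allowed k \<alpha> \<and> \<gamma> = map_pmf (\<lambda>M'. comp M' k) \<delta>) \<or>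
      (\<exists>\<kappa>. kstep k \<alpha> \<kappa> \<and> \<gamma> = map_pmf (comp M) \<kappa>) \<or>
      (\<exists>\<beta> \<beta>' \<delta> \<kappa>. \<alpha> = Tau \<and> co \<beta> \<beta>' \<and> cps_trans M \<beta> \<delta> \<and> kstep k \<beta>' \<kappa> \<and> \<gamma> = cprod comp \<delta> \<kappa>) \<or>
      (\<exists>\<delta> \<kappa>. \<alpha> = Tick \<and> cps_trans M Tick \<delta> \<and> ktick k \<kappa> \<and> \<gamma> = cprod comp \<delta> \<kappa>)"
begin

section \<open>Weak moves inside a context\<close>

lemma lift_step_comp:
  assumes "lift_step \<alpha> g g'" "calive k" "\<And>M. M \<in> set_pmf g \<Longrightarrow> compat M k" "\<alpha> \<noteq> Tick" "allowed k \<alpha>"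
  shows "lift_step \<alpha> (map_pmf (\<lambda>M. comp M k) g) (map_pmf (\<lambda>M. comp M k) g')"
proof -
  let ?c = "\<lambda>M. comp M k"
  from assms(1) obtain D where D: "finite (set_pmf D)" "map_pmf fst D = g"
    "\<forall>(M, \<delta>)\<in>set_pmf D. hat_trans \<alpha> M \<delta>" "g' = bind_pmf D snd"
    unfolding lift_step_def by blast
  have "hat_trans \<alpha> (comp M k) (map_pmf ?c \<delta>)" if "(M, \<delta>) \<in> set_pmf D" for M \<delta>
  proof -
    have "compat M k" using that D(2) assms(3) by force
    moreover have "hat_trans \<alpha> M \<delta>" using that D(3) by auto
    ultimately show ?thesis using trans_left[of M k \<alpha> \<delta>] assms(2,4,5) by (auto simp: hat_trans_def)
  qed
  then show ?thesis
    unfolding lift_step_def using D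
    by (intro exI[of _ "map_pmf (\<lambda>(M, \<delta>). (?c M, map_pmf ?c \<delta>)) D"])
      (auto simp: pmf.map_comp o_def split_beta bind_map_pmf map_bind_pmf)
qed

lemma lift_step_compat:
  "lift_step \<alpha> g g' \<Longrightarrow> (\<And>M. M \<in> set_pmf g \<Longrightarrow> compat M k) \<Longrightarrow> M' \<in> set_pmf g' \<Longrightarrow> compat M' k"
  by (erule lift_step_invariant) (blast intro: compat_trans)+

lemma lift_step_rtranclp_compat:
  "(lift_step Tau)\<^sup>*\<^sup>* g g' \<Longrightarrow> (\<And>M. M \<in> set_pmf g \<Longrightarrow> compat M k) \<Longrightarrow> M' \<in> set_pmf g' \<Longrightarrow> compat M' k"
  by (erule lift_step_rtranclp_invariant) (blast intro: compat_trans)+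

lemma lift_step_rtranclp_comp:
  assumes "(lift_step Tau)\<^sup>*\<^sup>* g g'" "calive k" "\<And>M. M \<in> set_pmf g \<Longrightarrow> compat M k"
  shows "(lift_step Tau)\<^sup>*\<^sup>* (map_pmf (\<lambda>M. comp M k) g) (map_pmf (\<lambda>M. comp M k) g')"
  using assms(1)
proof (induction rule: rtranclp_induct)
  case (step g1 g2)
  have "compat M k" if "M \<in> set_pmf g1" for M
    by (rule lift_step_rtranclp_compat[OF step(1) assms(3) that])
  with step.hyps(2) assms(2) have "lift_step Tau (map_pmf (\<lambda>M. comp M k) g1) (map_pmf (\<lambda>M. comp M k) g2)"
    by (intro lift_step_comp) (auto simp: allowed_Tau)
  with step.IH show ?case by (rule rtranclp.rtrancl_into_rtrancl)
qed blast

lemma weak_step_comp: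
  assumes "weak_step \<alpha> (return_pmf M) g" "calive k" "compat M k" "\<alpha> \<noteq> Tick" "allowed k \<alpha>"
  shows "weak_step \<alpha> (return_pmf (comp M k)) (map_pmf (\<lambda>M. comp M k) g)"
    and "M' \<in> set_pmf g \<Longrightarrow> compat M' k"
proof -
  let ?c = "map_pmf (\<lambda>M. comp M k)"
  have "weak_step \<alpha> (?c (return_pmf M)) (?c g) \<and> (\<forall>M'\<in>set_pmf g. compat M' k)"
  proof (cases "\<alpha> = Tau")
    case True
    with assms(1) have *: "(lift_step Tau)\<^sup>*\<^sup>* (return_pmf M) g" by (simp add: weak_step_def)
    have "compat M' k" if "M' \<in> set_pmf g" for M'
      by (rule lift_step_rtranclp_compat[OF * _ that]) (use assms(3) in auto)
    moreover have "(lift_step Tau)\<^sup>*\<^sup>* (?c (return_pmf M)) (?c g)"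
      by (rule lift_step_rtranclp_comp[OF * assms(2)]) (use assms(3) in auto)
    ultimately show ?thesis using True by (simp add: weak_step_def)
  next
    case False
    with assms(1) obtain g1 g2 where 1: "(lift_step Tau)\<^sup>*\<^sup>* (return_pmf M) g1" and 2: "lift_step \<alpha> g1 g2"
      and 3: "(lift_step Tau)\<^sup>*\<^sup>* g2 g"
      unfolding weak_step_def by auto
    have c1: "compat M' k" if "M' \<in> set_pmf g1" for M'
      by (rule lift_step_rtranclp_compat[OF 1 _ that]) (use assms(3) in auto)
    have c2: "compat M' k" if "M' \<in> set_pmf g2" for M'
      by (rule lift_step_compat[OF 2 c1 that])
    have c3: "compat M' k" if "M' \<in> set_pmf g" for M'
      by (rule lift_step_rtranclp_compat[OF 3 c2 that])
    have "(lift_step Tau)\<^sup>*\<^sup>* (?c (return_pmf M)) (?c g1)"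
      by (rule lift_step_rtranclp_comp[OF 1 assms(2)]) (use assms(3) in auto)
    moreover have "lift_step \<alpha> (?c g1) (?c g2)"
      by (rule lift_step_comp[OF 2 assms(2) c1 assms(4,5)])
    moreover have "(lift_step Tau)\<^sup>*\<^sup>* (?c g2) (?c g)"
      by (rule lift_step_rtranclp_comp[OF 3 assms(2) c2])
    ultimately show ?thesis using False c3 by (auto simp: weak_step_def)
  qed
  then show "weak_step \<alpha> (return_pmf (comp M k)) (?c g)" "M' \<in> set_pmf g \<Longrightarrow> compat M' k"
    by auto
qed

text \<open>Since \<open>\<alpha>\<close> is not \<tau>, no state of \<open>g\<close> idles, and the
  context can join each of the moves. The resulting \<open>\<beta>\<close> is \<tau> for a
  communication and \<open>Tick\<close> for the passage of time.\<close>

lemma lift_step_sync: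
  assumes "lift_step \<alpha> g g'" "\<alpha> \<noteq> Tau"
    and "\<And>M \<delta>. M \<in> set_pmf g \<Longrightarrow> cps_trans M \<alpha> \<delta> \<Longrightarrow> hat_trans \<beta> (comp M k) (cprod comp \<delta> \<kappa>)"
  shows "lift_step \<beta> (map_pmf (\<lambda>M. comp M k) g) (cprod comp g' \<kappa>)"
proof -
  from assms(1) obtain D where D: "finite (set_pmf D)" "map_pmf fst D = g"
    "\<forall>(M, \<delta>)\<in>set_pmf D. hat_trans \<alpha> M \<delta>" "g' = bind_pmf D snd"
    unfolding lift_step_def by blast
  have "hat_trans \<beta> (comp M k) (cprod comp \<delta> \<kappa>)" if "(M, \<delta>) \<in> set_pmf D" for M \<delta>
  proof -
    have "M \<in> set_pmf g" using that D(2) by force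
    moreover have "cps_trans M \<alpha> \<delta>" using that D(3) assms(2) by (auto simp: hat_trans_def)
    ultimately show ?thesis by (rule assms(3))
  qed
  \<comment> \<open>\<open>cprod\<close> draws the context first, the witness draws the system
    first; the draws are independent and commute.\<close>
  moreover have "cprod comp g' \<kappa> = bind_pmf D (\<lambda>(M, \<delta>). cprod comp \<delta> \<kappa>)"
    unfolding cprod_def D(4) map_bind_pmf by (subst bind_commute_pmf) (simp add: case_prod_unfold)
  ultimately show ?thesis
    unfolding lift_step_def using D(1,2)
    by (intro exI[of _ "map_pmf (\<lambda>(M, \<delta>). (comp M k, cprod comp \<delta> \<kappa>)) D"])
      (auto simp: pmf.map_comp o_def case_prod_unfold bind_map_pmf)
qed

text \<open>
  After a synchronisation \<open>M\<close> may go on with \<open>\<tau>\<close>-moves; a context that a \<open>tick\<close> has driven out of its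
  invariant blocks them, whence the case distinction on \<open>calive k\<close>.
\<close>

lemma cprod_rtranclp:
  assumes "(lift_step Tau)\<^sup>*\<^sup>* g g'" "finite (set_pmf \<kappa>)" "finite (set_pmf g)" "finite (set_pmf g')"
    and "\<And>M k. M \<in> set_pmf g \<Longrightarrow> k \<in> set_pmf \<kappa> \<Longrightarrow> compat M k"
  shows "(lift_step Tau)\<^sup>*\<^sup>* (cprod comp g \<kappa>)
    (bind_pmf \<kappa> (\<lambda>k. map_pmf (\<lambda>M. comp M k) (if calive k then g' else g)))"
  unfolding cprod_def
  by (rule lift_step_bind_rtranclp) (use assms in \<open>auto intro: lift_step_rtranclp_comp\<close>)

lemma compat_finite_lift_step:
  assumes "lift_step \<alpha> g g'" "\<And>M. M \<in> set_pmf g \<Longrightarrow> compat M k"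
  shows "finite (set_pmf g')"
  using assms(1) by (rule lift_step_finite) (use assms(2) wf_compat cps_trans_wf(1) in blast)

lemma compat_finite_rtranclp:
  assumes "(lift_step Tau)\<^sup>*\<^sup>* g g'" "finite (set_pmf g)" "\<And>M. M \<in> set_pmf g \<Longrightarrow> compat M k"
  shows "finite (set_pmf g')"
  using assms(1)
proof (cases rule: rtranclp.cases)
  case (rtrancl_into_rtrancl g1)
  then have h: "(lift_step Tau)\<^sup>*\<^sup>* g g1" "lift_step Tau g1 g'" by simp_all
  show ?thesis
    by (rule compat_finite_lift_step[OF h(2)]) (rule lift_step_rtranclp_compat[OF h(1) assms(3)])
qed (use assms(2) in simp)

text \<open>The second part does not come from \<open>R\<close>: it absorbs outcomes where a tick
  drives \<open>k\<close> out of its invariant and the systems beside \<open>k\<close> need not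
  correspond. It includes pairs with \<open>Dead\<close>, the target of the only move left, so a
  move from one of its pairs is answered by idling.\<close>

definition closure :: "('x, 's, 'a, 'c) cps rel \<Rightarrow> ('x, 's, 'a, 'c) cps rel" where
  "closure R = {(comp M k, comp N k) | M N k. (M, N) \<in> R \<and> compat M k \<and> compat N k} \<union>
     {(A, B). wf_cps A \<and> wf_cps B \<and> \<not> alive A \<and> \<not> alive B}"

lemma closure_comp: "(M, N) \<in> R \<Longrightarrow> compat M k \<Longrightarrow> compat N k \<Longrightarrow> (comp M k, comp N k) \<in> closure R"
  unfolding closure_def by blast

lemma closure_not_alive: "compat M k \<Longrightarrow> compat N k \<Longrightarrow> \<not> calive k \<Longrightarrow> (comp M k, comp N k) \<in> closure R"
  unfolding closure_def by (simp add: wf_comp alive_comp)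

lemma rel_pmf_all:
  assumes "\<And>x y. x \<in> set_pmf p \<Longrightarrow> y \<in> set_pmf q \<Longrightarrow> Q x y"
  shows "rel_pmf Q p q"
  by (rule rel_pmf.intros[of "pair_pmf p q"]) (use assms in \<open>auto simp: map_fst_pair_pmf map_snd_pair_pmf\<close>)

lemma rel_pmf_comp:
  assumes "rel_pmf (\<lambda>M N. (M, N) \<in> R) g g'"
    and "\<And>M. M \<in> set_pmf g \<Longrightarrow> compat M k" "\<And>M. M \<in> set_pmf g' \<Longrightarrow> compat M k"
  shows "rel_pmf (\<lambda>A B. (A, B) \<in> closure R) (map_pmf (\<lambda>M. comp M k) g) (map_pmf (\<lambda>M. comp M k) g')"
  unfolding pmf.rel_map using assms(1)
  by (rule pmf.rel_mono_strong) (use assms(2,3) closure_comp in auto)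

text \<open>Both sides are coupled so as to draw the same \<open>k\<close>. Beside a live
  \<open>k\<close> the coupling of \<open>g\<close> and \<open>g'\<close> is inherited; beside any
  other \<open>k\<close> all outcomes are related, whatever compatible systems \<open>g''\<close>
  yields.\<close>

lemma rel_pmf_cprod:
  assumes "rel_pmf (\<lambda>M N. (M, N) \<in> R) g g'"
    and "\<And>M k. M \<in> set_pmf g \<Longrightarrow> k \<in> set_pmf \<kappa> \<Longrightarrow> compat M k"
    and "\<And>M k. M \<in> set_pmf g' \<Longrightarrow> k \<in> set_pmf \<kappa> \<Longrightarrow> compat M k"
    and "\<And>M k. M \<in> set_pmf g'' \<Longrightarrow> k \<in> set_pmf \<kappa> \<Longrightarrow> compat M k"
  shows "rel_pmf (\<lambda>A B. (A, B) \<in> closure R) (cprod comp g \<kappa>)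
    (bind_pmf \<kappa> (\<lambda>k. map_pmf (\<lambda>M. comp M k) (if calive k then g' else g'')))"
  unfolding cprod_def
proof (rule rel_pmf_bindI[where R = "\<lambda>k k'. k = k' \<and> k \<in> set_pmf \<kappa>"])
  show "rel_pmf (\<lambda>k k'. k = k' \<and> k \<in> set_pmf \<kappa>) \<kappa> \<kappa>" by (rule rel_pmf_reflI) simp
next
  fix k k' assume k: "k = k' \<and> k \<in> set_pmf \<kappa>"
  show "rel_pmf (\<lambda>A B. (A, B) \<in> closure R) (map_pmf (\<lambda>M. comp M k) g)
    (map_pmf (\<lambda>M. comp M k') (if calive k' then g' else g''))"
  proof (cases "calive k")
    case True
    with k assms show ?thesis by (auto intro: rel_pmf_comp)
  next
    case False
    with k assms(2,4) show ?thesis by (auto intro!: rel_pmf_all closure_not_alive)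
  qed
qed

text \<open>Communication and time in one argument: the context moves exactly with the visible step
  in the answer of \<open>N\<close>. That step is taken by \<tau>-derivatives \<open>N'\<close> of
  \<open>N\<close> rather than by \<open>N\<close>; for a tick, the condition relating
  \<open>N'\<close> to \<open>M\<close> is what allows the negative premise to be checked at
  \<open>N'\<close>.\<close>

lemma sim_sync:
  assumes R: "weak_prob_bisim R" and MN: "(M, N) \<in> R" and c: "compat M k" "compat N k"
    and \<alpha>: "\<alpha> \<noteq> Tau" and \<delta>: "cps_trans M \<alpha> \<delta>" and k: "calive k"
    and \<kappa>: "finite (set_pmf \<kappa>)" "\<And>M k'. compat M k \<Longrightarrow> k' \<in> set_pmf \<kappa> \<Longrightarrow> compat M k'"
    and sync: "\<And>N' \<delta>'. compat N' k \<Longrightarrow> (\<nexists>\<gamma>. cps_trans M Tau \<gamma>) \<longrightarrow> (N', M) \<in> R \<Longrightarrow> cps_trans N' \<alpha> \<delta>' \<Longrightarrow>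
      cps_trans (comp N' k) \<beta> (cprod comp \<delta>' \<kappa>)"
  shows "\<exists>\<gamma>'. weak_step \<beta> (return_pmf (comp N k)) \<gamma>' \<and> rel_pmf (\<lambda>A B. (A, B) \<in> closure R) (cprod comp \<delta> \<kappa>) \<gamma>'"
proof -
  from weak_prob_bisimD(4)[OF R MN \<delta>] \<alpha> obtain g1 g2 g3 where 1: "(lift_step Tau)\<^sup>*\<^sup>* (return_pmf N) g1"
    and 2: "lift_step \<alpha> g1 g2" and 3: "(lift_step Tau)\<^sup>*\<^sup>* g2 g3"
    and rel: "rel_pmf (\<lambda>M N. (M, N) \<in> R) \<delta> g3"
    unfolding weak_step_def by auto
  have c1: "compat M' k" if "M' \<in> set_pmf g1" for M'
    by (rule lift_step_rtranclp_compat[OF 1 _ that]) (use c(2) in auto)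
  have c2: "compat M' k" if "M' \<in> set_pmf g2" for M'
    by (rule lift_step_compat[OF 2 c1 that])
  have c3: "compat M' k" if "M' \<in> set_pmf g3" for M'
    by (rule lift_step_rtranclp_compat[OF 3 c2 that])
  have fin2: "finite (set_pmf g2)" by (rule compat_finite_lift_step[OF 2 c1])
  have fin3: "finite (set_pmf g3)" by (rule compat_finite_rtranclp[OF 3 fin2 c2])
  let ?h = "bind_pmf \<kappa> (\<lambda>k. map_pmf (\<lambda>M. comp M k) (if calive k then g3 else g2))"
  have "(lift_step Tau)\<^sup>*\<^sup>* (map_pmf (\<lambda>M. comp M k) (return_pmf N)) (map_pmf (\<lambda>M. comp M k) g1)"
    by (rule lift_step_rtranclp_comp[OF 1 k]) (use c(2) in auto)
  then have s1: "(lift_step Tau)\<^sup>*\<^sup>* (return_pmf (comp N k)) (map_pmf (\<lambda>M. comp M k) g1)" by simp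
  have s2: "lift_step \<beta> (map_pmf (\<lambda>M. comp M k) g1) (cprod comp g2 \<kappa>)"
  proof (rule lift_step_sync[OF 2 \<alpha>])
    fix N' \<delta>' assume N': "N' \<in> set_pmf g1" "cps_trans N' \<alpha> \<delta>'"
    have "(\<nexists>\<gamma>. cps_trans M Tau \<gamma>) \<longrightarrow> (N', M) \<in> R"
    proof
      assume stuck: "\<nexists>\<gamma>. cps_trans M Tau \<gamma>"
      \<comment> \<open>Being related to \<open>M\<close>, which has no \<tau>-move, is an invariant
        of the leading \<tau>-moves.\<close>
      show "(N', M) \<in> R"
        by (rule lift_step_rtranclp_invariant[OF 1 _ _ N'(1), where I = "\<lambda>N'. (N', M) \<in> R"])
          (use weak_prob_bisimD(3)[OF R MN] bisim_stuck[OF R _ stuck] in auto)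
    qed
    with sync[OF c1[OF N'(1)] _ N'(2)] show "hat_trans \<beta> (comp N' k) (cprod comp \<delta>' \<kappa>)"
      by (simp add: hat_trans_def)
  qed
  \<comment> \<open>The trailing \<tau>-moves are run beside the live outcomes of
    \<open>\<kappa>\<close> only; beside the others the answer stops at \<open>g2\<close>.\<close>
  have s3: "(lift_step Tau)\<^sup>*\<^sup>* (cprod comp g2 \<kappa>) ?h"
    by (rule cprod_rtranclp[OF 3 \<kappa>(1) fin2 fin3]) (use c2 \<kappa>(2) in blast)
  have "weak_step \<beta> (return_pmf (comp N k)) ?h"
    using s1 s2 s3 unfolding weak_step_def
    by (auto intro: rtranclp_trans[OF rtranclp.rtrancl_into_rtrancl])
  moreover have "rel_pmf (\<lambda>A B. (A, B) \<in> closure R) (cprod comp \<delta> \<kappa>) ?h"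
    by (rule rel_pmf_cprod[OF rel]) (use c compat_trans[OF c(1) \<delta>] c2 c3 \<kappa>(2) in blast)+
  ultimately show ?thesis by blast
qed

text \<open>Supplies the negative premise for a tick of \<open>N\<close> beside \<open>k\<close>. A
  \<tau>-move of \<open>N\<close> alone contradicts its tick, one of \<open>k\<close> alone would
  also occur beside the live \<open>M\<close>, and a communication of \<open>N\<close> is offered by
  \<open>M\<close> in a single step because \<open>M\<close> has no \<tau>-move.\<close>

lemma no_tau_tick:
  assumes R: "weak_prob_bisim R" and NM: "(N, M) \<in> R" and c: "compat M k" "compat N k"
    and "alive M" and k: "calive k"
    and stuck: "\<nexists>\<gamma>. cps_trans (comp M k) Tau \<gamma>" and tick: "cps_trans N Tick \<delta>"
  shows "\<nexists>\<gamma>. cps_trans (comp N k) Tau \<gamma>"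
proof
  assume "\<exists>\<gamma>. cps_trans (comp N k) Tau \<gamma>"
  then obtain \<gamma> where \<gamma>: "cps_trans (comp N k) Tau \<gamma>" ..
  have N: "alive N" using tick not_alive_trans by blast
  have M_stuck: "\<nexists>\<gamma>. cps_trans M Tau \<gamma>" using stuck trans_left[OF c(1) k] allowed_Tau by blast
  from trans_cases[OF c(2) N k \<gamma>] consider
      (left) \<delta>' where "cps_trans N Tau \<delta>'"
    | (right) \<kappa> where "kstep k Tau \<kappa>"
    | (com) \<beta> \<beta>' \<delta>' \<kappa> where "co \<beta> \<beta>'" "cps_trans N \<beta> \<delta>'" "kstep k \<beta>' \<kappa>"
    by blast
  then show False
  proof cases
    case left
    with tick_no_tau[OF tick] show ?thesis by blast
  next
    case right
    with trans_right[OF c(1) assms(5) k] stuck show ?thesis by blast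
  next
    case com
    with weak_prob_bisimD(4)[OF R NM com(2)] weak_step_stuck[OF _ M_stuck] obtain \<delta>'' where
      "cps_trans M \<beta> \<delta>''" using co_not_Tau by blast
    from trans_com[OF c(1) k this com(3,1)] stuck show ?thesis by blast
  qed
qed

theorem closure_bisim:
  assumes R: "weak_prob_bisim R"
  shows "weak_prob_bisim (closure R)"
  unfolding weak_prob_bisim_iff
proof (intro conjI allI impI)
  show "closure R \<subseteq> {M. wf_cps M} \<times> {M. wf_cps M}" by (auto simp: closure_def wf_comp)
  show "sym (closure R)" using weak_prob_bisimD(3)[OF R] by (auto simp: closure_def sym_def)
next
  fix A B \<alpha> \<gamma> assume AB: "(A, B) \<in> closure R" and \<gamma>: "cps_trans A \<alpha> \<gamma>"
  show "\<exists>\<gamma>'. weak_step \<alpha> (return_pmf B) \<gamma>' \<and> rel_pmf (\<lambda>M N. (M, N) \<in> closure R) \<gamma> \<gamma>'"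
  proof (cases "alive A \<and> (\<exists>M N k. A = comp M k \<and> B = comp N k \<and> (M, N) \<in> R \<and> compat M k \<and> compat N k)")
    case True
    then obtain M N k where AB: "A = comp M k" "B = comp N k" and MN: "(M, N) \<in> R"
      and c: "compat M k" "compat N k" and alive: "alive M" "calive k"
      using alive_comp by blast
    \<comment> \<open>This lets \<open>k\<close> move on its own beside \<open>N\<close> as well: a
      system outside its invariant would block it.\<close>
    have N: "alive N" using bisim_alive[OF R MN alive(1)] .
    from trans_cases[OF c(1) alive \<gamma>[unfolded AB]] consider
        (left) \<delta> where "cps_trans M \<alpha> \<delta>" "\<alpha> \<noteq> Tick" "allowed k \<alpha>" "\<gamma> = map_pmf (\<lambda>M'. comp M' k) \<delta>"
      | (right) \<kappa> where "kstep k \<alpha> \<kappa>" "\<gamma> = map_pmf (comp M) \<kappa>"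
      | (com) \<beta> \<beta>' \<delta> \<kappa> where "\<alpha> = Tau" "co \<beta> \<beta>'" "cps_trans M \<beta> \<delta>" "kstep k \<beta>' \<kappa>" "\<gamma> = cprod comp \<delta> \<kappa>"
      | (tick) \<delta> \<kappa> where "\<alpha> = Tick" "cps_trans M Tick \<delta>" "ktick k \<kappa>" "\<gamma> = cprod comp \<delta> \<kappa>"
      by blast
    then show ?thesis
    proof cases
      case left
      from weak_prob_bisimD(4)[OF R MN left(1)] obtain g where
        g: "weak_step \<alpha> (return_pmf N) g" "rel_pmf (\<lambda>M N. (M, N) \<in> R) \<delta> g" by blast
      note w = weak_step_comp[OF g(1) alive(2) c(2) left(2,3)]
      from w(1) rel_pmf_comp[OF g(2) compat_trans[OF c(1) left(1)] w(2)] show ?thesis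
        unfolding AB left(4) by blast
    next
      case right
      have s: "lift_step \<alpha> (return_pmf (comp N k)) (map_pmf (comp N) \<kappa>)"
        using trans_right[OF c(2) N alive(2) right(1)] by (intro lift_step_return) (simp add: hat_trans_def)
      have "weak_step \<alpha> (return_pmf (comp N k)) (map_pmf (comp N) \<kappa>)"
        using s by (auto simp: weak_step_def intro!: relcomppI)
      moreover have "rel_pmf (\<lambda>M N. (M, N) \<in> closure R) (map_pmf (comp M) \<kappa>) (map_pmf (comp N) \<kappa>)"
        unfolding pmf.rel_map
        by (rule rel_pmf_reflI) (use compat_kstep[OF c(1) right(1)] compat_kstep[OF c(2) right(1)] closure_comp[OF MN] in blast)
      ultimately show ?thesis unfolding AB right(2) by blast
    next
      case com
      show ?thesis unfolding AB com(1,5)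
      proof (rule sim_sync[OF R MN c _ com(3) alive(2)])
        show "finite (set_pmf \<kappa>)" by (rule finite_kstep[OF c(1) com(4)])
      qed (use co_not_Tau[OF com(2)] compat_kstep[OF _ com(4)] trans_com[OF _ alive(2) _ com(4,2)] in auto)
    next
      case tick
      \<comment> \<open>A tick of the whole excludes its \<tau>-moves, and thereby those of
        \<open>M\<close>, as every context lets \<tau> through.\<close>
      have stuck: "\<nexists>\<gamma>. cps_trans (comp M k) Tau \<gamma>" using tick_no_tau \<gamma> AB tick(1) by blast
      have M_stuck: "\<nexists>\<gamma>. cps_trans M Tau \<gamma>" using stuck trans_left[OF c(1) alive(2)] allowed_Tau by blast
      show ?thesis unfolding AB tick(1,4)
      proof (rule sim_sync[OF R MN c _ tick(2) alive(2)])
        show "finite (set_pmf \<kappa>)" by (rule finite_ktick[OF c(1) tick(3)])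
      next
        fix N' \<delta>' assume N': "compat N' k" "(\<nexists>\<gamma>. cps_trans M Tau \<gamma>) \<longrightarrow> (N', M) \<in> R" "cps_trans N' Tick \<delta>'"
        with M_stuck have "(N', M) \<in> R" by blast
        from trans_tick[OF N'(1) alive(2) N'(3) tick(3) no_tau_tick[OF R this c(1) N'(1) alive stuck N'(3)]]
        show "cps_trans (comp N' k) Tick (cprod comp \<delta>' \<kappa>)" .
      qed (use compat_ktick[OF _ tick(3)] in auto)
    qed
  next
    case False
    \<comment> \<open>\<open>A\<close> can only move to \<open>Dead\<close> here, and
      \<open>B\<close> answers by idling, since \<open>(Dead, B)\<close> is in the relation.\<close>
    have "\<not> alive A \<and> \<not> alive B \<and> wf_cps B"
    proof (cases "alive A")
      case True
      with False AB show ?thesis by (auto simp: closure_def)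
    next
      case nA: False
      show ?thesis
        using AB nA bisim_alive[OF R weak_prob_bisimD(3)[OF R]] by (fastforce simp: closure_def alive_comp wf_comp)
    qed
    then have "\<alpha> = Tau" "\<gamma> = return_pmf Dead" "wf_cps B" "\<not> alive B" using not_alive_trans[OF \<gamma>] by auto
    then show ?thesis
      by (intro exI[of _ "return_pmf B"]) (auto simp: weak_step_def closure_def)
  qed
qed

corollary bisimilar_comp:
  assumes "M \<approx>\<^sub>p N" "compat M k" "compat N k"
  shows "comp M k \<approx>\<^sub>p comp N k"
  using assms closure_bisim closure_comp unfolding bisimilar_def by blast

end

section \<open>The three operators\<close>

fun upd :: "('x, 's, 'a) pstate \<Rightarrow> 'a \<Rightarrow> real \<Rightarrow> ('x, 's, 'a) pstate" where
  "upd (\<xi>x, \<xi>s, \<xi>a) b r = (\<xi>x, \<xi>s, \<xi>a(b \<mapsto> r))"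

text \<open>The pairs of system action and target that a process move with the given label produces
  inside the invariant. This merges three transition rules, so that an operator is analysed label by
  label; reading a sensor outside the domain yields the empty set.\<close>

fun run :: "('x, 's, 'a) penv \<Rightarrow> ('x, 's, 'a) pstate \<Rightarrow> ('x, 's, 'a, 'c) plabel \<Rightarrow>
    ('x, 's, 'a, 'c) proc pmf \<Rightarrow> (('x, 's, 'a, 'c) act \<times> ('x, 's, 'a, 'c) cps pmf) set" where
  "run E S (Act \<alpha>) \<pi> = {(\<alpha>, map_pmf (Sys E S) \<pi>)}"
| "run E S (Rd s z) \<pi> =
     (\<lambda>r. (Tau, map_pmf (\<lambda>P. Sys E S (subst (Real r) z P)) \<pi>)) ` set_option (fst (snd S) s)"
| "run E S (Wr b v) \<pi> = {(Tau, map_pmf (Sys E (upd S b (to_real v))) \<pi>)}"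

lemma sys_pmf_return: "sys_pmf E (return_pmf S) \<pi> = map_pmf (Sys E S) \<pi>"
  by (simp add: sys_pmf_def pair_return_pmf1 pmf.map_comp o_def)

lemma cstep_run:
  assumes "in_inv S E"
  shows "cstep (Sys E S P) \<alpha> \<gamma> \<longleftrightarrow> (\<exists>l \<pi>. pstep P l \<pi> \<and> (\<alpha>, \<gamma>) \<in> run E S l \<pi>)"
proof
  assume "cstep (Sys E S P) \<alpha> \<gamma>"
  then show "\<exists>l \<pi>. pstep P l \<pi> \<and> (\<alpha>, \<gamma>) \<in> run E S l \<pi>"
  proof cases
    case (Proc \<pi>)
    then show ?thesis by (intro exI[of _ "Act \<alpha>"]) (auto simp: sys_pmf_return)
  next
    case (Sensor s z \<pi> \<xi>x \<xi>s \<xi>a r)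
    then show ?thesis by (intro exI[of _ "Rd s z"]) (auto simp: sys_pmf_return pmf.map_comp o_def)
  next
    case (Actuator a v \<pi> \<xi>x \<xi>s \<xi>a)
    then show ?thesis by (intro exI[of _ "Wr a v"]) (auto simp: sys_pmf_return)
  qed (use assms in simp)
next
  assume "\<exists>l \<pi>. pstep P l \<pi> \<and> (\<alpha>, \<gamma>) \<in> run E S l \<pi>"
  then obtain l \<pi> where l: "pstep P l \<pi>" "(\<alpha>, \<gamma>) \<in> run E S l \<pi>" by blast
  obtain \<xi>x \<xi>s \<xi>a where S: "S = (\<xi>x, \<xi>s, \<xi>a)" by (cases S)
  show "cstep (Sys E S P) \<alpha> \<gamma>"
  proof (cases l)
    case (Act \<alpha>')
    with l assms cstep.Proc[of P \<alpha> \<pi> S E] show ?thesis by (auto simp: sys_pmf_return)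
  next
    case (Rd s z)
    with l obtain r where "\<xi>s s = Some r" "\<alpha> = Tau"
      "\<gamma> = map_pmf (\<lambda>P. Sys E S (subst (Real r) z P)) \<pi>"
      by (auto simp: S)
    with cstep.Sensor[of P s z \<pi> \<xi>x \<xi>s \<xi>a E r] l(1) assms Rd show ?thesis
      by (auto simp: S sys_pmf_return pmf.map_comp o_def)
  next
    case (Wr a v)
    with l assms cstep.Actuator[of P a v \<pi> \<xi>x \<xi>s \<xi>a E] show ?thesis by (auto simp: S sys_pmf_return)
  qed
qed

lemma run_not_tick: "pstep P l \<pi> \<Longrightarrow> (\<alpha>, \<gamma>) \<in> run E S l \<pi> \<Longrightarrow> \<alpha> \<noteq> Tick"
  using pstep_not_tick by (cases l) auto

lemma cps_trans_instant:
  assumes "in_inv S E" "\<alpha> \<noteq> Tick"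
  shows "cps_trans (Sys E S P) \<alpha> \<gamma> \<longleftrightarrow> (\<exists>l \<pi>. pstep P l \<pi> \<and> (\<alpha>, \<gamma>) \<in> run E S l \<pi>)"
  unfolding cstep_run[OF assms(1), symmetric] using assms(2) by (subst cps_trans.simps) auto

text \<open>Physical labels produce only \<tau>, so a communication of the system stems from the
  same communication of the process.\<close>

lemma cps_trans_visible:
  assumes "\<alpha> \<noteq> Tau" "\<alpha> \<noteq> Tick"
  shows "cps_trans (Sys E S P) \<alpha> \<gamma> \<longleftrightarrow> in_inv S E \<and> (\<exists>\<pi>. pstep P (Act \<alpha>) \<pi> \<and> \<gamma> = map_pmf (Sys E S) \<pi>)"
proof (cases "in_inv S E")
  case True
  have "(\<alpha>, \<gamma>) \<in> run E S l \<pi> \<longleftrightarrow> l = Act \<alpha> \<and> \<gamma> = map_pmf (Sys E S) \<pi>" for l \<pi>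
    using assms(1) by (cases l) auto
  with True cps_trans_instant[OF True assms(2)] show ?thesis by simp
next
  case False
  with not_alive_trans[of "Sys E S P" \<alpha> \<gamma>] assms show ?thesis by auto
qed

lemma cps_trans_tick:
  "cps_trans (Sys E S P) Tick \<gamma> \<longleftrightarrow> in_inv S E \<and> (\<nexists>\<delta>. cps_trans (Sys E S P) Tau \<delta>) \<and>
     (\<exists>\<pi>. ptick P \<pi> \<and> \<gamma> = sys_pmf E (next_env E S) \<pi>)"
proof (cases "in_inv S E")
  case True
  have *: "cps_trans (Sys E S P) Tau \<delta> \<longleftrightarrow> cstep (Sys E S P) Tau \<delta>" for \<delta>
    by (subst cps_trans.simps) auto
  have "\<not> cstep (Sys E S P) Tick \<gamma>"
    unfolding cstep_run[OF True] by (blast dest: run_not_tick)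
  then have "cps_trans (Sys E S P) Tick \<gamma> \<longleftrightarrow> (\<nexists>\<delta>. cstep (Sys E S P) Tau \<delta>) \<and>
     (\<exists>\<pi>. ptick P \<pi> \<and> \<gamma> = sys_pmf E (next_env E S) \<pi>)"
    using True by (subst cps_trans.simps) auto
  with True show ?thesis by (simp add: *)
next
  case False
  with not_alive_trans[of "Sys E S P" Tick \<gamma>] show ?thesis by auto
qed

text \<open>The side conditions list how a wrapping could interfere with a physical label: the
  substituted value could reach the added process, a sensor could read differently, or an update
  could fail to commute with the embedding of states.\<close>

lemma run_map:
  assumes emb: "\<And>S P. emb (Sys E S P) = Sys E' (u S) (F P)"
    and "\<And>s z v Q. l = Rd s z \<Longrightarrow> F (subst v z Q) = subst v z (F Q)"
    and "\<And>s z. l = Rd s z \<Longrightarrow> fst (snd (u S)) s = fst (snd S) s"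
    and "\<And>b v r. l = Wr b v \<Longrightarrow> u (upd S b r) = upd (u S) b r"
  shows "run E' (u S) l (map_pmf F \<pi>) = (\<lambda>(\<alpha>, \<gamma>). (\<alpha>, map_pmf emb \<gamma>)) ` run E S l \<pi>"
  using assms by (cases l) (auto simp: pmf.map_comp o_def image_image)

lemma par_pmf_return:
  "par_pmf \<pi> (return_pmf Q) = map_pmf (\<lambda>P. PPar P Q) \<pi>"
  "par_pmf (return_pmf P) \<pi> = map_pmf (PPar P) \<pi>"
  by (simp_all add: par_pmf_def pair_return_pmf1 pair_return_pmf2 pmf.map_comp o_def)

lemma par_pmf_bind: "par_pmf \<pi>\<^sub>1 \<pi>\<^sub>2 = cprod PPar \<pi>\<^sub>1 \<pi>\<^sub>2"
  unfolding par_pmf_def pair_pmf_def cprod_def map_bind_pmf map_pmf_def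
  by (subst bind_commute_pmf) (simp add: bind_assoc_pmf bind_return_pmf)

lemma sys_pmf_bind: "sys_pmf E \<sigma> \<pi> = bind_pmf \<pi> (\<lambda>P. map_pmf (\<lambda>S. Sys E S P) \<sigma>)"
  unfolding sys_pmf_def pair_pmf_def map_bind_pmf map_pmf_def
  by (subst bind_commute_pmf) (simp add: bind_assoc_pmf bind_return_pmf)

lemma pstep_PPar_iff: "pstep (PPar P Q) l \<rho> \<longleftrightarrow>
    (\<exists>\<pi>. pstep P l \<pi> \<and> \<rho> = map_pmf (\<lambda>P'. PPar P' Q) \<pi>) \<or>
    (\<exists>\<pi>. pstep Q l \<pi> \<and> \<rho> = map_pmf (PPar P) \<pi>) \<or>
    (\<exists>\<beta> \<beta>' \<pi>\<^sub>1 \<pi>\<^sub>2. l = Act Tau \<and> co \<beta> \<beta>' \<and> pstep P (Act \<beta>) \<pi>\<^sub>1 \<and> pstep Q (Act \<beta>') \<pi>\<^sub>2 \<and>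
      \<rho> = par_pmf \<pi>\<^sub>1 \<pi>\<^sub>2)"
  (is "_ \<longleftrightarrow> ?R")
proof
  assume "pstep (PPar P Q) l \<rho>"
  then show ?R
  proof cases
    case (ComL c v \<pi>\<^sub>1 \<pi>\<^sub>2)
    moreover have "co (Snd c v) (Rcv c v)" by simp
    ultimately show ?thesis by blast
  next
    case (ComR c v \<pi>\<^sub>1 \<pi>\<^sub>2)
    moreover have "co (Rcv c v) (Snd c v)" by simp
    ultimately show ?thesis by blast
  qed (auto simp: par_pmf_return)
next
  have com: "pstep (PPar P Q) (Act Tau) (par_pmf \<pi>\<^sub>1 \<pi>\<^sub>2)"
    if "co \<beta> \<beta>'" "pstep P (Act \<beta>) \<pi>\<^sub>1" "pstep Q (Act \<beta>') \<pi>\<^sub>2" for \<beta> \<beta>' \<pi>\<^sub>1 \<pi>\<^sub>2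
    using that by (cases "(\<beta>, \<beta>')" rule: co.cases) (auto intro: ComL ComR)
  assume ?R
  then show "pstep (PPar P Q) l \<rho>"
    using ParL[of P l _ Q] ParR[of Q l _ P] com by (auto simp: par_pmf_return)
qed

lemma pstep_PRes_iff: "pstep (PRes P c) l \<rho> \<longleftrightarrow>
    (\<exists>\<pi>. pstep P l \<pi> \<and> (\<forall>v. l \<noteq> Act (Snd c v) \<and> l \<noteq> Act (Rcv c v)) \<and> \<rho> = map_pmf (\<lambda>P'. PRes P' c) \<pi>)"
  by (subst pstep.simps) auto

lemma ptick_PPar_iff: "ptick (PPar P Q) \<rho> \<longleftrightarrow>
    (\<exists>\<pi>\<^sub>1 \<pi>\<^sub>2. ptick P \<pi>\<^sub>1 \<and> ptick Q \<pi>\<^sub>2 \<and> (\<nexists>\<pi>. pstep (PPar P Q) (Act Tau) \<pi>) \<and> \<rho> = par_pmf \<pi>\<^sub>1 \<pi>\<^sub>2)"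
  by (subst ptick.simps) auto

lemma ptick_PRes_iff: "ptick (PRes P c) \<rho> \<longleftrightarrow> (\<exists>\<pi>. ptick P \<pi> \<and> \<rho> = map_pmf (\<lambda>P'. PRes P' c) \<pi>)"
  by (subst ptick.simps) auto

lemma cps_trans_imp_alive: "cps_trans M \<alpha> \<gamma> \<Longrightarrow> \<alpha> \<noteq> Tau \<Longrightarrow> alive M"
  using not_alive_trans by blast

lemma cps_trans_not_alive:
  "\<not> alive M \<Longrightarrow> M \<noteq> Dead \<Longrightarrow> cps_trans M \<alpha> \<gamma> \<longleftrightarrow> \<alpha> = Tau \<and> \<gamma> = return_pmf Dead"
  by (cases M) (auto dest: not_alive_trans intro: cps_trans.Instant cstep.Deadlock)

subsection \<open>Restriction\<close>

lemma run_PRes: "run E S l (map_pmf (\<lambda>P'. PRes P' c) \<pi>) = (\<lambda>(\<alpha>, \<gamma>). (\<alpha>, map_pmf (\<lambda>M. M \<setminus> c) \<gamma>)) ` run E S l \<pi>"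
  using run_map[of "\<lambda>M. M \<setminus> c" E E "\<lambda>S. S" "\<lambda>P. PRes P c" l S \<pi>] by simp

lemma wf_cps_PRes: "wf_cps M \<Longrightarrow> wf_cps (M \<setminus> c)"
  by (cases M) (auto simp: wf_cps_Sys_iff wf_proc_def simp del: wf_cps.simps)

text \<open>A restriction never moves on its own, hence \<open>False\<close> for its steps; it lets
  time pass unchanged, hence the Dirac distribution for its tick.\<close>

interpretation res: cps_context "res_cps :: ('x, 's, 'a, 'c) cps \<Rightarrow> 'c \<Rightarrow> ('x, 's, 'a, 'c) cps" "\<lambda>M c. wf_cps M" "\<lambda>c. True"
  "\<lambda>c \<alpha>. \<forall>v. \<alpha> \<noteq> Snd c v \<and> \<alpha> \<noteq> Rcv c v" "\<lambda>c \<alpha> \<kappa>. False" "\<lambda>c \<kappa>. \<kappa> = return_pmf c"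
proof
  fix M :: "('x, 's, 'a, 'c) cps" and c :: 'c
  have alive: "alive (M \<setminus> c) \<longleftrightarrow> alive M" by (cases M) auto
  have instant: "cps_trans (M \<setminus> c) \<alpha> \<gamma> \<longleftrightarrow> (\<exists>\<delta>. cps_trans M \<alpha> \<delta> \<and>
    (\<forall>v. \<alpha> \<noteq> Snd c v \<and> \<alpha> \<noteq> Rcv c v) \<and> \<gamma> = map_pmf (\<lambda>M. M \<setminus> c) \<delta>)" if "\<alpha> \<noteq> Tick" for \<alpha> \<gamma>
  proof (cases M)
    case (Sys E S P)
    show ?thesis
    proof (cases "in_inv S E")
      case True
      \<comment> \<open>Reads and writes become \<tau> and are never blocked, so blocking can be
        tested on the system action instead of the process label.\<close>
      have ok: "(\<forall>v. l \<noteq> Act (Snd c v) \<and> l \<noteq> Act (Rcv c v)) \<longleftrightarrow> (\<forall>v. \<alpha> \<noteq> Snd c v \<and> \<alpha> \<noteq> Rcv c v)"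
        if "(\<alpha>, \<delta>) \<in> run E S l \<pi>" for l \<delta> \<pi>
        using that by (cases l) auto
      have img: "(\<alpha>, \<gamma>) \<in> run E S l (map_pmf (\<lambda>P'. PRes P' c) \<pi>) \<longleftrightarrow>
          (\<exists>\<delta>. (\<alpha>, \<delta>) \<in> run E S l \<pi> \<and> \<gamma> = map_pmf (\<lambda>M. M \<setminus> c) \<delta>)" for l \<pi>
        unfolding run_PRes by auto
      have "cps_trans (M \<setminus> c) \<alpha> \<gamma> \<longleftrightarrow> (\<exists>l \<pi>. pstep P l \<pi> \<and>
          (\<forall>v. l \<noteq> Act (Snd c v) \<and> l \<noteq> Act (Rcv c v)) \<and> (\<alpha>, \<gamma>) \<in> run E S l (map_pmf (\<lambda>P'. PRes P' c) \<pi>))"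
        unfolding Sys res_cps.simps cps_trans_instant[OF True \<open>\<alpha> \<noteq> Tick\<close>] pstep_PRes_iff by blast
      also have "\<dots> \<longleftrightarrow> (\<exists>l \<pi> \<delta>. pstep P l \<pi> \<and> (\<alpha>, \<delta>) \<in> run E S l \<pi> \<and>
          (\<forall>v. \<alpha> \<noteq> Snd c v \<and> \<alpha> \<noteq> Rcv c v) \<and> \<gamma> = map_pmf (\<lambda>M. M \<setminus> c) \<delta>)"
        unfolding img using ok by metis
      also have "\<dots> \<longleftrightarrow> (\<exists>\<delta>. cps_trans M \<alpha> \<delta> \<and>
          (\<forall>v. \<alpha> \<noteq> Snd c v \<and> \<alpha> \<noteq> Rcv c v) \<and> \<gamma> = map_pmf (\<lambda>M. M \<setminus> c) \<delta>)"
        unfolding Sys cps_trans_instant[OF True \<open>\<alpha> \<noteq> Tick\<close>] by blast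
      finally show ?thesis .
    next
      case False
      then show ?thesis unfolding Sys by (subst (1 2) cps_trans_not_alive) auto
    qed
  qed simp
  have tick: "cps_trans (M \<setminus> c) Tick \<gamma> \<longleftrightarrow> (\<exists>\<delta>. cps_trans M Tick \<delta> \<and> \<gamma> = map_pmf (\<lambda>M. M \<setminus> c) \<delta>)" for \<gamma>
  proof (cases M)
    case (Sys E S P)
    have "map_pmf (\<lambda>M. M \<setminus> c) (sys_pmf E \<sigma> \<pi>) = sys_pmf E \<sigma> (map_pmf (\<lambda>P. PRes P c) \<pi>)" for \<sigma> \<pi>
      by (simp add: sys_pmf_bind map_bind_pmf bind_map_pmf pmf.map_comp o_def)
    \<comment> \<open>\<tau> passes every restriction, so the negative premise of the tick rule is
      the same on both sides.\<close>
    moreover have "(\<exists>\<delta>. cps_trans (Sys E S P \<setminus> c) Tau \<delta>) \<longleftrightarrow> (\<exists>\<delta>. cps_trans (Sys E S P) Tau \<delta>)"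
      using instant[of Tau] Sys by simp
    ultimately show ?thesis
      unfolding Sys cps_trans_tick[of E S P] unfolding res_cps.simps cps_trans_tick
      by (auto simp: ptick_PRes_iff)
  qed simp
  show "wf_cps (M \<setminus> c)" if "wf_cps M"
    using that by (rule wf_cps_PRes)
  show "alive (M \<setminus> c) \<longleftrightarrow> alive M \<and> True"
    by (simp add: alive)
  show "wf_cps M'" if "wf_cps M" "cps_trans M \<alpha> \<delta>" "M' \<in> set_pmf \<delta>" for M' \<alpha> \<delta>
    using cps_trans_wf(2)[OF that(2,1,3)] .
  show "cps_trans (M \<setminus> c) \<alpha> (map_pmf (\<lambda>M. M \<setminus> c) \<gamma>)"
    if "cps_trans M \<alpha> \<gamma>" "\<alpha> \<noteq> Tick" "\<forall>v. \<alpha> \<noteq> Snd c v \<and> \<alpha> \<noteq> Rcv c v" for \<alpha> \<gamma>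
    using that instant by blast
  show "cps_trans (M \<setminus> c) Tick (cprod res_cps \<delta> \<kappa>)" if "cps_trans M Tick \<delta>" "\<kappa> = return_pmf c" for \<delta> \<kappa>
    using that tick by (auto simp: cprod_def bind_return_pmf)
  show "(\<exists>\<delta>. cps_trans M \<alpha> \<delta> \<and> \<alpha> \<noteq> Tick \<and> (\<forall>v. \<alpha> \<noteq> Snd c v \<and> \<alpha> \<noteq> Rcv c v) \<and> \<gamma> = map_pmf (\<lambda>M'. M' \<setminus> c) \<delta>) \<or>
      (\<exists>\<kappa>. False \<and> \<gamma> = map_pmf (res_cps M) \<kappa>) \<or>
      (\<exists>\<beta> \<beta>' \<delta> \<kappa>. \<alpha> = Tau \<and> co \<beta> \<beta>' \<and> cps_trans M \<beta> \<delta> \<and> False \<and> \<gamma> = cprod res_cps \<delta> \<kappa>) \<or>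
      (\<exists>\<delta> \<kappa>. \<alpha> = Tick \<and> cps_trans M Tick \<delta> \<and> \<kappa> = return_pmf c \<and> \<gamma> = cprod res_cps \<delta> \<kappa>)"
    if "cps_trans (M \<setminus> c) \<alpha> \<gamma>" for \<alpha> \<gamma>
    using that instant[of \<alpha>] tick by (cases "\<alpha> = Tick") (auto simp: cprod_def bind_return_pmf)
qed auto

subsection \<open>Parallel composition with a process\<close>

text \<open>The left component may live in another system \<open>Sys E\<^sub>1 S\<^sub>1 P\<close>:
  the same environment and state give composition with a process, a part of them gives physical
  union. The right component is left in terms of \<open>run\<close>, being a bare process in the one
  case and a system in the other.\<close>

lemma cps_trans_PPar:
  assumes inv: "in_inv S E" and "\<alpha> \<noteq> Tick"
    and left: "\<And>l \<pi>. pstep P l \<pi> \<Longrightarrow>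
      run E S l (map_pmf (\<lambda>P'. PPar P' Q) \<pi>) = (\<lambda>(\<alpha>, \<gamma>). (\<alpha>, map_pmf f \<gamma>)) ` run E\<^sub>1 S\<^sub>1 l \<pi>"
    and inv1: "in_inv S\<^sub>1 E\<^sub>1"
  shows "cps_trans (Sys E S (PPar P Q)) \<alpha> \<gamma> \<longleftrightarrow>
    (\<exists>\<delta>. cps_trans (Sys E\<^sub>1 S\<^sub>1 P) \<alpha> \<delta> \<and> \<gamma> = map_pmf f \<delta>) \<or>
    (\<exists>l \<pi>. pstep Q l \<pi> \<and> (\<alpha>, \<gamma>) \<in> run E S l (map_pmf (PPar P) \<pi>)) \<or>
    (\<alpha> = Tau \<and> (\<exists>\<beta> \<beta>' \<pi>\<^sub>1 \<pi>\<^sub>2. co \<beta> \<beta>' \<and> pstep P (Act \<beta>) \<pi>\<^sub>1 \<and> pstep Q (Act \<beta>') \<pi>\<^sub>2 \<and>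
      \<gamma> = map_pmf (Sys E S) (par_pmf \<pi>\<^sub>1 \<pi>\<^sub>2)))"
proof -
  have img: "(\<alpha>, \<gamma>) \<in> run E S l (map_pmf (\<lambda>P'. PPar P' Q) \<pi>) \<longleftrightarrow>
      (\<exists>\<delta>. (\<alpha>, \<delta>) \<in> run E\<^sub>1 S\<^sub>1 l \<pi> \<and> \<gamma> = map_pmf f \<delta>)" if "pstep P l \<pi>" for l \<pi>
    unfolding left[OF that] by auto
  have "(\<exists>l \<pi>. pstep P l \<pi> \<and> (\<alpha>, \<gamma>) \<in> run E S l (map_pmf (\<lambda>P'. PPar P' Q) \<pi>)) \<longleftrightarrow>
    (\<exists>l \<pi>. pstep P l \<pi> \<and> (\<exists>\<delta>. (\<alpha>, \<delta>) \<in> run E\<^sub>1 S\<^sub>1 l \<pi> \<and> \<gamma> = map_pmf f \<delta>))"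
    by (intro ex_cong1 conj_cong refl img)
  also have "\<dots> \<longleftrightarrow> (\<exists>\<delta>. cps_trans (Sys E\<^sub>1 S\<^sub>1 P) \<alpha> \<delta> \<and> \<gamma> = map_pmf f \<delta>)"
    unfolding cps_trans_instant[OF inv1 assms(2)] by blast
  finally have left': "(\<exists>l \<pi>. pstep P l \<pi> \<and> (\<alpha>, \<gamma>) \<in> run E S l (map_pmf (\<lambda>P'. PPar P' Q) \<pi>)) \<longleftrightarrow>
    (\<exists>\<delta>. cps_trans (Sys E\<^sub>1 S\<^sub>1 P) \<alpha> \<delta> \<and> \<gamma> = map_pmf f \<delta>)" .
  have "cps_trans (Sys E S (PPar P Q)) \<alpha> \<gamma> \<longleftrightarrow>
    (\<exists>l \<pi>. pstep P l \<pi> \<and> (\<alpha>, \<gamma>) \<in> run E S l (map_pmf (\<lambda>P'. PPar P' Q) \<pi>)) \<or>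
    (\<exists>l \<pi>. pstep Q l \<pi> \<and> (\<alpha>, \<gamma>) \<in> run E S l (map_pmf (PPar P) \<pi>)) \<or>
    (\<exists>\<beta> \<beta>' \<pi>\<^sub>1 \<pi>\<^sub>2. co \<beta> \<beta>' \<and> pstep P (Act \<beta>) \<pi>\<^sub>1 \<and> pstep Q (Act \<beta>') \<pi>\<^sub>2 \<and>
      (\<alpha>, \<gamma>) \<in> run E S (Act Tau) (par_pmf \<pi>\<^sub>1 \<pi>\<^sub>2))"
    unfolding cps_trans_instant[OF inv assms(2)] pstep_PPar_iff by blast
  also have "\<dots> \<longleftrightarrow> (\<exists>\<delta>. cps_trans (Sys E\<^sub>1 S\<^sub>1 P) \<alpha> \<delta> \<and> \<gamma> = map_pmf f \<delta>) \<or>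
    (\<exists>l \<pi>. pstep Q l \<pi> \<and> (\<alpha>, \<gamma>) \<in> run E S l (map_pmf (PPar P) \<pi>)) \<or>
    (\<alpha> = Tau \<and> (\<exists>\<beta> \<beta>' \<pi>\<^sub>1 \<pi>\<^sub>2. co \<beta> \<beta>' \<and> pstep P (Act \<beta>) \<pi>\<^sub>1 \<and> pstep Q (Act \<beta>') \<pi>\<^sub>2 \<and>
      \<gamma> = map_pmf (Sys E S) (par_pmf \<pi>\<^sub>1 \<pi>\<^sub>2)))"
    unfolding left' run.simps singleton_iff prod.inject by blast
  finally show ?thesis .
qed

text \<open>Inside the invariant a \<tau>-move of the composed process is one of the system, so the
  negative premise for processes follows from that for systems.\<close>

lemma cps_trans_PPar_tick:
  assumes "in_inv S E"
  shows "cps_trans (Sys E S (PPar P Q)) Tick \<gamma> \<longleftrightarrow> (\<nexists>\<delta>. cps_trans (Sys E S (PPar P Q)) Tau \<delta>) \<and>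
    (\<exists>\<pi>\<^sub>1 \<pi>\<^sub>2. ptick P \<pi>\<^sub>1 \<and> ptick Q \<pi>\<^sub>2 \<and> \<gamma> = sys_pmf E (next_env E S) (par_pmf \<pi>\<^sub>1 \<pi>\<^sub>2))"
proof -
  have "\<exists>\<delta>. cps_trans (Sys E S (PPar P Q)) Tau \<delta>" if "pstep (PPar P Q) (Act Tau) \<pi>" for \<pi>
    using assms that by (blast intro: cps_trans.Instant cstep.Proc)
  then show ?thesis using assms unfolding cps_trans_tick ptick_PPar_iff by blast
qed

lemma cprod_par_cps: "cprod par_cps (sys_pmf E \<sigma> \<pi>) \<kappa> = sys_pmf E \<sigma> (par_pmf \<pi> \<kappa>)"
  unfolding cprod_def par_pmf_bind sys_pmf_bind
  by (simp add: bind_assoc_pmf bind_map_pmf map_bind_pmf pmf.map_comp o_def)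

lemma wf_cps_par: "wf_cps M \<Longrightarrow> wf_proc Q \<Longrightarrow> pure_logical Q \<Longrightarrow> wf_cps (M \<parallel> Q)"
  by (cases M) (auto simp: wf_cps_Sys_iff wf_proc_def pure_logical_pdom simp del: wf_cps.simps)

text \<open>A physical label would put its sensor or actuator into the empty set
  \<open>pdom Q\<close>. Moves of \<open>Q\<close> therefore neither read nor change the
  state.\<close>

lemma pure_logical_pstep:
  assumes "wf_proc Q" "pure_logical Q" "pstep Q l \<pi>"
  obtains \<alpha> where "l = Act \<alpha>"
  using pstep_phys_label[OF assms(3)] assms(1,2) by (cases l) (auto simp: wf_proc_def pure_logical_pdom)

lemma par_cps_instant:
  assumes "wf_proc Q" "pure_logical Q" "alive M" "\<alpha> \<noteq> Tick"
  shows "cps_trans (M \<parallel> Q) \<alpha> \<gamma> \<longleftrightarrow>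
    (\<exists>\<delta>. cps_trans M \<alpha> \<delta> \<and> \<gamma> = map_pmf (\<lambda>M'. M' \<parallel> Q) \<delta>) \<or>
    (\<exists>\<kappa>. pstep Q (Act \<alpha>) \<kappa> \<and> \<gamma> = map_pmf (par_cps M) \<kappa>) \<or>
    (\<exists>\<beta> \<beta>' \<delta> \<kappa>. \<alpha> = Tau \<and> co \<beta> \<beta>' \<and> cps_trans M \<beta> \<delta> \<and> pstep Q (Act \<beta>') \<kappa> \<and>
      \<gamma> = cprod par_cps \<delta> \<kappa>)"
proof (cases M)
  case (Sys E S P)
  with assms(3) have inv: "in_inv S E" by simp
  \<comment> \<open>\<open>Q\<close> is closed, so a sensor value read by the left component does
    not enter it.\<close>
  have left: "run E S l (map_pmf (\<lambda>P'. PPar P' Q) \<pi>) =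
      (\<lambda>(\<alpha>, \<gamma>). (\<alpha>, map_pmf (\<lambda>M. M \<parallel> Q) \<gamma>)) ` run E S l \<pi>" for l \<pi>
    by (rule run_map[where u = "\<lambda>S. S"]) (use assms(1) in \<open>auto simp: wf_proc_def subst_fresh\<close>)
  have right: "(\<exists>l \<pi>. pstep Q l \<pi> \<and> (\<alpha>, \<gamma>) \<in> run E S l (map_pmf (PPar P) \<pi>)) \<longleftrightarrow>
      (\<exists>\<kappa>. pstep Q (Act \<alpha>) \<kappa> \<and> \<gamma> = map_pmf (par_cps M) \<kappa>)"
  proof -
    have img: "(\<alpha>, \<gamma>) \<in> run E S l (map_pmf (PPar P) \<pi>) \<longleftrightarrow> l = Act \<alpha> \<and> \<gamma> = map_pmf (par_cps M) \<pi>"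
      if Q: "pstep Q l \<pi>" for l \<pi>
    proof -
      obtain \<alpha>' where "l = Act \<alpha>'" using pure_logical_pstep[OF assms(1,2) Q] .
      moreover have "par_cps M = (\<lambda>Q. Sys E S (PPar P Q))" by (simp add: Sys fun_eq_iff)
      ultimately show ?thesis by (auto simp: pmf.map_comp o_def)
    qed
    have "(\<exists>l \<pi>. pstep Q l \<pi> \<and> (\<alpha>, \<gamma>) \<in> run E S l (map_pmf (PPar P) \<pi>)) \<longleftrightarrow>
        (\<exists>l \<pi>. pstep Q l \<pi> \<and> l = Act \<alpha> \<and> \<gamma> = map_pmf (par_cps M) \<pi>)"
      by (intro ex_cong1 conj_cong refl img)
    then show ?thesis by simp
  qed
  have com: "(\<exists>\<beta> \<beta>' \<pi>\<^sub>1 \<pi>\<^sub>2. co \<beta> \<beta>' \<and> pstep P (Act \<beta>) \<pi>\<^sub>1 \<and> pstep Q (Act \<beta>') \<pi>\<^sub>2 \<and>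
        \<gamma> = map_pmf (Sys E S) (par_pmf \<pi>\<^sub>1 \<pi>\<^sub>2)) \<longleftrightarrow>
      (\<exists>\<beta> \<beta>' \<delta> \<kappa>. co \<beta> \<beta>' \<and> cps_trans M \<beta> \<delta> \<and> pstep Q (Act \<beta>') \<kappa> \<and> \<gamma> = cprod par_cps \<delta> \<kappa>)"
  proof -
    have *: "map_pmf (Sys E S) (par_pmf \<pi>\<^sub>1 \<pi>\<^sub>2) = cprod par_cps (map_pmf (Sys E S) \<pi>\<^sub>1) \<pi>\<^sub>2" for \<pi>\<^sub>1 \<pi>\<^sub>2
      using cprod_par_cps[of E "return_pmf S" \<pi>\<^sub>1 \<pi>\<^sub>2] by (simp add: sys_pmf_return)
    have "cps_trans M \<beta> \<delta> \<longleftrightarrow> (\<exists>\<pi>. pstep P (Act \<beta>) \<pi> \<and> \<delta> = map_pmf (Sys E S) \<pi>)" if "co \<beta> \<beta>'" for \<beta> \<beta>' \<delta>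
      using co_not_Tau[OF that] inv by (simp add: Sys cps_trans_visible)
    with * show ?thesis by metis
  qed
  show ?thesis
    using cps_trans_PPar[OF inv assms(4) left inv] right com unfolding Sys par_cps.simps by blast
qed (use assms in simp)

text \<open>A tick of \<open>M\<close> has a negative premise of its own; it follows from that of
  the composition, as \<tau>-moves of a live \<open>M\<close> persist beside
  \<open>Q\<close>.\<close>

lemma par_cps_tick:
  assumes "wf_proc Q" "pure_logical Q" "alive M"
  shows "cps_trans (M \<parallel> Q) Tick \<gamma> \<longleftrightarrow> (\<nexists>\<delta>. cps_trans (M \<parallel> Q) Tau \<delta>) \<and>
    (\<exists>\<delta> \<kappa>. cps_trans M Tick \<delta> \<and> ptick Q \<kappa> \<and> \<gamma> = cprod par_cps \<delta> \<kappa>)"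
proof (cases M)
  case (Sys E S P)
  with assms(3) have inv: "in_inv S E" by simp
  show ?thesis
  proof (cases "\<exists>\<delta>. cps_trans (M \<parallel> Q) Tau \<delta>")
    case True
    then show ?thesis using cps_trans_PPar_tick[OF inv, of P Q \<gamma>] unfolding Sys par_cps.simps by blast
  next
    case False
    then have "\<nexists>\<delta>. cps_trans M Tau \<delta>"
      using par_cps_instant[OF assms, of Tau] by auto
    then have M: "cps_trans M Tick \<delta> \<longleftrightarrow> (\<exists>\<pi>. ptick P \<pi> \<and> \<delta> = sys_pmf E (next_env E S) \<pi>)" for \<delta>
      using inv by (simp add: Sys cps_trans_tick)
    have "cps_trans (M \<parallel> Q) Tick \<gamma> \<longleftrightarrow> (\<exists>\<pi>\<^sub>1 \<pi>\<^sub>2. ptick P \<pi>\<^sub>1 \<and> ptick Q \<pi>\<^sub>2 \<and>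
        \<gamma> = sys_pmf E (next_env E S) (par_pmf \<pi>\<^sub>1 \<pi>\<^sub>2))"
      using False cps_trans_PPar_tick[OF inv] unfolding Sys par_cps.simps by blast
    also have "\<dots> \<longleftrightarrow> (\<exists>\<delta> \<kappa>. cps_trans M Tick \<delta> \<and> ptick Q \<kappa> \<and> \<gamma> = cprod par_cps \<delta> \<kappa>)"
      unfolding M cprod_par_cps[symmetric] by blast
    finally show ?thesis using False by simp
  qed
qed (use assms in simp)

text \<open>A process has no physical state and so no invariant to leave: every such context is
  live, and it blocks no action of the system.\<close>

interpretation par: cps_context "par_cps :: ('x, 's, 'a, 'c) cps \<Rightarrow> ('x, 's, 'a, 'c) proc \<Rightarrow> ('x, 's, 'a, 'c) cps"
  "\<lambda>M Q. wf_cps M \<and> wf_proc Q \<and> pure_logical Q" "\<lambda>Q. True" "\<lambda>Q \<alpha>. True"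
  "\<lambda>Q \<alpha>. pstep Q (Act \<alpha>)" ptick
proof
  fix M :: "('x, 's, 'a, 'c) cps" and Q :: "('x, 's, 'a, 'c) proc"
  assume c: "wf_cps M \<and> wf_proc Q \<and> pure_logical Q"
  then have Q: "ok_proc Q" "fpv Q = {}" by (auto simp: wf_proc_def)
  show "wf_cps (M \<parallel> Q)" "wf_cps M" using c wf_cps_par by auto
  show "alive (M \<parallel> Q) \<longleftrightarrow> alive M \<and> True" by (cases M) auto
  show "wf_cps M' \<and> wf_proc Q \<and> pure_logical Q" if "cps_trans M \<alpha> \<delta>" "M' \<in> set_pmf \<delta>" for M' \<alpha> \<delta>
    using cps_trans_wf(2)[OF that(1) _ that(2)] c by blast
  show "(wf_cps M \<and> wf_proc Q' \<and> pure_logical Q') \<and> True" if "pstep Q (Act \<alpha>) \<kappa>" "Q' \<in> set_pmf \<kappa>" for \<alpha> \<kappa> Q'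
    using pstep_preserves[OF that(1) Q that(2)] c by (auto simp: wf_proc_def pure_logical_pdom)
  show "wf_cps M \<and> wf_proc Q' \<and> pure_logical Q'" if "ptick Q \<kappa>" "Q' \<in> set_pmf \<kappa>" for \<kappa> Q'
    using ptick_preserves[OF that(1) Q that(2)] c by (auto simp: wf_proc_def pure_logical_pdom)
  show "finite (set_pmf \<kappa>)" if "pstep Q (Act \<alpha>) \<kappa>" for \<alpha> \<kappa>
    using pstep_finite[OF that Q] .
  show "finite (set_pmf \<kappa>)" if "ptick Q \<kappa>" for \<kappa>
    using ptick_finite[OF that Q] .
  show "cps_trans (M \<parallel> Q) \<alpha> (map_pmf (\<lambda>M'. M' \<parallel> Q) \<delta>)" if "cps_trans M \<alpha> \<delta>" "\<alpha> \<noteq> Tick" for \<alpha> \<delta>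
  proof (cases "alive M")
    case True
    with that c show ?thesis by (auto simp: par_cps_instant)
  next
    case False
    \<comment> \<open>Outside its invariant \<open>M\<close> can only fall to \<open>Dead\<close>,
      and the composition does the same.\<close>
    have "M \<noteq> Dead" using that(1) by auto
    then obtain E S P where "M = Sys E S P" by (cases M) auto
    with False show ?thesis
      using not_alive_trans[OF that(1)] by (auto simp: cps_trans_not_alive)
  qed
  {
    fix \<alpha> assume alive: "alive M"
    have not_tick: "\<alpha> \<noteq> Tick" if "pstep Q (Act \<alpha>) \<kappa>" for \<alpha> \<kappa> using pstep_not_tick[OF that] by simp
    show "cps_trans (M \<parallel> Q) \<alpha> (map_pmf (par_cps M) \<kappa>)" if "pstep Q (Act \<alpha>) \<kappa>" for \<kappa>
      using par_cps_instant[OF _ _ alive not_tick[OF that]] c that by blast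
    show "(\<exists>\<delta>. cps_trans M \<alpha> \<delta> \<and> \<alpha> \<noteq> Tick \<and> True \<and> \<gamma> = map_pmf (\<lambda>M'. M' \<parallel> Q) \<delta>) \<or>
      (\<exists>\<kappa>. pstep Q (Act \<alpha>) \<kappa> \<and> \<gamma> = map_pmf (par_cps M) \<kappa>) \<or>
      (\<exists>\<beta> \<beta>' \<delta> \<kappa>. \<alpha> = Tau \<and> co \<beta> \<beta>' \<and> cps_trans M \<beta> \<delta> \<and> pstep Q (Act \<beta>') \<kappa> \<and> \<gamma> = cprod par_cps \<delta> \<kappa>) \<or>
      (\<exists>\<delta> \<kappa>. \<alpha> = Tick \<and> cps_trans M Tick \<delta> \<and> ptick Q \<kappa> \<and> \<gamma> = cprod par_cps \<delta> \<kappa>)"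
      if "cps_trans (M \<parallel> Q) \<alpha> \<gamma>" for \<gamma>
      using par_cps_instant[of Q M \<alpha> \<gamma>] par_cps_tick[of Q M \<gamma>] alive c that by (cases "\<alpha> = Tick") auto
  }
  show "cps_trans (M \<parallel> Q) Tau (cprod par_cps \<delta> \<kappa>)"
    if "cps_trans M \<alpha> \<delta>" "pstep Q (Act \<beta>) \<kappa>" "co \<alpha> \<beta>" for \<alpha> \<beta> \<delta> \<kappa>
    using par_cps_instant[of Q M Tau] cps_trans_imp_alive[OF that(1)] co_not_Tau[OF that(3)] c that by blast
  show "cps_trans (M \<parallel> Q) Tick (cprod par_cps \<delta> \<kappa>)"
    if "cps_trans M Tick \<delta>" "ptick Q \<kappa>" "\<nexists>\<gamma>. cps_trans (M \<parallel> Q) Tau \<gamma>" for \<delta> \<kappa>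
    using par_cps_tick[of Q M] cps_trans_imp_alive[OF that(1)] c that by blast
qed auto

subsection \<open>Physical union\<close>

lemma map_pair_pmf_cprod: "map_pmf (\<lambda>(a, b). f a b) (pair_pmf p q) = cprod f p q"
  unfolding pair_pmf_def cprod_def map_bind_pmf map_pmf_def
  by (subst bind_commute_pmf) (simp add: bind_assoc_pmf bind_return_pmf)

text \<open>\<open>++\<close> prefers its right argument, so a left update stays visible when the
  right state does not own the actuator.\<close>

lemma union_pstate_upd_left:
  "b \<notin> dom (snd (snd T)) \<Longrightarrow> union_pstate (upd S b r) T = upd (union_pstate S T) b r"
  by (cases S; cases T) (auto simp: map_add_upd_left)

lemma union_pstate_upd_right: "union_pstate S (upd T b r) = upd (union_pstate S T) b r"
  by (cases S; cases T) auto

lemma union_Dead_right [simp]: "M \<uplus> Dead = Dead"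
  by (cases M) auto

lemma phys_disjoint_sym: "phys_disjoint M N \<Longrightarrow> phys_disjoint N M"
  by (cases M; cases N) auto

lemma phys_disjoint_trans:
  assumes "phys_disjoint M K" "cps_trans M \<alpha> \<delta>" "wf_cps M" "M' \<in> set_pmf \<delta>"
  shows "phys_disjoint M' K"
proof (cases M)
  case (Sys E S P)
  from cps_trans_preserves[OF assms(2,3)[unfolded Sys]] assms(4)
  have "M' = Dead \<or> (\<exists>S' P'. M' = Sys E S' P')" by blast
  with assms(1) Sys show ?thesis by (cases K) auto
qed (use assms(2) in simp)

lemma in_inv_union:
  assumes "S \<in> pstates E\<^sub>1" "T \<in> pstates E\<^sub>2" "xvars E\<^sub>1 \<inter> xvars E\<^sub>2 = {}"
  shows "in_inv (union_pstate S T) (union_env E\<^sub>1 E\<^sub>2) \<longleftrightarrow> in_inv S E\<^sub>1 \<and> in_inv T E\<^sub>2"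
  using assms by (cases S; cases T) (auto simp: pstates_def invar_union_env)

lemma pstates_union:
  "S \<in> pstates E\<^sub>1 \<Longrightarrow> T \<in> pstates E\<^sub>2 \<Longrightarrow> union_pstate S T \<in> pstates (union_env E\<^sub>1 E\<^sub>2)"
  by (cases S; cases T) (auto simp: pstates_def union_env_def fun_space_def)

lemma fun_space_restrict: "\<xi> \<in> fun_space A \<Longrightarrow> B \<subseteq> A \<Longrightarrow> \<xi> |` B \<in> fun_space B"
  by (auto simp: fun_space_def)

lemma fun_space_add: "f \<in> fun_space A \<Longrightarrow> g \<in> fun_space B \<Longrightarrow> f ++ g \<in> fun_space (A \<union> B)"
  by (auto simp: fun_space_def)

lemma wf_env_union:
  assumes "wf_env E\<^sub>1" "wf_env E\<^sub>2"
  shows "wf_env (union_env E\<^sub>1 E\<^sub>2)"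
proof -
  let ?U = "union_env E\<^sub>1 E\<^sub>2"
  have "finite (set_pmf (evol ?U \<xi>x \<xi>a)) \<and> set_pmf (evol ?U \<xi>x \<xi>a) \<subseteq> fun_space (xvars ?U)"
    if "\<xi>x \<in> fun_space (xvars ?U)" "\<xi>a \<in> fun_space (avars ?U)" for \<xi>x \<xi>a
  proof -
    have "\<xi>x |` xvars E\<^sub>1 \<in> fun_space (xvars E\<^sub>1)" "\<xi>x |` xvars E\<^sub>2 \<in> fun_space (xvars E\<^sub>2)"
      "\<xi>a |` avars E\<^sub>1 \<in> fun_space (avars E\<^sub>1)" "\<xi>a |` avars E\<^sub>2 \<in> fun_space (avars E\<^sub>2)"
      using that by (auto simp: union_env_def intro: fun_space_restrict)
    then have "finite (set_pmf (evol E\<^sub>1 (\<xi>x |` xvars E\<^sub>1) (\<xi>a |` avars E\<^sub>1)))"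
      "set_pmf (evol E\<^sub>1 (\<xi>x |` xvars E\<^sub>1) (\<xi>a |` avars E\<^sub>1)) \<subseteq> fun_space (xvars E\<^sub>1)"
      "finite (set_pmf (evol E\<^sub>2 (\<xi>x |` xvars E\<^sub>2) (\<xi>a |` avars E\<^sub>2)))"
      "set_pmf (evol E\<^sub>2 (\<xi>x |` xvars E\<^sub>2) (\<xi>a |` avars E\<^sub>2)) \<subseteq> fun_space (xvars E\<^sub>2)"
      using assms unfolding wf_env_def by blast+
    then show ?thesis by (auto simp: union_env_def intro!: fun_space_add)
  qed
  moreover have "finite (set_pmf (meas ?U \<xi>x)) \<and> set_pmf (meas ?U \<xi>x) \<subseteq> fun_space (svars ?U)"
    if "\<xi>x \<in> fun_space (xvars ?U)" for \<xi>x
  proof -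
    have "\<xi>x |` xvars E\<^sub>1 \<in> fun_space (xvars E\<^sub>1)" "\<xi>x |` xvars E\<^sub>2 \<in> fun_space (xvars E\<^sub>2)"
      using that by (auto simp: union_env_def intro: fun_space_restrict)
    then have "finite (set_pmf (meas E\<^sub>1 (\<xi>x |` xvars E\<^sub>1)))"
      "set_pmf (meas E\<^sub>1 (\<xi>x |` xvars E\<^sub>1)) \<subseteq> fun_space (svars E\<^sub>1)"
      "finite (set_pmf (meas E\<^sub>2 (\<xi>x |` xvars E\<^sub>2)))"
      "set_pmf (meas E\<^sub>2 (\<xi>x |` xvars E\<^sub>2)) \<subseteq> fun_space (svars E\<^sub>2)"
      using assms unfolding wf_env_def by blast+
    then show ?thesis by (auto simp: union_env_def intro!: fun_space_add)
  qed
  moreover have "invar ?U \<subseteq> fun_space (xvars ?U)" by (auto simp: union_env_def)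
  ultimately show ?thesis unfolding wf_env_def by blast
qed

lemma wf_cps_union:
  assumes "wf_cps M" "wf_cps K" "phys_disjoint M K"
  shows "wf_cps (M \<uplus> K)"
proof (cases "M = Dead \<or> K = Dead")
  case False
  then obtain E\<^sub>1 S\<^sub>1 P\<^sub>1 E\<^sub>2 S\<^sub>2 P\<^sub>2 where "M = Sys E\<^sub>1 S\<^sub>1 P\<^sub>1" "K = Sys E\<^sub>2 S\<^sub>2 P\<^sub>2"
    by (cases M; cases K) auto
  moreover have "svars (union_env E\<^sub>1 E\<^sub>2) <+> avars (union_env E\<^sub>1 E\<^sub>2) =
      (svars E\<^sub>1 <+> avars E\<^sub>1) \<union> (svars E\<^sub>2 <+> avars E\<^sub>2)" by (auto simp: union_env_def)
  ultimately show ?thesis using assms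
    by (auto simp: wf_cps_Sys_iff wf_proc_def wf_env_union pstates_union simp del: wf_cps.simps)
qed auto

text \<open>Each side evolves and measures on its own, so the four draws can be regrouped by
  system.\<close>

lemma next_env_union:
  assumes wf: "wf_env E\<^sub>1" "wf_env E\<^sub>2" and disj: "xvars E\<^sub>1 \<inter> xvars E\<^sub>2 = {}" "avars E\<^sub>1 \<inter> avars E\<^sub>2 = {}"
    and S: "S \<in> pstates E\<^sub>1" and T: "T \<in> pstates E\<^sub>2"
  shows "next_env (union_env E\<^sub>1 E\<^sub>2) (union_pstate S T) =
    cprod union_pstate (next_env E\<^sub>1 S) (next_env E\<^sub>2 T)"
proof -
  let ?U = "union_env E\<^sub>1 E\<^sub>2"
  obtain x s a where S': "S = (x, s, a)" by (cases S)
  obtain y t b where T': "T = (y, t, b)" by (cases T)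
  have mem: "x \<in> fun_space (xvars E\<^sub>1)" "a \<in> fun_space (avars E\<^sub>1)"
    "y \<in> fun_space (xvars E\<^sub>2)" "b \<in> fun_space (avars E\<^sub>2)"
    using S T by (auto simp: S' T' pstates_def)
  have evol: "evol ?U (x ++ y) (a ++ b) = cprod (++) (evol E\<^sub>1 x a) (evol E\<^sub>2 y b)"
    using map_add_restrict[OF mem(1,3) disj(1)] map_add_restrict[OF mem(2,4) disj(2)]
    by (simp add: union_env_def map_pair_pmf_cprod)
  have sub: "set_pmf (evol E\<^sub>1 x a) \<subseteq> fun_space (xvars E\<^sub>1)" "set_pmf (evol E\<^sub>2 y b) \<subseteq> fun_space (xvars E\<^sub>2)"
    using wf mem unfolding wf_env_def by blast+
  \<comment> \<open>Restriction recovers both parts of a union whose parts have the right domains;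
    outcomes in the supports do.\<close>
  have meas: "meas ?U (x' ++ y') = cprod (++) (meas E\<^sub>1 x') (meas E\<^sub>2 y')"
    if "x' \<in> set_pmf (evol E\<^sub>1 x a)" "y' \<in> set_pmf (evol E\<^sub>2 y b)" for x' y'
    using map_add_restrict[OF subsetD[OF sub(1) that(1)] subsetD[OF sub(2) that(2)] disj(1)]
    by (simp add: union_env_def map_pair_pmf_cprod)
  have "next_env ?U (union_pstate S T) =
      bind_pmf (evol E\<^sub>2 y b) (\<lambda>y'. bind_pmf (evol E\<^sub>1 x a) (\<lambda>x'.
        map_pmf (\<lambda>s'. (x' ++ y', s', a ++ b)) (meas ?U (x' ++ y'))))"
    by (simp add: S' T' evol cprod_def bind_assoc_pmf bind_map_pmf)
  also have "\<dots> = bind_pmf (evol E\<^sub>2 y b) (\<lambda>y'. bind_pmf (evol E\<^sub>1 x a) (\<lambda>x'.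
        bind_pmf (meas E\<^sub>2 y') (\<lambda>t'. map_pmf (\<lambda>s'. (x' ++ y', s' ++ t', a ++ b)) (meas E\<^sub>1 x'))))"
    by (intro bind_pmf_cong refl) (simp add: meas cprod_def map_bind_pmf pmf.map_comp o_def)
  \<comment> \<open>The left evolution and the right measurement are independent draws and are
    exchanged.\<close>
  also have "\<dots> = bind_pmf (evol E\<^sub>2 y b) (\<lambda>y'. bind_pmf (meas E\<^sub>2 y') (\<lambda>t'.
        bind_pmf (evol E\<^sub>1 x a) (\<lambda>x'. map_pmf (\<lambda>s'. (x' ++ y', s' ++ t', a ++ b)) (meas E\<^sub>1 x'))))"
    by (subst bind_commute_pmf) (rule refl)
  also have "\<dots> = cprod union_pstate (next_env E\<^sub>1 S) (next_env E\<^sub>2 T)"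
    by (simp add: S' T' cprod_def bind_assoc_pmf bind_map_pmf map_bind_pmf pmf.map_comp o_def)
  finally show ?thesis .
qed

lemma cprod_union_cps:
  "cprod union_cps (sys_pmf E\<^sub>1 \<sigma>\<^sub>1 \<pi>\<^sub>1) (sys_pmf E\<^sub>2 \<sigma>\<^sub>2 \<pi>\<^sub>2) =
    sys_pmf (union_env E\<^sub>1 E\<^sub>2) (cprod union_pstate \<sigma>\<^sub>1 \<sigma>\<^sub>2) (par_pmf \<pi>\<^sub>1 \<pi>\<^sub>2)"
proof -
  let ?U = "union_env E\<^sub>1 E\<^sub>2"
  have "cprod union_cps (sys_pmf E\<^sub>1 \<sigma>\<^sub>1 \<pi>\<^sub>1) (sys_pmf E\<^sub>2 \<sigma>\<^sub>2 \<pi>\<^sub>2) =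
      bind_pmf \<pi>\<^sub>2 (\<lambda>Q. bind_pmf \<sigma>\<^sub>2 (\<lambda>T. bind_pmf \<pi>\<^sub>1 (\<lambda>P.
        map_pmf (\<lambda>S. Sys ?U (union_pstate S T) (PPar P Q)) \<sigma>\<^sub>1)))"
    by (simp add: cprod_def sys_pmf_bind bind_assoc_pmf bind_map_pmf map_bind_pmf pmf.map_comp o_def)
  also have "\<dots> = bind_pmf \<pi>\<^sub>2 (\<lambda>Q. bind_pmf \<pi>\<^sub>1 (\<lambda>P. bind_pmf \<sigma>\<^sub>2 (\<lambda>T.
        map_pmf (\<lambda>S. Sys ?U (union_pstate S T) (PPar P Q)) \<sigma>\<^sub>1)))"
    by (subst bind_commute_pmf) (rule refl)
  also have "\<dots> = sys_pmf ?U (cprod union_pstate \<sigma>\<^sub>1 \<sigma>\<^sub>2) (par_pmf \<pi>\<^sub>1 \<pi>\<^sub>2)"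
    by (simp add: cprod_def sys_pmf_bind par_pmf_bind bind_assoc_pmf bind_map_pmf map_bind_pmf pmf.map_comp o_def)
  finally show ?thesis .
qed

text \<open>Well-formedness puts the sensor or actuator of a physical label into the part owned by
  the component that uses it, and disjointness keeps it out of the other part. So a physical move
  acts in the union as it does alone.\<close>

lemma union_cps_instant:
  assumes wf: "wf_cps M" "wf_cps K" and disj: "phys_disjoint M K" and alive: "alive M" "alive K"
    and "\<alpha> \<noteq> Tick"
  shows "cps_trans (M \<uplus> K) \<alpha> \<gamma> \<longleftrightarrow>
    (\<exists>\<delta>. cps_trans M \<alpha> \<delta> \<and> \<gamma> = map_pmf (\<lambda>M'. M' \<uplus> K) \<delta>) \<or>
    (\<exists>\<kappa>. cps_trans K \<alpha> \<kappa> \<and> \<gamma> = map_pmf (union_cps M) \<kappa>) \<or>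
    (\<exists>\<beta> \<beta>' \<delta> \<kappa>. \<alpha> = Tau \<and> co \<beta> \<beta>' \<and> cps_trans M \<beta> \<delta> \<and> cps_trans K \<beta>' \<kappa> \<and>
      \<gamma> = cprod union_cps \<delta> \<kappa>)"
proof -
  from alive obtain E\<^sub>1 S\<^sub>1 P\<^sub>1 E\<^sub>2 S\<^sub>2 P\<^sub>2 where M: "M = Sys E\<^sub>1 S\<^sub>1 P\<^sub>1" and K: "K = Sys E\<^sub>2 S\<^sub>2 P\<^sub>2"
    by (cases M; cases K) auto
  let ?U = "union_env E\<^sub>1 E\<^sub>2" and ?S = "union_pstate S\<^sub>1 S\<^sub>2"
  have w1: "S\<^sub>1 \<in> pstates E\<^sub>1" "ok_proc P\<^sub>1" "fpv P\<^sub>1 = {}" "fv P\<^sub>1 = {}" "pdom P\<^sub>1 \<subseteq> svars E\<^sub>1 <+> avars E\<^sub>1"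
    and w2: "S\<^sub>2 \<in> pstates E\<^sub>2" "ok_proc P\<^sub>2" "fpv P\<^sub>2 = {}" "fv P\<^sub>2 = {}" "pdom P\<^sub>2 \<subseteq> svars E\<^sub>2 <+> avars E\<^sub>2"
    using wf by (auto simp: M K wf_cps_Sys_iff wf_proc_def simp del: wf_cps.simps)
  have disj': "xvars E\<^sub>1 \<inter> xvars E\<^sub>2 = {}" "svars E\<^sub>1 \<inter> svars E\<^sub>2 = {}" "avars E\<^sub>1 \<inter> avars E\<^sub>2 = {}"
    using disj by (auto simp: M K)
  have inv1: "in_inv S\<^sub>1 E\<^sub>1" and inv2: "in_inv S\<^sub>2 E\<^sub>2" using alive by (auto simp: M K)
  have inv: "in_inv ?S ?U" using in_inv_union[OF w1(1) w2(1) disj'(1)] inv1 inv2 by blast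
  have doms: "dom (fst (snd S\<^sub>2)) = svars E\<^sub>2" "dom (snd (snd S\<^sub>2)) = avars E\<^sub>2"
    using w2(1) by (simp_all add: pstates_def fun_space_def mem_Times_iff)
  have sens: "fst (snd ?S) = fst (snd S\<^sub>1) ++ fst (snd S\<^sub>2)" by (cases S\<^sub>1; cases S\<^sub>2) auto
  have left: "run ?U ?S l (map_pmf (\<lambda>P'. PPar P' P\<^sub>2) \<pi>) =
      (\<lambda>(\<alpha>, \<gamma>). (\<alpha>, map_pmf (\<lambda>M'. M' \<uplus> K) \<gamma>)) ` run E\<^sub>1 S\<^sub>1 l \<pi>" if "pstep P\<^sub>1 l \<pi>" for l \<pi>
  proof (rule run_map[where u = "\<lambda>S. union_pstate S S\<^sub>2"])
    note lab = pstep_phys_label[OF that w1(2,3)]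
    show "fst (snd ?S) s = fst (snd S\<^sub>1) s" if "l = Rd s z" for s z
    proof -
      have "s \<notin> dom (fst (snd S\<^sub>2))" using lab that w1(5) disj'(2) doms(1) by auto
      then show ?thesis by (simp add: sens map_add_dom_app_simps)
    qed
    show "union_pstate (upd S\<^sub>1 b r) S\<^sub>2 = upd ?S b r" if "l = Wr b v" for b v r
      using lab that w1(5) disj'(3) doms(2) by (intro union_pstate_upd_left) auto
  qed (use w2(4) in \<open>auto simp: K subst_fresh\<close>)
  \<comment> \<open>As \<open>++\<close> is biased to the right, reads of sensors in the right
    domain and updates of the right state pass through it directly.\<close>
  have right: "run ?U ?S l (map_pmf (PPar P\<^sub>1) \<pi>) =
      (\<lambda>(\<alpha>, \<gamma>). (\<alpha>, map_pmf (union_cps M) \<gamma>)) ` run E\<^sub>2 S\<^sub>2 l \<pi>" if "pstep P\<^sub>2 l \<pi>" for l \<pi>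
  proof (rule run_map[where u = "union_pstate S\<^sub>1"])
    note lab = pstep_phys_label[OF that w2(2,3)]
    show "fst (snd ?S) s = fst (snd S\<^sub>2) s" if "l = Rd s z" for s z
      using lab that w2(5) doms(1) by (auto simp: sens map_add_dom_app_simps(1))
  qed (use w1(4) in \<open>auto simp: M subst_fresh union_pstate_upd_right\<close>)
  have right': "(\<exists>l \<pi>. pstep P\<^sub>2 l \<pi> \<and> (\<alpha>, \<gamma>) \<in> run ?U ?S l (map_pmf (PPar P\<^sub>1) \<pi>)) \<longleftrightarrow>
      (\<exists>\<kappa>. cps_trans K \<alpha> \<kappa> \<and> \<gamma> = map_pmf (union_cps M) \<kappa>)"
  proof -
    have img: "(\<alpha>, \<gamma>) \<in> run ?U ?S l (map_pmf (PPar P\<^sub>1) \<pi>) \<longleftrightarrow>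
        (\<exists>\<kappa>. (\<alpha>, \<kappa>) \<in> run E\<^sub>2 S\<^sub>2 l \<pi> \<and> \<gamma> = map_pmf (union_cps M) \<kappa>)" if "pstep P\<^sub>2 l \<pi>" for l \<pi>
      unfolding right[OF that] by auto
    have "(\<exists>l \<pi>. pstep P\<^sub>2 l \<pi> \<and> (\<alpha>, \<gamma>) \<in> run ?U ?S l (map_pmf (PPar P\<^sub>1) \<pi>)) \<longleftrightarrow>
        (\<exists>l \<pi>. pstep P\<^sub>2 l \<pi> \<and> (\<exists>\<kappa>. (\<alpha>, \<kappa>) \<in> run E\<^sub>2 S\<^sub>2 l \<pi> \<and> \<gamma> = map_pmf (union_cps M) \<kappa>))"
      by (intro ex_cong1 conj_cong refl img)
    then show ?thesis unfolding K cps_trans_instant[OF inv2 \<open>\<alpha> \<noteq> Tick\<close>] by blast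
  qed
  have com: "(\<exists>\<beta> \<beta>' \<pi>\<^sub>1 \<pi>\<^sub>2. co \<beta> \<beta>' \<and> pstep P\<^sub>1 (Act \<beta>) \<pi>\<^sub>1 \<and> pstep P\<^sub>2 (Act \<beta>') \<pi>\<^sub>2 \<and>
        \<gamma> = map_pmf (Sys ?U ?S) (par_pmf \<pi>\<^sub>1 \<pi>\<^sub>2)) \<longleftrightarrow>
      (\<exists>\<beta> \<beta>' \<delta> \<kappa>. co \<beta> \<beta>' \<and> cps_trans M \<beta> \<delta> \<and> cps_trans K \<beta>' \<kappa> \<and> \<gamma> = cprod union_cps \<delta> \<kappa>)"
  proof -
    have *: "map_pmf (Sys ?U ?S) (par_pmf \<pi>\<^sub>1 \<pi>\<^sub>2) =
        cprod union_cps (map_pmf (Sys E\<^sub>1 S\<^sub>1) \<pi>\<^sub>1) (map_pmf (Sys E\<^sub>2 S\<^sub>2) \<pi>\<^sub>2)" for \<pi>\<^sub>1 \<pi>\<^sub>2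
      using cprod_union_cps[of E\<^sub>1 "return_pmf S\<^sub>1" \<pi>\<^sub>1 E\<^sub>2 "return_pmf S\<^sub>2" \<pi>\<^sub>2]
      by (simp add: sys_pmf_return cprod_def[of union_pstate] bind_return_pmf)
    have 1: "cps_trans M \<beta> \<delta> \<longleftrightarrow> (\<exists>\<pi>. pstep P\<^sub>1 (Act \<beta>) \<pi> \<and> \<delta> = map_pmf (Sys E\<^sub>1 S\<^sub>1) \<pi>)"
      "cps_trans K \<beta>' \<delta> \<longleftrightarrow> (\<exists>\<pi>. pstep P\<^sub>2 (Act \<beta>') \<pi> \<and> \<delta> = map_pmf (Sys E\<^sub>2 S\<^sub>2) \<pi>)" if "co \<beta> \<beta>'" for \<beta> \<beta>' \<delta>
      using that inv1 inv2 co_not_Tau[OF that] by (cases "(\<beta>, \<beta>')" rule: co.cases; simp add: M K cps_trans_visible)+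
    show ?thesis unfolding * using 1 by metis
  qed
  show ?thesis
    using cps_trans_PPar[OF inv \<open>\<alpha> \<noteq> Tick\<close> left inv1] right' com unfolding M K union_cps.simps by blast
qed

text \<open>If the union has no \<tau>-move, neither has a component, so the ticks of both meet
  their own negative premises; their next states combine to that of the union.\<close>

lemma union_cps_tick:
  assumes wf: "wf_cps M" "wf_cps K" and disj: "phys_disjoint M K" and alive: "alive M" "alive K"
  shows "cps_trans (M \<uplus> K) Tick \<gamma> \<longleftrightarrow> (\<nexists>\<delta>. cps_trans (M \<uplus> K) Tau \<delta>) \<and>
    (\<exists>\<delta> \<kappa>. cps_trans M Tick \<delta> \<and> cps_trans K Tick \<kappa> \<and> \<gamma> = cprod union_cps \<delta> \<kappa>)"
proof -
  from alive obtain E\<^sub>1 S\<^sub>1 P\<^sub>1 E\<^sub>2 S\<^sub>2 P\<^sub>2 where M: "M = Sys E\<^sub>1 S\<^sub>1 P\<^sub>1" and K: "K = Sys E\<^sub>2 S\<^sub>2 P\<^sub>2"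
    by (cases M; cases K) auto
  let ?U = "union_env E\<^sub>1 E\<^sub>2" and ?S = "union_pstate S\<^sub>1 S\<^sub>2"
  have w: "S\<^sub>1 \<in> pstates E\<^sub>1" "S\<^sub>2 \<in> pstates E\<^sub>2" "wf_env E\<^sub>1" "wf_env E\<^sub>2"
    using wf by (auto simp: M K wf_cps_Sys_iff simp del: wf_cps.simps)
  have disj': "xvars E\<^sub>1 \<inter> xvars E\<^sub>2 = {}" "avars E\<^sub>1 \<inter> avars E\<^sub>2 = {}"
    using disj by (auto simp: M K)
  have inv1: "in_inv S\<^sub>1 E\<^sub>1" and inv2: "in_inv S\<^sub>2 E\<^sub>2" using alive by (auto simp: M K)
  have inv: "in_inv ?S ?U" using in_inv_union[OF w(1,2) disj'(1)] inv1 inv2 by blast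
  note ptick = cps_trans_PPar_tick[OF inv, of P\<^sub>1 P\<^sub>2 \<gamma>]
  show ?thesis
  proof (cases "\<exists>\<delta>. cps_trans (M \<uplus> K) Tau \<delta>")
    case True
    then show ?thesis using ptick unfolding M K union_cps.simps by blast
  next
    case False
    then have "\<nexists>\<delta>. cps_trans M Tau \<delta>" "\<nexists>\<delta>. cps_trans K Tau \<delta>"
      using union_cps_instant[OF assms, of Tau] by auto
    then have MK: "cps_trans M Tick \<delta> \<longleftrightarrow> (\<exists>\<pi>. ptick P\<^sub>1 \<pi> \<and> \<delta> = sys_pmf E\<^sub>1 (next_env E\<^sub>1 S\<^sub>1) \<pi>)"
      "cps_trans K Tick \<delta> \<longleftrightarrow> (\<exists>\<pi>. ptick P\<^sub>2 \<pi> \<and> \<delta> = sys_pmf E\<^sub>2 (next_env E\<^sub>2 S\<^sub>2) \<pi>)" for \<delta>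
      using inv1 inv2 by (simp_all add: M K cps_trans_tick)
    have "cps_trans (M \<uplus> K) Tick \<gamma> \<longleftrightarrow> (\<exists>\<pi>\<^sub>1 \<pi>\<^sub>2. ptick P\<^sub>1 \<pi>\<^sub>1 \<and> ptick P\<^sub>2 \<pi>\<^sub>2 \<and>
        \<gamma> = sys_pmf ?U (next_env ?U ?S) (par_pmf \<pi>\<^sub>1 \<pi>\<^sub>2))"
      using False ptick unfolding M K union_cps.simps by blast
    also have "\<dots> \<longleftrightarrow> (\<exists>\<delta> \<kappa>. cps_trans M Tick \<delta> \<and> cps_trans K Tick \<kappa> \<and> \<gamma> = cprod union_cps \<delta> \<kappa>)"
      unfolding MK next_env_union[OF w(3,4) disj' w(1,2)] cprod_union_cps[symmetric] by blast
    finally show ?thesis using False by simp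
  qed
qed

text \<open>A \<open>K\<close> outside its invariant has a \<tau>-move to \<open>Dead\<close>,
  whereas instantaneous context moves must end inside the invariant; this is why
  \<open>alive K\<close> is part of the steps. \<open>Tick\<close> is excluded there because time
  passes jointly.\<close>

interpretation union: cps_context "union_cps :: ('x, 's, 'a, 'c) cps \<Rightarrow> ('x, 's, 'a, 'c) cps \<Rightarrow> ('x, 's, 'a, 'c) cps"
  "\<lambda>M K. wf_cps M \<and> wf_cps K \<and> phys_disjoint M K" alive "\<lambda>K \<alpha>. True"
  "\<lambda>K \<alpha> \<kappa>. alive K \<and> \<alpha> \<noteq> Tick \<and> cps_trans K \<alpha> \<kappa>" "\<lambda>K \<kappa>. cps_trans K Tick \<kappa>"
proof
  fix M K :: "('x, 's, 'a, 'c) cps"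
  assume c: "wf_cps M \<and> wf_cps K \<and> phys_disjoint M K"
  then have wf: "wf_cps M" "wf_cps K" and disj: "phys_disjoint M K" by auto
  show "wf_cps (M \<uplus> K)" "wf_cps M" using wf_cps_union[OF wf disj] wf by auto
  show alive_iff: "alive (M \<uplus> K) \<longleftrightarrow> alive M \<and> alive K"
    using wf disj by (cases M; cases K) (auto simp: wf_cps_Sys_iff in_inv_union simp del: wf_cps.simps)
  show "wf_cps M' \<and> wf_cps K \<and> phys_disjoint M' K" if "cps_trans M \<alpha> \<delta>" "M' \<in> set_pmf \<delta>" for M' \<alpha> \<delta>
    using cps_trans_wf(2)[OF that(1) wf(1) that(2)] phys_disjoint_trans[OF disj that(1) wf(1) that(2)] wf by blast
  have K: "wf_cps M \<and> wf_cps K' \<and> phys_disjoint M K'" if "cps_trans K \<alpha> \<kappa>" "K' \<in> set_pmf \<kappa>" for K' \<alpha> \<kappa>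
    using cps_trans_wf(2)[OF that(1) wf(2) that(2)] wf
      phys_disjoint_sym[OF phys_disjoint_trans[OF phys_disjoint_sym[OF disj] that(1) wf(2) that(2)]] by blast
  show "(wf_cps M \<and> wf_cps K' \<and> phys_disjoint M K') \<and> alive K'"
    if "alive K \<and> \<alpha> \<noteq> Tick \<and> cps_trans K \<alpha> \<kappa>" "K' \<in> set_pmf \<kappa>" for \<alpha> \<kappa> K'
    using K[of \<alpha> \<kappa> K'] cps_trans_alive[of K \<alpha> \<kappa> K'] that wf by blast
  show "wf_cps M \<and> wf_cps K' \<and> phys_disjoint M K'" if "cps_trans K Tick \<kappa>" "K' \<in> set_pmf \<kappa>" for \<kappa> K'
    using K[OF that] .
  show "finite (set_pmf \<kappa>)" if "alive K \<and> \<alpha> \<noteq> Tick \<and> cps_trans K \<alpha> \<kappa>" for \<alpha> \<kappa>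
    using cps_trans_wf(1) that wf by blast
  show "finite (set_pmf \<kappa>)" if "cps_trans K Tick \<kappa>" for \<kappa>
    using cps_trans_wf(1)[OF that wf(2)] .
  note instant = union_cps_instant[OF wf disj] and tick = union_cps_tick[OF wf disj]
  show "cps_trans (M \<uplus> K) \<alpha> (map_pmf (\<lambda>M'. M' \<uplus> K) \<delta>)"
    if "alive K" "cps_trans M \<alpha> \<delta>" "\<alpha> \<noteq> Tick" for \<alpha> \<delta>
  proof (cases "alive M")
    case True
    with that instant show ?thesis by blast
  next
    case False
    have "M \<noteq> Dead" "K \<noteq> Dead" using that by auto
    \<comment> \<open>A union other than \<open>Dead\<close> still has the move to
      \<open>Dead\<close> that answers the one of \<open>M\<close>.\<close>
    then have "M \<uplus> K \<noteq> Dead" by (cases M; cases K) auto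
    with False show ?thesis
      using not_alive_trans[OF that(2)] alive_iff by (auto simp: cps_trans_not_alive)
  qed
  show "cps_trans (M \<uplus> K) \<alpha> (map_pmf (union_cps M) \<kappa>)"
    if "alive M" "alive K" "alive K \<and> \<alpha> \<noteq> Tick \<and> cps_trans K \<alpha> \<kappa>" for \<alpha> \<kappa>
    using instant[OF that(1,2)] that(3) by blast
  show "cps_trans (M \<uplus> K) Tau (cprod union_cps \<delta> \<kappa>)"
    if "alive K" "cps_trans M \<alpha> \<delta>" "alive K \<and> \<beta> \<noteq> Tick \<and> cps_trans K \<beta> \<kappa>" "co \<alpha> \<beta>" for \<alpha> \<beta> \<delta> \<kappa>
    using instant[OF cps_trans_imp_alive[OF that(2)] that(1), of Tau] co_not_Tau[OF that(4)] that by blast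
  show "cps_trans (M \<uplus> K) Tick (cprod union_cps \<delta> \<kappa>)"
    if "alive K" "cps_trans M Tick \<delta>" "cps_trans K Tick \<kappa>" "\<nexists>\<gamma>. cps_trans (M \<uplus> K) Tau \<gamma>" for \<delta> \<kappa>
    using tick[OF cps_trans_imp_alive[OF that(2)] that(1)] that by blast
  show "(\<exists>\<delta>. cps_trans M \<alpha> \<delta> \<and> \<alpha> \<noteq> Tick \<and> True \<and> \<gamma> = map_pmf (\<lambda>M'. M' \<uplus> K) \<delta>) \<or>
      (\<exists>\<kappa>. (alive K \<and> \<alpha> \<noteq> Tick \<and> cps_trans K \<alpha> \<kappa>) \<and> \<gamma> = map_pmf (union_cps M) \<kappa>) \<or>
      (\<exists>\<beta> \<beta>' \<delta> \<kappa>. \<alpha> = Tau \<and> co \<beta> \<beta>' \<and> cps_trans M \<beta> \<delta> \<and> (alive K \<and> \<beta>' \<noteq> Tick \<and> cps_trans K \<beta>' \<kappa>) \<and>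
        \<gamma> = cprod union_cps \<delta> \<kappa>) \<or>
      (\<exists>\<delta> \<kappa>. \<alpha> = Tick \<and> cps_trans M Tick \<delta> \<and> cps_trans K Tick \<kappa> \<and> \<gamma> = cprod union_cps \<delta> \<kappa>)"
    if alive: "alive M" "alive K" and \<gamma>: "cps_trans (M \<uplus> K) \<alpha> \<gamma>" for \<alpha> \<gamma>
  proof (cases "\<alpha> = Tick")
    case True
    with tick[OF alive] \<gamma> show ?thesis by blast
  next
    case False
    have "\<beta>' \<noteq> Tick" if "co \<beta> \<beta>'" for \<beta> \<beta>' :: "('x, 's, 'a, 'c) act"
      using that by (cases "(\<beta>, \<beta>')" rule: co.cases) auto
    then have co: "co \<beta> \<beta>' \<longleftrightarrow> co \<beta> \<beta>' \<and> alive K \<and> \<beta>' \<noteq> Tick" for \<beta> \<beta>' :: "('x, 's, 'a, 'c) act"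
      using alive(2) by blast
    from instant[OF alive False, THEN iffD1, OF \<gamma>] show ?thesis
    proof (elim disjE)
      assume "\<exists>\<delta>. cps_trans M \<alpha> \<delta> \<and> \<gamma> = map_pmf (\<lambda>M'. M' \<uplus> K) \<delta>"
      with False show ?thesis by blast
    next
      assume "\<exists>\<kappa>. cps_trans K \<alpha> \<kappa> \<and> \<gamma> = map_pmf (union_cps M) \<kappa>"
      with False alive(2) show ?thesis by blast
    next
      assume "\<exists>\<beta> \<beta>' \<delta> \<kappa>. \<alpha> = Tau \<and> co \<beta> \<beta>' \<and> cps_trans M \<beta> \<delta> \<and> cps_trans K \<beta>' \<kappa> \<and>
        \<gamma> = cprod union_cps \<delta> \<kappa>"
      then obtain \<beta> \<beta>' \<delta> \<kappa> where "\<alpha> = Tau" "co \<beta> \<beta>'" "cps_trans M \<beta> \<delta>" "cps_trans K \<beta>' \<kappa>"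
        "\<gamma> = cprod union_cps \<delta> \<kappa>" by blast
      with co show ?thesis by blast
    qed
  qed
qed auto

theorem theorem2:
  fixes M N :: "('x, 's, 'a, 'c) cps"
  assumes "wf_cps M" and "wf_cps N"
  shows "(M \<approx>\<^sub>p N \<longrightarrow> (\<forall>K. wf_cps K \<and> phys_disjoint M K \<and> phys_disjoint N K \<longrightarrow> M \<uplus> K \<approx>\<^sub>p N \<uplus> K)) \<and>
    (M \<approx>\<^sub>p N \<longrightarrow> (\<forall>P. wf_proc P \<and> pure_logical P \<longrightarrow> M \<parallel> P \<approx>\<^sub>p N \<parallel> P)) \<and>
    (M \<approx>\<^sub>p N \<longrightarrow> (\<forall>c. M \<setminus> c \<approx>\<^sub>p N \<setminus> c))"
proof (intro conjI impI allI)
  assume MN: "M \<approx>\<^sub>p N"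
  show "M \<uplus> K \<approx>\<^sub>p N \<uplus> K" if "wf_cps K \<and> phys_disjoint M K \<and> phys_disjoint N K" for K
    by (rule union.bisimilar_comp[OF MN]) (use assms that in auto)
  show "M \<parallel> P \<approx>\<^sub>p N \<parallel> P" if "wf_proc P \<and> pure_logical P" for P
    by (rule par.bisimilar_comp[OF MN]) (use assms that in auto)
  show "M \<setminus> c \<approx>\<^sub>p N \<setminus> c" for c
    by (rule res.bisimilar_comp[OF MN]) (use assms in auto)
qed

end
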